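(* The mapping $\mathcal{F}_{H,Q}$ is surjective, that is, $\mathcal{F}_{H,Q}$ maps $L^2(\mathbb{R}_+,\mathbb{C}^{2n})$ onto $L^2_\sigma(\mathbb{R})$.
   Context: Let $n\ge 1$, $\mathbb{R}_+=[0,\infty)$. Let $B=\begin{pmatrix}B_1&0\\0&-B_2\end{pmatrix}$ with $B_1,B_2\in \mathrm{M}(n,\mathbb{C})$ self-adjoint positive definite, let $H\in \mathrm{M}(n,\mathbb{C})$ satisfy $B_1=H^*B_2H$, and let $Q:\mathbb{R}_+\to \mathrm{M}(2n,\mathbb{C})$ be continuous with self-adjoint values. Put $L:=B\frac1i\frac{d}{dx}+Q(x)$ and let $Y(x,\lambda)$ be the $2n\times n$ matrix solution of $LY=\lambda Y$, $Y(0,\lambda)=\binom{I}{H}$. An $n\times n$ matrix function $\sigma=(\sigma_{ij})$ on $\mathbb{R}$ is increasing if its values are self-adjoint and $\sigma(\lambda)-\sigma(\mu)\ge 0$ for $\mu<\lambda$. For such $\sigma$, $L^2_\sigma(\mathbb{R})$ is the Hilbert space completion of $C_0(\mathbb{R},\mathbb{C}^n)$ (continuous functions with compact support) with respect to $(f,g)_{L^2_\sigma}:=\int_{\mathbb{R}} f^*\,d\sigma\, g:=\sum_{i,j=1}^n\int_{\mathbb{R}}\overline{f_i}\,g_j\,d\sigma_{ij}$. Here $\sigma$ is the spectral function of the boundary value problem $Lf=\lambda f$, $f_2(0)=Hf_1(0)$: the unique increasing right-continuous $n\times n$ matrix function with $\sigma(0)=0$ for which $(\mathcal{F}_{H,Q}f)(\lambda):=\int_0^\infty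 Y(x,\lambda)^*f(x)\,dx$, defined for $f\in L^2(\mathbb{R}_+,\mathbb{C}^{2n})$ with compact support, extends by continuity to an isometry $\mathcal{F}_{H,Q}:L^2(\mathbb{R}_+,\mathbb{C}^{2n})\to L^2_\sigma(\mathbb{R})$; the extension is denoted by the same letter. *)

theory Defs
  imports "HOL-Analysis.Analysis"
begin

definition cadjoint :: "complex ^ 'n ^ 'm \<Rightarrow> complex ^ 'm ^ 'n" where
  "cadjoint A = (\<chi> i j. cnj (A $ j $ i))"

definition cinner :: "complex ^ 'n \<Rightarrow> complex ^ 'n::finite \<Rightarrow> complex" where
  "cinner u v = (\<Sum>i\<in>UNIV. cnj (u $ i) * v $ i)"

definition self_adjoint :: "complex ^ 'n ^ 'n \<Rightarrow> bool" where
  "self_adjoint A \<longleftrightarrow> cadjoint A = A"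

definition pos_semidef :: "complex ^ 'n ^ 'n::finite \<Rightarrow> bool" where
  "pos_semidef A \<longleftrightarrow> self_adjoint A \<and> (\<forall>v. 0 \<le> Re (cinner v (A *v v)))"

definition pos_def :: "complex ^ 'n ^ 'n::finite \<Rightarrow> bool" where
  "pos_def A \<longleftrightarrow> self_adjoint A \<and> (\<forall>v. v \<noteq> 0 \<longrightarrow> 0 < Re (cinner v (A *v v)))"

text \<open>Vectors of length \<open>2n\<close> are indexed by \<^typ>\<open>'n + 'n\<close>, the summands indexing the upper and lower
  half.\<close>

definition block_diag :: "complex ^ 'n ^ 'n \<Rightarrow> complex ^ 'n ^ 'n \<Rightarrow> complex ^ ('n + 'n) ^ ('n + 'n)"
  where
  "block_diag A D = (\<chi> i j. case i of
      Inl a \<Rightarrow> (case j of Inl b \<Rightarrow> A $ a $ b | Inr b \<Rightarrow> 0)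
    | Inr a \<Rightarrow> (case j of Inl b \<Rightarrow> 0 | Inr b \<Rightarrow> D $ a $ b))"

definition block_col :: "complex ^ 'n ^ 'n \<Rightarrow> complex ^ 'n ^ 'n \<Rightarrow> complex ^ 'n ^ ('n + 'n)" where
  "block_col A C = (\<chi> i. case i of Inl a \<Rightarrow> A $ a | Inr a \<Rightarrow> C $ a)"

text \<open>\<open>LY = \<lambda>Y\<close> on \<open>[0,\<infinity>)\<close> for \<open>L = B (1/i) d/dx + Q(x)\<close>, with one-sided derivative at \<open>0\<close>.\<close>

definition solves_system ::
  "complex ^ 'm ^ 'm \<Rightarrow> (real \<Rightarrow> complex ^ 'm ^ 'm) \<Rightarrow> complex \<Rightarrow> (real \<Rightarrow> complex ^ 'n ^ 'm::finite) \<Rightarrow> bool"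
  where
  "solves_system B Q lam Y \<longleftrightarrow>
    (\<forall>x\<ge>0. \<exists>D. (Y has_vector_derivative D) (at x within {0..}) \<and>
       B ** (mat (1 / \<i>) ** D) + Q x ** Y x = mat lam ** Y x)"

text \<open>Elements are represented by functions, not by classes modulo almost everywhere equality;
  values on the negative axis are irrelevant.\<close>

definition L2_half_line :: "(real \<Rightarrow> complex ^ 'm::finite) set" where
  "L2_half_line = {f. f \<in> borel_measurable (lebesgue_on {0..}) \<and>
                      integrable (lebesgue_on {0..}) (\<lambda>x. (norm (f x))\<^sup>2)}"

definition L2_half_line_inner ::
  "(real \<Rightarrow> complex ^ 'm::finite) \<Rightarrow> (real \<Rightarrow> complex ^ 'm) \<Rightarrow> complex" where
  "L2_half_line_inner f g = (LINT x|lebesgue_on {0..}. cinner (f x) (g x))"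

definition L2_half_line_compact :: "(real \<Rightarrow> complex ^ 'm::finite) set" where
  "L2_half_line_compact =
     {f \<in> L2_half_line. \<exists>R. AE x in lebesgue_on {0..}. x > R \<longrightarrow> f x = 0}"

text \<open>Riemann--Stieltjes integral over \<open>[a,b]\<close>. It exists for continuous \<open>h\<close> and \<open>g\<close> of bounded
  variation; if \<open>g\<close> is right-continuous it is the Lebesgue--Stieltjes integral over \<open>(a,b]\<close>.\<close>

definition has_RS_integral ::
  "(real \<Rightarrow> complex) \<Rightarrow> (real \<Rightarrow> complex) \<Rightarrow> real \<Rightarrow> real \<Rightarrow> complex \<Rightarrow> bool" where
  "has_RS_integral h g a b I \<longleftrightarrow>
    (\<forall>e>0. \<exists>d>0. \<forall>p. p tagged_division_of {a..b} \<and> (\<lambda>x. ball x d) fine p \<longrightarrow>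
       norm ((\<Sum>(x, K)\<in>p. h x * (g (Sup K) - g (Inf K))) - I) < e)"

definition RS_integral ::
  "(real \<Rightarrow> complex) \<Rightarrow> (real \<Rightarrow> complex) \<Rightarrow> real \<Rightarrow> real \<Rightarrow> complex" where
  "RS_integral h g a b = (THE I. has_RS_integral h g a b I)"

definition increasing_matrix :: "(real \<Rightarrow> complex ^ 'n ^ 'n::finite) \<Rightarrow> bool" where
  "increasing_matrix \<sigma> \<longleftrightarrow>
    (\<forall>l. self_adjoint (\<sigma> l)) \<and> (\<forall>l m. m < l \<longrightarrow> pos_semidef (\<sigma> l - \<sigma> m))"

text \<open>\<open>\<integral>\<^sub>\<real> f\<^sup>* d\<sigma> g = (\<Sum>i j. \<integral>\<^sub>\<real> cnj f\<^sub>i \<cdot> g\<^sub>j d\<sigma>\<^sub>i\<^sub>j)\<close>. The sum over \<open>i, j\<close> is taken before the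
  limit of the windows \<open>[-R,R]\<close>: for \<open>f, g\<close> of compact support this makes no difference, but for
  \<open>f = g\<close> of finite norm and unbounded support the individual integrals may diverge.\<close>

definition has_sigma_inner ::
  "(real \<Rightarrow> complex ^ 'n ^ 'n::finite) \<Rightarrow> (real \<Rightarrow> complex ^ 'n) \<Rightarrow> (real \<Rightarrow> complex ^ 'n) \<Rightarrow> complex \<Rightarrow> bool"
  where
  "has_sigma_inner \<sigma> f g c \<longleftrightarrow>
    ((\<lambda>R. \<Sum>i\<in>UNIV. \<Sum>j\<in>UNIV.
        RS_integral (\<lambda>l. cnj (f l $ i) * g l $ j) (\<lambda>l. \<sigma> l $ i $ j) (- R) R) \<longlongrightarrow> c) at_top"

definition sigma_inner ::
  "(real \<Rightarrow> complex ^ 'n ^ 'n::finite) \<Rightarrow> (real \<Rightarrow> complex ^ 'n) \<Rightarrow> (real \<Rightarrow> complex ^ 'n) \<Rightarrow> complex"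
  where
  "sigma_inner \<sigma> f g = (THE c. has_sigma_inner \<sigma> f g c)"

definition sigma_norm ::
  "(real \<Rightarrow> complex ^ 'n ^ 'n::finite) \<Rightarrow> (real \<Rightarrow> complex ^ 'n) \<Rightarrow> real" where
  "sigma_norm \<sigma> f = sqrt (Re (sigma_inner \<sigma> f f))"

definition C0 :: "(real \<Rightarrow> complex ^ 'n::finite) set" where
  "C0 = {f. continuous_on UNIV f \<and> compact (closure {l. f l \<noteq> 0})}"

text \<open>The Hilbert space completion of \<^const>\<open>C0\<close>: Cauchy sequences modulo null sequences.\<close>

definition sigma_Cauchy ::
  "(real \<Rightarrow> complex ^ 'n ^ 'n::finite) \<Rightarrow> (nat \<Rightarrow> real \<Rightarrow> complex ^ 'n) set" where
  "sigma_Cauchy \<sigma> = {u. (\<forall>k. u k \<in> C0) \<and>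
     (\<forall>e>0. \<exists>N. \<forall>k\<ge>N. \<forall>m\<ge>N. sigma_norm \<sigma> (\<lambda>l. u k l - u m l) < e)}"

definition sigma_equiv ::
  "(real \<Rightarrow> complex ^ 'n ^ 'n::finite) \<Rightarrow> (nat \<Rightarrow> real \<Rightarrow> complex ^ 'n) rel" where
  "sigma_equiv \<sigma> = {(u, v). u \<in> sigma_Cauchy \<sigma> \<and> v \<in> sigma_Cauchy \<sigma> \<and>
     (\<lambda>k. sigma_norm \<sigma> (\<lambda>l. u k l - v k l)) \<longlonglongrightarrow> 0}"

definition L2_sigma ::
  "(real \<Rightarrow> complex ^ 'n ^ 'n::finite) \<Rightarrow> (nat \<Rightarrow> real \<Rightarrow> complex ^ 'n) set set" where
  "L2_sigma \<sigma> = sigma_Cauchy \<sigma> // sigma_equiv \<sigma>"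

definition L2_sigma_inner ::
  "(real \<Rightarrow> complex ^ 'n ^ 'n::finite) \<Rightarrow> (nat \<Rightarrow> real \<Rightarrow> complex ^ 'n) set \<Rightarrow>
     (nat \<Rightarrow> real \<Rightarrow> complex ^ 'n) set \<Rightarrow> complex" where
  "L2_sigma_inner \<sigma> \<xi> \<eta> =
     (THE c. \<exists>u\<in>\<xi>. \<exists>v\<in>\<eta>. (\<lambda>k. sigma_inner \<sigma> (u k) (v k)) \<longlonglongrightarrow> c)"

text \<open>The element of \<^term>\<open>L2_sigma \<sigma>\<close> given by a continuous function \<open>G\<close>, not necessarily of compact
  support: all sequences \<open>u\<close> in \<^const>\<open>C0\<close> such that \<open>\<integral>\<^sub>\<real> (G - u\<^sub>k)\<^sup>* d\<sigma> (G - u\<^sub>k)\<close> is finite and tends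
  to \<open>0\<close>. If \<open>\<integral>\<^sub>\<real> G\<^sup>* d\<sigma> G\<close> diverges, this set is empty and hence not a member of \<^term>\<open>L2_sigma \<sigma>\<close>.\<close>

definition sigma_class ::
  "(real \<Rightarrow> complex ^ 'n ^ 'n::finite) \<Rightarrow> (real \<Rightarrow> complex ^ 'n) \<Rightarrow>
     (nat \<Rightarrow> real \<Rightarrow> complex ^ 'n) set" where
  "sigma_class \<sigma> G = {u \<in> sigma_Cauchy \<sigma>. \<exists>c.
     (\<forall>k. has_sigma_inner \<sigma> (\<lambda>l. G l - u k l) (\<lambda>l. G l - u k l) (c k)) \<and> c \<longlonglongrightarrow> 0}"

definition spectral_transform ::
  "(real \<Rightarrow> complex \<Rightarrow> complex ^ 'n ^ 'm) \<Rightarrow> (real \<Rightarrow> complex ^ 'm) \<Rightarrow> real \<Rightarrow> complex ^ 'n::finite" where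
  "spectral_transform Y f l =
     (LINT x|lebesgue_on {0..}. cadjoint (Y x (complex_of_real l)) *v f x)"

text \<open>\<open>F\<close> is an isometry from \<open>L\<^sup>2(\<real>\<^sub>+)\<close> into \<open>L\<^sup>2\<^sub>\<sigma>(\<real>)\<close> which agrees with the integral transform on
  functions of compact support. Isometries are linear maps here; between inner product spaces,
  linearity and preservation of norms together amount to preservation of inner products.\<close>

definition isometric_extension ::
  "(real \<Rightarrow> complex \<Rightarrow> complex ^ 'n ^ 'm) \<Rightarrow> (real \<Rightarrow> complex ^ 'n ^ 'n::finite) \<Rightarrow>
     ((real \<Rightarrow> complex ^ 'm::finite) \<Rightarrow> (nat \<Rightarrow> real \<Rightarrow> complex ^ 'n) set) \<Rightarrow> bool" where
  "isometric_extension Y \<sigma> F \<longleftrightarrow>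
     (\<forall>f\<in>L2_half_line. F f \<in> L2_sigma \<sigma>) \<and>
     (\<forall>f\<in>L2_half_line. \<forall>g\<in>L2_half_line. L2_sigma_inner \<sigma> (F f) (F g) = L2_half_line_inner f g) \<and>
     (\<forall>f\<in>L2_half_line_compact. F f = sigma_class \<sigma> (spectral_transform Y f))"

definition is_spectral_function ::
  "(real \<Rightarrow> complex \<Rightarrow> complex ^ 'n ^ 'm::finite) \<Rightarrow> (real \<Rightarrow> complex ^ 'n ^ 'n::finite) \<Rightarrow> bool" where
  "is_spectral_function Y \<sigma> \<longleftrightarrow>
     increasing_matrix \<sigma> \<and> (\<forall>l. continuous (at_right l) \<sigma>) \<and> \<sigma> 0 = 0 \<and>
     (\<exists>F. isometric_extension Y \<sigma> F)"

end

theory Submission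
  imports Defs
begin

text \<open>The range of the isometry is closed because \<open>L\<^sup>2\<close> is complete, so it suffices to approximate every
  function in \<^const>\<open>C0\<close> by transforms of compactly supported functions. Call a function approximable
  if this is possible. For \<open>z = \<plusminus>\<i>\<close> the problem \<open>(L - z)u = f\<close> on \<open>[0,R]\<close>, with the given condition at \<open>0\<close>
  and \<open>u\<^sub>1(R) = 0\<close> or \<open>u\<^sub>2(R) = 0\<close> according to the sign of \<open>Im z\<close>, is solvable with \<open>\<parallel>u\<parallel> \<le> \<parallel>f\<parallel>\<close>; cutting
  \<open>u\<close> off shows that multiplication by \<open>1/(\<lambda> - z)\<close> preserves approximability. By Weierstrass'
  theorem on the circle traced by \<open>(1/(1+\<lambda>\<^sup>2), \<lambda>/(1+\<lambda>\<^sup>2))\<close>, so does multiplication by every continuous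
  \<open>\<phi>\<close> of compact support. Applied to transforms of approximate delta functions at \<open>0\<close>, which converge
  locally uniformly to the unit vectors \<open>e\<^sub>i\<close>, this shows that all \<open>\<phi> e\<^sub>i\<close> are approximable.\<close>

subsection \<open>Riemann--Stieltjes integrals as limits along fine divisions\<close>

text \<open>\<open>\<sigma>\<close> is accessible only through the norm identity of the isometry, so
  the transform is never inverted; instead the closure of its range is shown to be stable under many
  multipliers. Multiplication by \<open>\<lambda>\<close> corresponds to applying \<open>L\<close>,
  but it is unbounded and does not pass to limits. The factors \<open>1/(\<lambda> - z)\<close> with
  \<open>z = \<plusminus>\<i>\<close> are bounded by 1, and having both values provides the real and
  imaginary parts that the Weierstrass theorem asks for. The endpoint \<open>R\<close> is
  artificial. The condition imposed there may depend on \<open>z\<close>, since the solution is cut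
  off before \<open>R\<close> matters; it is chosen only to give the boundary term of the energy
  identity the right sign, and the resulting bound does not depend on \<open>R\<close>. A cutoff
  with derivative of order \<open>1/R\<close> then costs little, however fast \<open>Q\<close>
  grows. Transforms have unbounded support, whereas the completion is made of sequences in
  \<open>C0\<close>. All estimates are therefore made on windows \<open>[-R,R]\<close> for every
  large \<open>R\<close> and reach the completion only at the end.\<close>

definition fine_divisions :: "real \<Rightarrow> real \<Rightarrow> (real \<times> real set) set filter" where
  "fine_divisions a b =
     (INF d\<in>{0<..}. principal {p. p tagged_division_of {a..b} \<and> (\<lambda>x. ball x d) fine p})"

lemma eventually_fine_divisions:
  "eventually P (fine_divisions a b) \<longleftrightarrow>
     (\<exists>d>0. \<forall>p. p tagged_division_of {a..b} \<and> (\<lambda>x. ball x d) fine p \<longrightarrow> P p)"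
proof -
  have "\<exists>x\<in>{0<..}. principal {p. p tagged_division_of {a..b} \<and> (\<lambda>y. ball y x) fine p}
      \<le> inf (principal {p. p tagged_division_of {a..b} \<and> (\<lambda>y. ball y d) fine p})
            (principal {p. p tagged_division_of {a..b} \<and> (\<lambda>y. ball y e) fine p})"
    if "d \<in> {0<..}" "e \<in> {0<..}" for d e :: real
  proof
    show "min d e \<in> {0<..}" using that by auto
  qed (auto simp: fine_def subset_iff)
  then show ?thesis
    unfolding fine_divisions_def
    by (subst eventually_INF_base) (auto simp: eventually_principal)
qed

text \<open>Cousin's lemma: every positive mesh admits a fine tagged division. Properness of the
  filter is what makes limits along it, and hence the integrals, unique.\<close>

lemma fine_divisions_neq_bot [simp]: "fine_divisions a b \<noteq> bot"
proof -
  have "\<exists>p. p tagged_division_of {a..b} \<and> (\<lambda>x. ball x d) fine p" if "d > 0" for d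
    using that by (metis fine_division_exists_real gauge_ball)
  then show ?thesis
    by (auto simp: trivial_limit_def eventually_fine_divisions)
qed

lemma eventually_fine_divisions_division:
  "eventually (\<lambda>p. p tagged_division_of {a..b}) (fine_divisions a b)"
  by (auto simp: eventually_fine_divisions intro: exI[of _ 1])

text \<open>As limits along a filter, the integrals inherit linearity, order and conjugation from
  their Riemann sums by the usual limit laws.\<close>

lemma has_RS_integral_iff_tendsto:
  "has_RS_integral h g a b I \<longleftrightarrow>
     ((\<lambda>p. \<Sum>(x, K)\<in>p. h x * (g (Sup K) - g (Inf K))) \<longlongrightarrow> I) (fine_divisions a b)"
  by (simp add: has_RS_integral_def tendsto_iff dist_norm eventually_fine_divisions)

lemma RS_integral_eqI: "has_RS_integral h g a b I \<Longrightarrow> RS_integral h g a b = I"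
  unfolding RS_integral_def has_RS_integral_iff_tendsto
  by (rule the_equality) (auto intro: tendsto_unique[rotated])

lemma has_RS_integral_add:
  assumes "has_RS_integral h g a b I" "has_RS_integral h g' a b I'"
  shows "has_RS_integral h (\<lambda>l. g l + g' l) a b (I + I')"
  using tendsto_add[OF assms[unfolded has_RS_integral_iff_tendsto]]
  unfolding has_RS_integral_iff_tendsto
  by (simp add: sum.distrib[symmetric] case_prod_unfold algebra_simps)

lemma has_RS_integral_cmult:
  assumes "has_RS_integral h g a b I"
  shows "has_RS_integral h (\<lambda>l. c * g l) a b (c * I)"
  using tendsto_mult_left[OF assms[unfolded has_RS_integral_iff_tendsto], of c]
  unfolding has_RS_integral_iff_tendsto
  by (simp add: sum_distrib_left case_prod_unfold algebra_simps)

text \<open>One function \<open>J\<close> carries the values over all windows and records that they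
  stop changing once \<open>h\<close> vanishes for \<open>\<bar>x\<bar> \<ge> R\<close>. The
  predicate is stable under complex linear combinations, so the entries of a matrix function can be
  reduced to monotone functions.\<close>

definition RS_integrator :: "(real \<Rightarrow> complex) \<Rightarrow> bool" where
  "RS_integrator g \<longleftrightarrow> (\<forall>h. continuous_on UNIV h \<longrightarrow> (\<exists>J. \<forall>R\<ge>0. has_RS_integral h g (- R) R (J R) \<and>
     ((\<forall>x. \<bar>x\<bar> \<ge> R \<longrightarrow> h x = 0) \<longrightarrow> (\<forall>R'\<ge>R. J R' = J R))))"

lemma RS_integrator_add:
  assumes "RS_integrator g" "RS_integrator g'"
  shows "RS_integrator (\<lambda>l. g l + g' l)"
  unfolding RS_integrator_def
proof (intro allI impI)
  fix h :: "real \<Rightarrow> complex" assume h: "continuous_on UNIV h"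
  obtain J where J: "\<And>R. R \<ge> 0 \<Longrightarrow> has_RS_integral h g (- R) R (J R)"
    "\<And>R R'. R \<ge> 0 \<Longrightarrow> (\<forall>x. \<bar>x\<bar> \<ge> R \<longrightarrow> h x = 0) \<Longrightarrow> R' \<ge> R \<Longrightarrow> J R' = J R"
    using assms(1) h unfolding RS_integrator_def by metis
  obtain J' where J': "\<And>R. R \<ge> 0 \<Longrightarrow> has_RS_integral h g' (- R) R (J' R)"
    "\<And>R R'. R \<ge> 0 \<Longrightarrow> (\<forall>x. \<bar>x\<bar> \<ge> R \<longrightarrow> h x = 0) \<Longrightarrow> R' \<ge> R \<Longrightarrow> J' R' = J' R"
    using assms(2) h unfolding RS_integrator_def by metis
  show "\<exists>J. \<forall>R\<ge>0. has_RS_integral h (\<lambda>l. g l + g' l) (- R) R (J R) \<and>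
     ((\<forall>x. \<bar>x\<bar> \<ge> R \<longrightarrow> h x = 0) \<longrightarrow> (\<forall>R'\<ge>R. J R' = J R))"
  proof (intro exI[of _ "\<lambda>R. J R + J' R"] allI impI conjI)
    fix R R' :: real assume "0 \<le> R" "\<forall>x. \<bar>x\<bar> \<ge> R \<longrightarrow> h x = 0" "R \<le> R'"
    from J(2)[OF this] J'(2)[OF this] show "J R' + J' R' = J R + J' R" by simp
  qed (intro has_RS_integral_add J J')
qed

lemma RS_integrator_cmult:
  assumes "RS_integrator g"
  shows "RS_integrator (\<lambda>l. c * g l)"
  unfolding RS_integrator_def
proof (intro allI impI)
  fix h :: "real \<Rightarrow> complex" assume h: "continuous_on UNIV h"
  obtain J where J: "\<And>R. R \<ge> 0 \<Longrightarrow> has_RS_integral h g (- R) R (J R)"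
    "\<And>R R'. R \<ge> 0 \<Longrightarrow> (\<forall>x. \<bar>x\<bar> \<ge> R \<longrightarrow> h x = 0) \<Longrightarrow> R' \<ge> R \<Longrightarrow> J R' = J R"
    using assms(1) h unfolding RS_integrator_def by metis
  show "\<exists>J. \<forall>R\<ge>0. has_RS_integral h (\<lambda>l. c * g l) (- R) R (J R) \<and>
     ((\<forall>x. \<bar>x\<bar> \<ge> R \<longrightarrow> h x = 0) \<longrightarrow> (\<forall>R'\<ge>R. J R' = J R))"
  proof (intro exI[of _ "\<lambda>R. c * J R"] allI impI conjI)
    fix R R' :: real assume "0 \<le> R" "\<forall>x. \<bar>x\<bar> \<ge> R \<longrightarrow> h x = 0" "R \<le> R'"
    from J(2)[OF this] show "c * J R' = c * J R" by simp
  qed (intro has_RS_integral_cmult J)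
qed

text \<open>An additive interval function that agrees with \<open>h x * (g d - g c)\<close> up to
  the oscillation of \<open>h\<close> on \<open>[c,d]\<close> must be the integral: over a division
  fine for the uniform continuity of \<open>h\<close> the values of \<open>J\<close> telescope, and
  the errors add up to a small multiple of the total increment of \<open>g\<close>.\<close>

lemma has_RS_integralI_additive:
  fixes J :: "real \<Rightarrow> real \<Rightarrow> complex" and g :: "real \<Rightarrow> real" and h :: "real \<Rightarrow> complex"
  assumes "a \<le> b"
    and J: "\<And>c d x e. c \<le> d \<Longrightarrow> (\<And>t. t \<in> {c..d} \<Longrightarrow> norm (h t - h x) \<le> e) \<Longrightarrow>
              norm (J c d - h x * (g d - g c)) \<le> e * (g d - g c)"
    and add: "\<And>c d. a \<le> c \<Longrightarrow> c \<le> d \<Longrightarrow> J a d = J a c + J c d"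
    and mono: "mono g" and h: "continuous_on UNIV h"
  shows "has_RS_integral h (\<lambda>l. complex_of_real (g l)) a b (J a b)"
  unfolding has_RS_integral_def
proof (intro allI impI)
  fix e :: real assume "e > 0"
  \<comment> \<open>The \<open>+ 1\<close> keeps the denominator positive when
    \<open>g a = g b\<close> and makes the total error \<open>e' * (g b - g a)\<close> strictly
    smaller than \<open>e\<close>.\<close>
  define e' where "e' = e / (g b - g a + 1)"
  have gab: "g a \<le> g b" using mono \<open>a \<le> b\<close> by (simp add: monoD)
  then have e': "e' > 0" "e' * (g b - g a) < e"
    using \<open>e > 0\<close> by (auto simp: e'_def field_simps)
  have "uniformly_continuous_on {a..b} h"
    by (rule compact_uniformly_continuous) (use h continuous_on_subset in auto)
  then obtain d where d: "d > 0"
    "\<And>s t. s \<in> {a..b} \<Longrightarrow> t \<in> {a..b} \<Longrightarrow> dist s t < d \<Longrightarrow> dist (h s) (h t) < e'"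
    unfolding uniformly_continuous_on_def using e' by metis
  have "norm ((\<Sum>(x, K)\<in>p. h x * (complex_of_real (g (Sup K)) - complex_of_real (g (Inf K)))) - J a b) < e"
    if p: "p tagged_division_of {a..b}" "(\<lambda>x. ball x d) fine p" for p
  proof -
    have fin: "finite p" using p by auto
    have "J a a = 0" using add[of a a] by simp
    then have 1: "J a b = (\<Sum>(x, K)\<in>p. J a (Sup K) - J a (Inf K))"
      using additive_tagged_division_1[OF \<open>a \<le> b\<close> p(1), of "J a"] by simp
    have 2: "g b - g a = (\<Sum>(x, K)\<in>p. g (Sup K) - g (Inf K))"
      using additive_tagged_division_1[OF \<open>a \<le> b\<close> p(1), of g] by simp
    have "norm ((\<Sum>(x, K)\<in>p. h x * (complex_of_real (g (Sup K)) - complex_of_real (g (Inf K)))) - J a b)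
        = norm (\<Sum>(x, K)\<in>p. h x * (complex_of_real (g (Sup K)) - complex_of_real (g (Inf K)))
               - (J a (Sup K) - J a (Inf K)))"
      unfolding 1 by (simp add: sum_subtractf case_prod_unfold)
    also have "\<dots> \<le> (\<Sum>(x, K)\<in>p. e' * (g (Sup K) - g (Inf K)))"
    proof (rule sum_norm_le, clarify)
      fix x K assume xK: "(x, K) \<in> p"
      obtain u v where K: "K = cbox u v" using p(1) xK by (meson tagged_division_ofD(4))
      have x: "x \<in> K" "K \<subseteq> {a..b}" "K \<subseteq> ball x d"
        using p xK by (auto dest: tagged_division_ofD(2,3) simp: fine_def)
      then have uv: "u \<le> v" "Inf K = u" "Sup K = v" "a \<le> u" "v \<le> b" using K by auto
      have "norm (h t - h x) \<le> e'" if "t \<in> {u..v}" for t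
        using d(2)[of t x] that x K by (auto simp: dist_norm subset_iff dist_commute norm_minus_commute less_imp_le)
      then have "norm (J u v - h x * (g v - g u)) \<le> e' * (g v - g u)"
        using J uv by blast
      then show "norm (h x * (complex_of_real (g (Sup K)) - complex_of_real (g (Inf K)))
               - (J a (Sup K) - J a (Inf K))) \<le> e' * (g (Sup K) - g (Inf K))"
        using add[of u v] uv by (simp add: norm_minus_commute)
    qed
    also have "\<dots> = e' * (g b - g a)" unfolding 2 by (simp add: sum_distrib_left case_prod_unfold)
    finally show ?thesis using e' by simp
  qed
  with d show "\<exists>d>0. \<forall>p. p tagged_division_of {a..b} \<and> (\<lambda>x. ball x d) fine p \<longrightarrow>
       norm ((\<Sum>(x, K)\<in>p. h x * (complex_of_real (g (Sup K)) - complex_of_real (g (Inf K)))) - J a b) < e"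
    by blast
qed

text \<open>The value is the Lebesgue integral against the Stieltjes measure of \<open>g\<close>
  over half-open intervals \<open>(c,d]\<close>, whose measure is \<open>g d - g c\<close> by right
  continuity. Half-openness counts each atom once, so additivity is exact.\<close>

lemma RS_integrator_mono:
  fixes g :: "real \<Rightarrow> real"
  assumes mono: "mono g" and rc: "\<And>l. continuous (at_right l) g"
  shows "RS_integrator (\<lambda>l. complex_of_real (g l))"
  unfolding RS_integrator_def
proof (intro allI impI)
  fix h :: "real \<Rightarrow> complex" assume h: "continuous_on UNIV h"
  define M where "M = interval_measure g"
  define J where "J c d = (LINT t:{c<..d}|M. h t)" for c d
  have [measurable]: "h \<in> borel_measurable borel"
    using h by (rule borel_measurable_continuous_onI)
  have sets [measurable_cong, simp]: "sets M = sets borel" by (simp add: M_def)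
  have em: "emeasure M {c<..d} = ennreal (g d - g c)" if "c \<le> d" for c d
    unfolding M_def using emeasure_interval_measure_Ioc[OF that, of g] mono rc by (auto simp: monoD)
  have m: "measure M {c<..d} = g d - g c" if "c \<le> d" for c d
    using em[OF that] monoD[OF mono that] by (simp add: measure_def)
  have int: "set_integrable M {c<..d} f" if "continuous_on UNIV f" for c d and f :: "real \<Rightarrow> complex"
  proof (cases "c \<le> d")
    case True
    have [measurable]: "f \<in> borel_measurable borel"
      using that by (rule borel_measurable_continuous_onI)
    have "compact (f ` {c..d})"
      by (rule compact_continuous_image) (use that continuous_on_subset in auto)
    then obtain B where B: "\<And>t. t \<in> {c..d} \<Longrightarrow> norm (f t) \<le> B"
      by (metis bounded_iff compact_imp_bounded imageI)
    show ?thesis unfolding set_integrable_def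
      by (rule integrableI_bounded_set_indicator[where B = B])
         (use B em[OF True] in \<open>auto intro!: AE_I2\<close>)
  qed (simp add: set_integrable_def)
  have bound: "norm (J c d - h x * (g d - g c)) \<le> e * (g d - g c)"
    if "c \<le> d" and e: "\<And>t. t \<in> {c..d} \<Longrightarrow> norm (h t - h x) \<le> e" for c d x e
  proof -
    have fin: "emeasure M {c<..d} < \<infinity>" using em[OF that(1)] by simp
    have I: "set_integrable M {c<..d} (\<lambda>t. h t - h x)"
      by (intro int continuous_intros h)
    have "J c d - h x * (g d - g c) = (LINT t:{c<..d}|M. h t - h x)"
      using int[of h] int[of "\<lambda>_. h x"] h m[OF that(1)] fin unfolding J_def
      by (subst set_integral_diff(2)) (auto simp: set_integral_const scaleR_conv_of_real)
    also have "norm \<dots> \<le> (LINT t:{c<..d}|M. norm (h t - h x))"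
      by (rule set_integral_norm_bound[OF I])
    also have "\<dots> \<le> (LINT t:{c<..d}|M. e)"
    proof (rule set_integral_mono)
      show "set_integrable M {c<..d} (\<lambda>t. norm (h t - h x))"
        using I by (rule set_integrable_norm)
      show "set_integrable M {c<..d} (\<lambda>_. e)"
        using fin by (auto simp: set_integrable_def)
    qed (use e in auto)
    also have "\<dots> = e * (g d - g c)"
      using m[OF that(1)] fin by (simp add: set_integral_const)
    finally show ?thesis .
  qed
  have add: "J a d = J a c + J c d" if "a \<le> c" "c \<le> d" for a c d
  proof -
    have "{a<..d} = {a<..c} \<union> {c<..d}" using that by auto
    then show ?thesis unfolding J_def
      by (simp, subst set_integral_Un) (use int h in auto)
  qed
  show "\<exists>J. \<forall>R\<ge>0. has_RS_integral h (\<lambda>l. complex_of_real (g l)) (- R) R (J R) \<and>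
     ((\<forall>x. \<bar>x\<bar> \<ge> R \<longrightarrow> h x = 0) \<longrightarrow> (\<forall>R'\<ge>R. J R' = J R))"
  proof (intro exI[of _ "\<lambda>R. J (-R) R"] allI impI conjI)
    fix R :: real assume R: "R \<ge> 0"
    show "has_RS_integral h (\<lambda>l. complex_of_real (g l)) (- R) R (J (-R) R)"
      by (rule has_RS_integralI_additive[OF _ bound add mono h]) (use R in auto)
    fix R' assume h0: "\<forall>x. \<bar>x\<bar> \<ge> R \<longrightarrow> h x = 0" and R': "R \<le> R'"
    \<comment> \<open>The added pieces are \<open>(-R',-R]\<close> and \<open>(R,R']\<close>. The
      first contains \<open>-R\<close>, so \<open>h\<close> has to vanish at the endpoint
      itself.\<close>
    have "J (- R') (- R) = 0" "J R R' = 0"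
      using h0 R R' by (auto simp: J_def intro!: set_lebesgue_integral_zero set_lebesgue_integral_cong[of _ M _ "\<lambda>_. 0", simplified])
    then show "J (-R') R' = J (-R) R"
      using add[of "-R'" "-R" R'] add[of "-R" R R'] R R' by simp
  qed
qed

subsection \<open>The form of an increasing matrix function on a window\<close>

lemma Re_cinner: "Re (cinner u v) = u \<bullet> v"
  by (simp add: cinner_def inner_vec_def inner_complex_def)

lemma cinner_add_left: "cinner (u + v) w = cinner u w + cinner v w"
  by (simp add: cinner_def algebra_simps sum.distrib)

lemma cinner_add_right: "cinner u (v + w) = cinner u v + cinner u w"
  by (simp add: cinner_def algebra_simps sum.distrib)

lemma cinner_smult_left: "cinner (c *s u) v = cnj c * cinner u v"
  by (simp add: cinner_def sum_distrib_left algebra_simps)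

lemma cinner_smult_right: "cinner u (c *s v) = c * cinner u v"
  by (simp add: cinner_def sum_distrib_left algebra_simps)

lemma cnj_cinner: "cnj (cinner u v) = cinner v u"
  by (simp add: cinner_def mult.commute)

lemma cinner_self: "cinner u u = complex_of_real ((norm u)\<^sup>2)"
  by (simp add: cinner_def norm_vec_def L2_set_def sum_nonneg complex_norm_square mult.commute del: of_real_power)

lemma cinner_cadjoint:
  fixes A :: "complex ^ 'n::finite ^ 'm::finite"
  shows "cinner (cadjoint A *v u) v = cinner u (A *v v)"
proof -
  have "cinner (cadjoint A *v u) v = (\<Sum>i\<in>UNIV. \<Sum>j\<in>UNIV. A $ j $ i * cnj (u $ j) * v $ i)"
    by (simp add: cinner_def matrix_vector_mult_def cadjoint_def sum_distrib_right)
  also have "\<dots> = (\<Sum>j\<in>UNIV. \<Sum>i\<in>UNIV. A $ j $ i * cnj (u $ j) * v $ i)"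
    by (rule sum.swap)
  also have "\<dots> = cinner u (A *v v)"
    by (simp add: cinner_def matrix_vector_mult_def sum_distrib_left algebra_simps)
  finally show ?thesis .
qed

lemma inner_cadjoint:
  fixes A :: "complex ^ 'n::finite ^ 'm::finite"
  shows "(cadjoint A *v u) \<bullet> v = u \<bullet> (A *v v)"
  using cinner_cadjoint[of A u v] by (metis Re_cinner)

lemma self_adjoint_cinner: "self_adjoint A \<Longrightarrow> cinner (A *v u) v = cinner u (A *v v)"
  using cinner_cadjoint[of A u v] by (simp add: self_adjoint_def)

lemma self_adjoint_inner: "self_adjoint A \<Longrightarrow> (A *v u) \<bullet> v = u \<bullet> (A *v v)"
  using inner_cadjoint[of A u v] by (simp add: self_adjoint_def)

text \<open>Real polarization is enough, since \<open>u \<bullet> (A *v v)\<close> is a symmetric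
  real bilinear form for self-adjoint \<open>A\<close>. It reduces mixed scalars to quadratic forms,
  which are monotone in the spectral variable.\<close>

lemma self_adjoint_polarization:
  assumes "self_adjoint A"
  shows "u \<bullet> (A *v v) = ((u + v) \<bullet> (A *v (u + v)) - u \<bullet> (A *v u) - v \<bullet> (A *v v)) / 2"
proof -
  have "v \<bullet> (A *v u) = u \<bullet> (A *v v)"
    using self_adjoint_inner[OF assms, of u v] by (simp add: inner_commute)
  then show ?thesis
    by (simp add: matrix_vector_right_distrib inner_add_left inner_add_right)
qed

lemma matrix_vector_mult_axis:
  "((A :: complex ^ 'n::finite ^ 'm) *v axis j c) $ i = A $ i $ j * c"
  by (simp add: matrix_vector_mult_def axis_def if_distrib cong: if_cong)

lemma inner_axis_one: "axis i (1::complex) \<bullet> v = Re (v $ i)"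
  by (simp add: inner_axis' inner_complex_def)

text \<open>The second scalar is \<open>Re (\<i> * A $ i $ j) = - Im (A $ i $ j)\<close>, so the
  factor \<open>- \<i>\<close> restores the imaginary part.\<close>

lemma matrix_entry_eq:
  "(A :: complex ^ 'n::finite ^ 'm::finite) $ i $ j =
     complex_of_real (axis i 1 \<bullet> (A *v axis j 1)) + (- \<i>) * complex_of_real (axis i 1 \<bullet> (A *v axis j \<i>))"
  by (rule complex_eqI) (simp_all add: inner_axis_one matrix_vector_mult_axis)

lemma bounded_bilinear_matrix_vector_mult_complex:
  "bounded_bilinear (\<lambda>(A :: complex ^ 'n::finite ^ 'm::finite) v. A *v v)"
proof -
  have "bilinear (\<lambda>(A :: complex ^ 'n ^ 'm) v. A *v v)"
    unfolding bilinear_def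
    by (auto intro!: linearI simp: matrix_vector_mult_def vec_eq_iff algebra_simps sum.distrib scaleR_sum_right)
  then show ?thesis by (simp add: bilinear_conv_bounded_bilinear)
qed

lemmas bounded_linear_matrix_vector_left =
  bounded_bilinear.bounded_linear_left[OF bounded_bilinear_matrix_vector_mult_complex]

lemma continuous_on_entries:
  assumes "continuous_on UNIV (f :: real \<Rightarrow> complex ^ 'n)" "continuous_on UNIV (g :: real \<Rightarrow> complex ^ 'n)"
  shows "continuous_on UNIV (\<lambda>l. cnj (f l $ i) * g l $ j)"
  by (intro continuous_intros assms)

lemma continuous_on_smult:
  fixes m :: "real \<Rightarrow> complex" and f :: "real \<Rightarrow> complex ^ 'm"
  shows "continuous_on S m \<Longrightarrow> continuous_on S f \<Longrightarrow> continuous_on S (\<lambda>l. m l *s f l)"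
  unfolding vector_scalar_mult_def by (intro continuous_intros)

section \<open>Stieltjes integrals against the entries, and the form they define on a window\<close>

locale spectral_matrix =
  fixes \<sigma> :: "real \<Rightarrow> complex ^ 'n::finite ^ 'n"
  assumes increasing: "increasing_matrix \<sigma>"
    and right_continuous: "\<And>l. continuous (at_right l) \<sigma>"
begin

lemma self_adjoint_\<sigma>: "self_adjoint (\<sigma> l)"
  using increasing by (simp add: increasing_matrix_def)

lemma pos_semidef_diff: "m \<le> l \<Longrightarrow> pos_semidef (\<sigma> l - \<sigma> m)"
proof (cases "m = l")
  case True
  have "pos_semidef (0 :: complex ^ 'n ^ 'n)"
    by (simp add: pos_semidef_def self_adjoint_def cadjoint_def vec_eq_iff cinner_def matrix_vector_mult_def)
  with True show ?thesis by simp
qed (use increasing in \<open>auto simp: increasing_matrix_def\<close>)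

text \<open>Positive semidefinite increments make these scalars monotone. They are the functions to
  which measure theory is applied; everything else is a linear combination of them.\<close>

lemma RS_integrator_quadratic: "RS_integrator (\<lambda>l. complex_of_real (v \<bullet> (\<sigma> l *v v)))"
proof (rule RS_integrator_mono)
  show "mono (\<lambda>l. v \<bullet> (\<sigma> l *v v))"
  proof (rule monoI)
    fix m l :: real assume "m \<le> l"
    then have "0 \<le> v \<bullet> ((\<sigma> l - \<sigma> m) *v v)"
      using pos_semidef_diff by (auto simp: pos_semidef_def Re_cinner)
    then show "v \<bullet> (\<sigma> m *v v) \<le> v \<bullet> (\<sigma> l *v v)"
      by (simp add: matrix_vector_mult_diff_rdistrib inner_diff_right)
  qed
  show "continuous (at_right l) (\<lambda>l. v \<bullet> (\<sigma> l *v v))" for l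
    by (intro continuous_intros bounded_linear.continuous[OF bounded_linear_matrix_vector_left] right_continuous)
qed

lemma RS_integrator_entry: "RS_integrator (\<lambda>l. \<sigma> l $ i $ j)"
proof -
  have inner: "RS_integrator (\<lambda>l. complex_of_real (u \<bullet> (\<sigma> l *v v)))" for u v
  proof -
    have *: "(\<lambda>l. complex_of_real (u \<bullet> (\<sigma> l *v v))) =
      (\<lambda>l. (1/2) * (complex_of_real ((u + v) \<bullet> (\<sigma> l *v (u + v))) +
         ((-1) * complex_of_real (u \<bullet> (\<sigma> l *v u)) + (-1) * complex_of_real (v \<bullet> (\<sigma> l *v v)))))"
      by (rule ext, subst self_adjoint_polarization[OF self_adjoint_\<sigma>]) (simp add: field_simps)
    show ?thesis unfolding *
      by (intro RS_integrator_cmult RS_integrator_add RS_integrator_quadratic)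
  qed
  show ?thesis
    by (subst matrix_entry_eq) (intro RS_integrator_cmult RS_integrator_add inner)
qed

text \<open>Collecting the scalar sums for all \<open>i, j\<close> over one common division shows
  each summand as a value of the positive semidefinite form of an increment of
  \<open>\<sigma>\<close>. Positivity is invisible in the separate entries.\<close>

definition Riemann_form ::
  "(real \<times> real set) set \<Rightarrow> (real \<Rightarrow> complex ^ 'n) \<Rightarrow> (real \<Rightarrow> complex ^ 'n) \<Rightarrow> complex" where
  "Riemann_form p f g = (\<Sum>(x, K)\<in>p. cinner (f x) ((\<sigma> (Sup K) - \<sigma> (Inf K)) *v g x))"

text \<open>The expression under the limit in \<open>has_sigma_inner\<close>. It is finite for all
  continuous functions, before anything is known about the limit
  \<open>R \<rightarrow> \<infinity>\<close>.\<close>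

definition window_form :: "real \<Rightarrow> (real \<Rightarrow> complex ^ 'n) \<Rightarrow> (real \<Rightarrow> complex ^ 'n) \<Rightarrow> complex" where
  "window_form R f g = (\<Sum>i\<in>UNIV. \<Sum>j\<in>UNIV.
     RS_integral (\<lambda>l. cnj (f l $ i) * g l $ j) (\<lambda>l. \<sigma> l $ i $ j) (- R) R)"

definition window_norm :: "real \<Rightarrow> (real \<Rightarrow> complex ^ 'n) \<Rightarrow> real" where
  "window_norm R f = sqrt (Re (window_form R f f))"

abbreviation window_dist :: "real \<Rightarrow> (real \<Rightarrow> complex ^ 'n) \<Rightarrow> (real \<Rightarrow> complex ^ 'n) \<Rightarrow> real" where
  "window_dist R f g \<equiv> window_norm R (\<lambda>l. f l - g l)"

abbreviation sigma_dist :: "(real \<Rightarrow> complex ^ 'n) \<Rightarrow> (real \<Rightarrow> complex ^ 'n) \<Rightarrow> real" where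
  "sigma_dist f g \<equiv> sigma_norm \<sigma> (\<lambda>l. f l - g l)"

lemma has_sigma_inner_iff: "has_sigma_inner \<sigma> f g c \<longleftrightarrow> ((\<lambda>R. window_form R f g) \<longlongrightarrow> c) at_top"
  by (simp add: has_sigma_inner_def window_form_def)

text \<open>Identities and inequalities of Riemann sums pass to the window form through this limit.
  Existence of the entrywise integrals allows it to be taken inside the finite sums over
  \<open>i\<close> and \<open>j\<close>.\<close>

lemma window_form_tendsto:
  assumes "continuous_on UNIV f" "continuous_on UNIV g" "R \<ge> 0"
  shows "((\<lambda>p. Riemann_form p f g) \<longlongrightarrow> window_form R f g) (fine_divisions (- R) R)"
proof -
  have "((\<lambda>p. \<Sum>i\<in>UNIV. \<Sum>j\<in>UNIV. \<Sum>(x, K)\<in>p. (cnj (f x $ i) * g x $ j) *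
          (\<sigma> (Sup K) $ i $ j - \<sigma> (Inf K) $ i $ j)) \<longlongrightarrow> window_form R f g) (fine_divisions (- R) R)"
    unfolding window_form_def
  proof (intro tendsto_sum)
    fix i j
    obtain J where J: "has_RS_integral (\<lambda>l. cnj (f l $ i) * g l $ j) (\<lambda>l. \<sigma> l $ i $ j) (- R) R J"
      using RS_integrator_entry[of i j] continuous_on_entries[OF assms(1,2)] assms(3)
      unfolding RS_integrator_def by meson
    show "((\<lambda>p. \<Sum>(x, K)\<in>p. (cnj (f x $ i) * g x $ j) * (\<sigma> (Sup K) $ i $ j - \<sigma> (Inf K) $ i $ j))
       \<longlongrightarrow> RS_integral (\<lambda>l. cnj (f l $ i) * g l $ j) (\<lambda>l. \<sigma> l $ i $ j) (- R) R) (fine_divisions (- R) R)"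
      using J unfolding RS_integral_eqI[OF J] has_RS_integral_iff_tendsto .
  qed
  moreover have "(\<Sum>i\<in>UNIV. \<Sum>j\<in>UNIV. \<Sum>(x, K)\<in>p. (cnj (f x $ i) * g x $ j) *
          (\<sigma> (Sup K) $ i $ j - \<sigma> (Inf K) $ i $ j)) = Riemann_form p f g" for p
  proof -
    have "(\<Sum>i\<in>UNIV. \<Sum>j\<in>UNIV. \<Sum>(x, K)\<in>p. (cnj (f x $ i) * g x $ j) *
          (\<sigma> (Sup K) $ i $ j - \<sigma> (Inf K) $ i $ j)) =
      (\<Sum>i\<in>UNIV. \<Sum>(x, K)\<in>p. \<Sum>j\<in>UNIV. (cnj (f x $ i) * g x $ j) *
          (\<sigma> (Sup K) $ i $ j - \<sigma> (Inf K) $ i $ j))"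
      by (subst sum.swap) (simp add: case_prod_unfold)
    also have "\<dots> = (\<Sum>(x, K)\<in>p. \<Sum>i\<in>UNIV. \<Sum>j\<in>UNIV. (cnj (f x $ i) * g x $ j) *
          (\<sigma> (Sup K) $ i $ j - \<sigma> (Inf K) $ i $ j))"
      by (subst sum.swap) (simp add: case_prod_unfold)
    also have "\<dots> = Riemann_form p f g"
      unfolding Riemann_form_def cinner_def matrix_vector_mult_def
      by (simp add: sum_distrib_left case_prod_unfold algebra_simps)
    finally show ?thesis .
  qed
  ultimately show ?thesis by simp
qed

lemma window_form_add_left:
  assumes "continuous_on UNIV f" "continuous_on UNIV g" "continuous_on UNIV h" "R \<ge> 0"
  shows "window_form R (\<lambda>l. f l + g l) h = window_form R f h + window_form R g h"
proof (rule tendsto_unique[OF fine_divisions_neq_bot])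
  show "((\<lambda>p. Riemann_form p (\<lambda>l. f l + g l) h) \<longlongrightarrow> window_form R (\<lambda>l. f l + g l) h) (fine_divisions (- R) R)"
    by (intro window_form_tendsto continuous_intros assms)
  have "((\<lambda>p. Riemann_form p f h + Riemann_form p g h) \<longlongrightarrow> window_form R f h + window_form R g h) (fine_divisions (- R) R)"
    by (intro window_form_tendsto tendsto_intros assms)
  then show "((\<lambda>p. Riemann_form p (\<lambda>l. f l + g l) h) \<longlongrightarrow> window_form R f h + window_form R g h) (fine_divisions (- R) R)"
    by (simp add: Riemann_form_def cinner_add_left sum.distrib case_prod_unfold)
qed

lemma window_form_smult_right:
  assumes "continuous_on UNIV f" "continuous_on UNIV g" "R \<ge> 0"
  shows "window_form R f (\<lambda>l. c *s g l) = c * window_form R f g"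
proof (rule tendsto_unique[OF fine_divisions_neq_bot])
  have "continuous_on UNIV (\<lambda>l. c *s g l)"
    unfolding vector_scalar_mult_def by (intro continuous_intros assms)
  then show "((\<lambda>p. Riemann_form p f (\<lambda>l. c *s g l)) \<longlongrightarrow> window_form R f (\<lambda>l. c *s g l)) (fine_divisions (- R) R)"
    by (intro window_form_tendsto assms)
  have "((\<lambda>p. c * Riemann_form p f g) \<longlongrightarrow> c * window_form R f g) (fine_divisions (- R) R)"
    by (intro window_form_tendsto tendsto_intros assms)
  then show "((\<lambda>p. Riemann_form p f (\<lambda>l. c *s g l)) \<longlongrightarrow> c * window_form R f g) (fine_divisions (- R) R)"
    by (simp add: Riemann_form_def cinner_smult_right vector_scalar_commute sum_distrib_left case_prod_unfold)
qed

lemma window_form_commute: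
  assumes "continuous_on UNIV f" "continuous_on UNIV g" "R \<ge> 0"
  shows "window_form R g f = cnj (window_form R f g)"
proof (rule tendsto_unique[OF fine_divisions_neq_bot])
  show "((\<lambda>p. Riemann_form p g f) \<longlongrightarrow> window_form R g f) (fine_divisions (- R) R)"
    by (intro window_form_tendsto assms)
  have "self_adjoint (\<sigma> a - \<sigma> b)" for a b
    using self_adjoint_\<sigma>[of a] self_adjoint_\<sigma>[of b] by (simp add: self_adjoint_def cadjoint_def vec_eq_iff)
  then have *: "cinner (g x) ((\<sigma> a - \<sigma> b) *v f x) = cnj (cinner (f x) ((\<sigma> a - \<sigma> b) *v g x))" for x a b
    by (simp add: cnj_cinner self_adjoint_cinner)
  have "((\<lambda>p. cnj (Riemann_form p f g)) \<longlongrightarrow> cnj (window_form R f g)) (fine_divisions (- R) R)"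
    by (intro window_form_tendsto tendsto_intros assms)
  then show "((\<lambda>p. Riemann_form p g f) \<longlongrightarrow> cnj (window_form R f g)) (fine_divisions (- R) R)"
    unfolding Riemann_form_def * by (simp add: case_prod_unfold)
qed

lemma window_form_add_right:
  assumes "continuous_on UNIV f" "continuous_on UNIV g" "continuous_on UNIV h" "R \<ge> 0"
  shows "window_form R h (\<lambda>l. f l + g l) = window_form R h f + window_form R h g"
proof -
  have "continuous_on UNIV (\<lambda>l. f l + g l)" by (intro continuous_intros assms)
  then show ?thesis
    using window_form_add_left[OF assms] window_form_commute[OF _ assms(3,4)] assms(1,2)
    by simp
qed

lemma division_psd:
  assumes "p tagged_division_of {a..b}" "(x, K) \<in> p"
  shows "0 \<le> Re (cinner v ((\<sigma> (Sup K) - \<sigma> (Inf K)) *v v))"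
proof -
  obtain u w where K: "K = cbox u w" using assms by (meson tagged_division_ofD(4))
  moreover have "x \<in> K" using assms by (meson tagged_division_ofD(2))
  ultimately have "Inf K \<le> Sup K" by auto
  then show ?thesis using pos_semidef_diff by (auto simp: pos_semidef_def)
qed

text \<open>A scalar multiplier leaves the form of each increment as the factor
  \<open>|m|^2\<close>, and these forms are nonnegative, so the bound holds term by term.
  Multiplication by \<open>m\<close> is thus bounded by its supremum norm, uniformly over all
  windows.\<close>

lemma window_form_scale_mono:
  fixes m :: "real \<Rightarrow> complex"
  assumes "continuous_on UNIV f" "continuous_on UNIV m" "R \<ge> 0"
    and m: "\<And>l. norm (m l) \<le> M"
  shows "Re (window_form R (\<lambda>l. m l *s f l) (\<lambda>l. m l *s f l)) \<le> M\<^sup>2 * Re (window_form R f f)"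
proof (rule tendsto_le[OF fine_divisions_neq_bot])
  have c: "continuous_on UNIV (\<lambda>l. m l *s f l)"
    unfolding vector_scalar_mult_def by (intro continuous_intros assms)
  show "((\<lambda>p. Re (Riemann_form p (\<lambda>l. m l *s f l) (\<lambda>l. m l *s f l)))
      \<longlongrightarrow> Re (window_form R (\<lambda>l. m l *s f l) (\<lambda>l. m l *s f l))) (fine_divisions (- R) R)"
    by (intro window_form_tendsto tendsto_intros assms c)
  show "((\<lambda>p. M\<^sup>2 * Re (Riemann_form p f f)) \<longlongrightarrow> M\<^sup>2 * Re (window_form R f f)) (fine_divisions (- R) R)"
    by (intro window_form_tendsto tendsto_intros assms)
  show "eventually (\<lambda>p. Re (Riemann_form p (\<lambda>l. m l *s f l) (\<lambda>l. m l *s f l))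
           \<le> M\<^sup>2 * Re (Riemann_form p f f)) (fine_divisions (- R) R)"
    using eventually_fine_divisions_division
  proof eventually_elim
    case (elim p)
    have "Re (case z of (x, K) \<Rightarrow> cinner (m x *s f x) ((\<sigma> (Sup K) - \<sigma> (Inf K)) *v (m x *s f x))) \<le>
       M\<^sup>2 * Re (case z of (x, K) \<Rightarrow> cinner (f x) ((\<sigma> (Sup K) - \<sigma> (Inf K)) *v f x))" if "z \<in> p" for z
    proof (cases z)
      case (Pair x K)
      let ?D = "(\<sigma> (Sup K) - \<sigma> (Inf K))"
      have "cinner (m x *s f x) (?D *v (m x *s f x)) = complex_of_real ((norm (m x))\<^sup>2) * cinner (f x) (?D *v f x)"
        by (simp add: vector_scalar_commute cinner_smult_left cinner_smult_right
            complex_norm_square mult_ac del: of_real_power)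
      then have "Re (cinner (m x *s f x) (?D *v (m x *s f x))) = (norm (m x))\<^sup>2 * Re (cinner (f x) (?D *v f x))"
        by simp
      also have "\<dots> \<le> M\<^sup>2 * Re (cinner (f x) (?D *v f x))"
        using m division_psd[OF elim, of x K] that Pair
        by (intro mult_right_mono power_mono) auto
      finally show ?thesis using Pair by simp
    qed
    then show ?case
      unfolding Riemann_form_def Re_sum sum_distrib_left by (rule sum_mono)
  qed
qed

lemma window_form_nonneg:
  assumes "continuous_on UNIV f" "R \<ge> 0"
  shows "0 \<le> Re (window_form R f f)"
proof (rule tendsto_lowerbound[OF _ _ fine_divisions_neq_bot])
  show "((\<lambda>p. Re (Riemann_form p f f)) \<longlongrightarrow> Re (window_form R f f)) (fine_divisions (- R) R)"
    by (intro window_form_tendsto tendsto_intros assms)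
  show "eventually (\<lambda>p. 0 \<le> Re (Riemann_form p f f)) (fine_divisions (- R) R)"
    using eventually_fine_divisions_division
    by eventually_elim (auto simp: Riemann_form_def case_prod_unfold intro!: sum_nonneg division_psd)
qed

end

section \<open>Cauchy-Schwarz and the triangle inequality on windows\<close>

lemma quadratic_nonneg_imp_le:
  fixes a b c :: real
  assumes nn: "\<And>t. 0 \<le> a + 2 * t * b + t\<^sup>2 * c" and "0 \<le> a" "0 \<le> c"
  shows "\<bar>b\<bar> \<le> sqrt a * sqrt c"
proof (cases "c = 0")
  case True
  have "b = 0"
  proof (rule ccontr)
    assume "b \<noteq> 0"
    \<comment> \<open>At this point the affine function \<open>a + 2 * t * b\<close> takes the value
      -1.\<close>
    with nn[of "- (a + 1) / (2 * b)"] True show False by (simp add: field_simps)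
  qed
  then show ?thesis by (simp add: assms)
next
  case False
  with \<open>0 \<le> c\<close> have c: "c > 0" by simp
  \<comment> \<open>The minimiser \<open>t = - b / c\<close> of the quadratic.\<close>
  have "0 \<le> a + 2 * (- b / c) * b + (- b / c)\<^sup>2 * c" by (rule nn)
  then have "b\<^sup>2 \<le> a * c" using c by (simp add: field_simps power2_eq_square)
  then show ?thesis
    by (metis real_sqrt_abs real_sqrt_le_mono real_sqrt_mult)
qed

context spectral_matrix
begin

lemma window_norm_power2:
  "continuous_on UNIV f \<Longrightarrow> R \<ge> 0 \<Longrightarrow> (window_norm R f)\<^sup>2 = Re (window_form R f f)"
  using window_form_nonneg by (simp add: window_norm_def)

lemma window_norm_nonneg: "continuous_on UNIV f \<Longrightarrow> R \<ge> 0 \<Longrightarrow> 0 \<le> window_norm R f"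
  using window_form_nonneg by (simp add: window_norm_def)

lemma window_norm_scale:
  assumes "continuous_on UNIV f" "continuous_on UNIV m" "R \<ge> 0" "\<And>l. norm (m l) \<le> M"
  shows "window_norm R (\<lambda>l. m l *s f l) \<le> M * window_norm R f"
proof -
  have "0 \<le> M" using assms(4) norm_ge_zero order_trans by blast
  then show ?thesis
    using real_sqrt_le_mono[OF window_form_scale_mono[OF assms]]
    by (simp add: window_norm_def real_sqrt_mult)
qed

lemma Re_window_form_expand:
  assumes f: "continuous_on UNIV f" and g: "continuous_on UNIV g" and R: "R \<ge> 0"
  shows "Re (window_form R (\<lambda>l. f l + g l) (\<lambda>l. f l + g l)) =
    Re (window_form R f f) + 2 * Re (window_form R f g) + Re (window_form R g g)"
proof -
  have "continuous_on UNIV (\<lambda>l. f l + g l)" by (intro continuous_intros f g)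
  then have "window_form R (\<lambda>l. f l + g l) (\<lambda>l. f l + g l) =
    window_form R f f + window_form R f g + (window_form R g f + window_form R g g)"
    using f g R by (simp add: window_form_add_left window_form_add_right)
  then show ?thesis using window_form_commute[OF f g R] by simp
qed

lemma Re_window_form_bound:
  assumes f: "continuous_on UNIV f" and g: "continuous_on UNIV g" and R: "R \<ge> 0"
  shows "\<bar>Re (window_form R f g)\<bar> \<le> window_norm R f * window_norm R g"
  unfolding window_norm_def
proof (rule quadratic_nonneg_imp_le)
  fix t :: real
  define h where "h = (\<lambda>l. complex_of_real t *s g l)"
  have h: "continuous_on UNIV h" unfolding h_def by (intro continuous_on_smult continuous_intros g)
  have "window_form R h h = t * window_form R h g" unfolding h_def
    by (rule window_form_smult_right) (use h g R in \<open>auto simp: h_def\<close>)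
  also have "window_form R h g = cnj (window_form R g h)" by (rule window_form_commute) (use h g R in auto)
  also have "window_form R g h = t * window_form R g g" unfolding h_def
    by (rule window_form_smult_right) (use g R in auto)
  finally have hh: "Re (window_form R h h) = t\<^sup>2 * Re (window_form R g g)"
    by (simp add: power2_eq_square)
  have "window_form R f h = t * window_form R f g" unfolding h_def
    by (rule window_form_smult_right) (use f g R in auto)
  with hh Re_window_form_expand[OF f h R] window_form_nonneg[of "\<lambda>l. f l + h l" R]
  show "0 \<le> Re (window_form R f f) + 2 * t * Re (window_form R f g) + t\<^sup>2 * Re (window_form R g g)"
    using f h R by (simp add: continuous_on_add)
qed (use window_form_nonneg assms in auto)

text \<open>Replacing \<open>g\<close> by its multiple by \<open>\<i>\<close> turns the imaginary
  part into a real part. The factor 2 comes from adding the bounds of the two parts and is harmless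
  where only convergence matters.\<close>

lemma norm_window_form_bound:
  assumes f: "continuous_on UNIV f" and g: "continuous_on UNIV g" and R: "R \<ge> 0"
  shows "norm (window_form R f g) \<le> 2 * (window_norm R f * window_norm R g)"
proof -
  define h where "h = (\<lambda>l. \<i> *s g l)"
  have h: "continuous_on UNIV h" unfolding h_def by (intro continuous_on_smult continuous_intros g)
  have "window_form R f h = \<i> * window_form R f g" unfolding h_def
    by (rule window_form_smult_right) (use f g R in auto)
  moreover have "window_norm R h \<le> 1 * window_norm R g"
    unfolding h_def by (rule window_norm_scale) (use g R in auto)
  ultimately have "\<bar>Im (window_form R f g)\<bar> \<le> window_norm R f * window_norm R g"
    using Re_window_form_bound[OF f h R] mult_left_mono[OF _ window_norm_nonneg[OF f R]]
    by fastforce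
  then show ?thesis
    using Re_window_form_bound[OF f g R] cmod_le[of "window_form R f g"] by linarith
qed

lemma window_norm_triangle:
  assumes f: "continuous_on UNIV f" and g: "continuous_on UNIV g" and R: "R \<ge> 0"
  shows "window_norm R (\<lambda>l. f l + g l) \<le> window_norm R f + window_norm R g"
proof (rule power2_le_imp_le)
  have "continuous_on UNIV (\<lambda>l. f l + g l)" by (intro continuous_intros f g)
  then have "(window_norm R (\<lambda>l. f l + g l))\<^sup>2 =
      (window_norm R f)\<^sup>2 + 2 * Re (window_form R f g) + (window_norm R g)\<^sup>2"
    using Re_window_form_expand[OF assms] by (simp add: window_norm_power2 f g R)
  then show "(window_norm R (\<lambda>l. f l + g l))\<^sup>2 \<le> (window_norm R f + window_norm R g)\<^sup>2"
    using Re_window_form_bound[OF assms] by (simp add: power2_sum)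
qed (use window_norm_nonneg assms in auto)

lemma window_norm_minus:
  assumes "continuous_on UNIV f" "R \<ge> 0"
  shows "window_norm R (\<lambda>l. - f l) \<le> window_norm R f"
  using window_norm_scale[of f "\<lambda>_. -1" R 1] assms by (simp add: vec_eq_iff)

lemma window_norm_triangle3:
  assumes f: "continuous_on UNIV f" and g: "continuous_on UNIV g" and h: "continuous_on UNIV h" and R: "R \<ge> 0"
  shows "window_dist R f h \<le> window_dist R f g + window_dist R g h"
  using window_norm_triangle[of "\<lambda>l. f l - g l" "\<lambda>l. g l - h l" R] assms
  by (simp add: continuous_on_diff)

lemma window_norm_zero: "R \<ge> 0 \<Longrightarrow> window_norm R (\<lambda>l. 0) = 0"
  using window_norm_scale[of "\<lambda>l. 0" "\<lambda>_. 0" R 0] window_norm_nonneg[of "\<lambda>l. 0" R]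
  by simp

lemma window_norm_sum:
  assumes "finite I" "\<And>i. i \<in> I \<Longrightarrow> continuous_on UNIV (f i)" and R: "R \<ge> 0"
  shows "window_norm R (\<lambda>l. \<Sum>i\<in>I. f i l) \<le> (\<Sum>i\<in>I. window_norm R (f i))"
  using assms(1,2)
proof (induction I)
  case empty
  then show ?case using window_norm_zero[OF R] by simp
next
  case (insert i I)
  have "window_norm R (\<lambda>l. f i l + (\<Sum>i\<in>I. f i l)) \<le> window_norm R (f i) + window_norm R (\<lambda>l. \<Sum>i\<in>I. f i l)"
    by (intro window_norm_triangle continuous_intros insert R) auto
  with insert show ?case by force
qed

end

subsection \<open>The completion\<close>

lemma C0_iff: "(f :: real \<Rightarrow> complex ^ 'm::finite) \<in> C0 \<longleftrightarrow> continuous_on UNIV f \<and> (\<exists>R\<ge>0. \<forall>x. \<bar>x\<bar> \<ge> R \<longrightarrow> f x = 0)"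
proof -
  have "bounded {x. f x \<noteq> 0} \<longleftrightarrow> (\<exists>R\<ge>0. \<forall>x. \<bar>x\<bar> \<ge> R \<longrightarrow> f x = 0)"
  proof
    assume "bounded {x. f x \<noteq> 0}"
    then obtain B where B: "\<forall>x\<in>{x. f x \<noteq> 0}. norm x \<le> B" by (auto simp: bounded_iff)
    then have "\<forall>x. \<bar>x\<bar> \<ge> \<bar>B\<bar> + 1 \<longrightarrow> f x = 0" by force
    then show "\<exists>R\<ge>0. \<forall>x. \<bar>x\<bar> \<ge> R \<longrightarrow> f x = 0" by (intro exI[of _ "\<bar>B\<bar> + 1"]) auto
  next
    assume "\<exists>R\<ge>0. \<forall>x. \<bar>x\<bar> \<ge> R \<longrightarrow> f x = 0"
    then show "bounded {x. f x \<noteq> 0}" unfolding bounded_iff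
      by (metis linorder_le_cases mem_Collect_eq real_norm_def)
  qed
  then show ?thesis by (simp add: C0_def)
qed

lemma C0_continuous: "f \<in> C0 \<Longrightarrow> continuous_on UNIV f"
  by (simp add: C0_def)

lemma C0_diff:
  assumes "f \<in> C0" "g \<in> C0" shows "(\<lambda>l. f l - g l) \<in> C0"
proof -
  obtain R R' where "R \<ge> 0" "\<forall>x. \<bar>x\<bar> \<ge> R \<longrightarrow> f x = 0" "R' \<ge> 0" "\<forall>x. \<bar>x\<bar> \<ge> R' \<longrightarrow> g x = 0"
    using assms unfolding C0_iff by blast
  then have "\<exists>R\<ge>0. \<forall>x. \<bar>x\<bar> \<ge> R \<longrightarrow> f x - g x = 0" by (intro exI[of _ "max R R'"]) auto
  with assms show ?thesis unfolding C0_iff by (auto intro!: continuous_intros)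
qed

lemma C0_zero: "(\<lambda>l. 0 :: complex ^ 'm::finite) \<in> C0"
  by (auto simp: C0_iff)

section \<open>The inner product of compactly supported functions and of their classes\<close>

context spectral_matrix
begin

text \<open>The radius depends on \<open>f\<close> alone: outside its support every integrand
  vanishes, whatever continuous \<open>g\<close> is paired with it.\<close>

lemma window_form_C0:
  assumes f: "f \<in> C0"
  shows "\<exists>R0\<ge>0. \<forall>R\<ge>R0. \<forall>g. continuous_on UNIV g \<longrightarrow> window_form R f g = window_form R0 f g"
proof -
  obtain R0 where R0: "R0 \<ge> 0" "\<forall>x. \<bar>x\<bar> \<ge> R0 \<longrightarrow> f x = 0" using f unfolding C0_iff by blast
  have "window_form R f g = window_form R0 f g" if R: "R \<ge> R0" and g: "continuous_on UNIV g" for R g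
    unfolding window_form_def
  proof (intro sum.cong refl)
    fix i j
    let ?h = "\<lambda>l. cnj (f l $ i) * g l $ j" and ?s = "\<lambda>l. \<sigma> l $ i $ j"
    obtain J where J: "\<forall>R\<ge>0. has_RS_integral ?h ?s (- R) R (J R) \<and>
       ((\<forall>x. \<bar>x\<bar> \<ge> R \<longrightarrow> ?h x = 0) \<longrightarrow> (\<forall>R'\<ge>R. J R' = J R))"
      using RS_integrator_entry[of i j, unfolded RS_integrator_def, rule_format,
          OF continuous_on_entries[OF C0_continuous[OF f] g, of i j]] by blast
    have "\<forall>x. \<bar>x\<bar> \<ge> R0 \<longrightarrow> ?h x = 0" using R0 by simp
    then have "J R = J R0" using J R0(1) R by blast
    moreover have *: "has_RS_integral ?h ?s (- R) R (J R)" "has_RS_integral ?h ?s (- R0) R0 (J R0)"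
      using J R0(1) R order_trans by blast+
    ultimately show "RS_integral ?h ?s (- R) R = RS_integral ?h ?s (- R0) R0"
      by (simp only: *[THEN RS_integral_eqI])
  qed
  with R0 show ?thesis by blast
qed

text \<open>A transfer principle: for finitely many functions of compact support one window serves
  them all, so statements on window forms become statements on \<open>sigma_inner\<close>.
  Uniqueness of limits discharges the definite description.\<close>

lemma eventually_window_form_eq:
  assumes f: "f \<in> C0"
  shows "eventually (\<lambda>R. R \<ge> 0 \<and> (\<forall>g. continuous_on UNIV g \<longrightarrow> window_form R f g = sigma_inner \<sigma> f g)) at_top"
proof -
  obtain R0 where R0: "R0 \<ge> 0" "\<forall>R\<ge>R0. \<forall>g. continuous_on UNIV g \<longrightarrow> window_form R f g = window_form R0 f g"
    using window_form_C0[OF f] by blast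
  have "sigma_inner \<sigma> f g = window_form R0 f g" if "continuous_on UNIV g" for g
  proof -
    have "eventually (\<lambda>R. window_form R f g = window_form R0 f g) at_top"
      by (rule eventually_mono[OF eventually_ge_at_top[of R0]]) (use R0(2) that in blast)
    then have *: "has_sigma_inner \<sigma> f g (window_form R0 f g)"
      unfolding has_sigma_inner_iff by (rule tendsto_eventually)
    show ?thesis unfolding sigma_inner_def
      by (rule the_equality[where P="has_sigma_inner \<sigma> f g", OF *])
         (rule tendsto_unique[OF trivial_limit_at_top_linorder], simp add: has_sigma_inner_iff,
           use * in \<open>simp add: has_sigma_inner_iff\<close>)
  qed
  then show ?thesis
    by (intro eventually_mono[OF eventually_ge_at_top[of R0]]) (use R0 in \<open>metis order_trans\<close>)
qed

lemma eventually_window_norm_eq: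
  "f \<in> C0 \<Longrightarrow> eventually (\<lambda>R. window_norm R f = sigma_norm \<sigma> f) at_top"
  by (rule eventually_mono[OF eventually_window_form_eq])
     (auto simp: window_norm_def sigma_norm_def C0_continuous)

lemma sigma_norm_nonneg: "f \<in> C0 \<Longrightarrow> 0 \<le> sigma_norm \<sigma> f"
proof -
  assume f: "f \<in> C0"
  have "eventually (\<lambda>R. window_norm R f = sigma_norm \<sigma> f \<and> R \<ge> 0) at_top"
    by (intro eventually_conj eventually_window_norm_eq f eventually_ge_at_top)
  then have "\<exists>R. window_norm R f = sigma_norm \<sigma> f \<and> R \<ge> 0" by (rule eventually_happens'[rotated]) simp
  then show ?thesis using window_norm_nonneg[OF C0_continuous[OF f]] by metis
qed

lemma sigma_norm_triangle3:
  assumes "f \<in> C0" "g \<in> C0" "h \<in> C0"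
  shows "sigma_dist f h \<le> sigma_dist f g + sigma_dist g h"
proof -
  have "eventually (\<lambda>R. window_dist R f h = sigma_dist f h \<and>
     window_dist R f g = sigma_dist f g \<and>
     window_dist R g h = sigma_dist g h \<and> R \<ge> 0) at_top"
    by (intro eventually_conj eventually_window_norm_eq eventually_ge_at_top C0_diff assms)
  then obtain R where R: "window_dist R f h = sigma_dist f h"
     "window_dist R f g = sigma_dist f g"
     "window_dist R g h = sigma_dist g h" "R \<ge> 0"
    using eventually_happens'[OF trivial_limit_at_top_linorder] by blast
  from window_norm_triangle3[OF assms[THEN C0_continuous] R(4)] show ?thesis unfolding R(1-3) .
qed

lemma sigma_norm_minus_commute:
  assumes "f \<in> C0" "g \<in> C0"
  shows "sigma_dist f g = sigma_dist g f"
proof -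
  have le: "sigma_dist f g \<le> sigma_dist g f" if "f \<in> C0" "g \<in> C0" for f g
  proof -
    have "eventually (\<lambda>R. window_dist R f g = sigma_dist f g \<and>
       window_dist R g f = sigma_dist g f \<and> R \<ge> 0) at_top"
      by (intro eventually_conj eventually_window_norm_eq eventually_ge_at_top C0_diff that)
    from eventually_happens'[OF trivial_limit_at_top_linorder this]
    show ?thesis
      using window_norm_minus[OF C0_continuous[OF C0_diff[OF that(2,1)]]]
      by (metis (no_types, lifting) ext minus_diff_eq)
  qed
  show ?thesis using le[OF assms] le[OF assms(2,1)] by simp
qed

lemma norm_sigma_inner_bound:
  assumes "f \<in> C0" "g \<in> C0"
  shows "norm (sigma_inner \<sigma> f g) \<le> 2 * (sigma_norm \<sigma> f * sigma_norm \<sigma> g)"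
proof -
  have "eventually (\<lambda>R. window_norm R f = sigma_norm \<sigma> f \<and> window_norm R g = sigma_norm \<sigma> g \<and>
     (R \<ge> 0 \<and> (\<forall>g. continuous_on UNIV g \<longrightarrow> window_form R f g = sigma_inner \<sigma> f g))) at_top"
    by (intro eventually_conj eventually_window_norm_eq eventually_window_form_eq assms)
  note ex = eventually_happens'[OF trivial_limit_at_top_linorder this]
  from ex show ?thesis
    using norm_window_form_bound[OF assms[THEN C0_continuous]] assms[THEN C0_continuous] by metis
qed

lemma sigma_inner_diff_left:
  assumes "f \<in> C0" "f' \<in> C0" "g \<in> C0"
  shows "sigma_inner \<sigma> (\<lambda>l. f l - f' l) g = sigma_inner \<sigma> f g - sigma_inner \<sigma> f' g"
proof -
  let ?P = "\<lambda>f R. R \<ge> 0 \<and> (\<forall>g. continuous_on UNIV g \<longrightarrow> window_form R f g = sigma_inner \<sigma> f g)"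
  have "eventually (\<lambda>R. ?P (\<lambda>l. f l - f' l) R \<and> ?P f R \<and> ?P f' R) at_top"
    by (intro eventually_conj eventually_window_form_eq assms C0_diff)
  then obtain R where R: "?P (\<lambda>l. f l - f' l) R" "?P f R" "?P f' R"
    using eventually_happens'[OF trivial_limit_at_top_linorder] by blast
  have "window_form R (\<lambda>l. (f l - f' l) + f' l) g = window_form R (\<lambda>l. f l - f' l) g + window_form R f' g"
    by (rule window_form_add_left) (use R assms C0_continuous in \<open>auto intro!: continuous_intros\<close>)
  moreover have "window_form R (\<lambda>l. f l - f' l) g = sigma_inner \<sigma> (\<lambda>l. f l - f' l) g"
    "window_form R f g = sigma_inner \<sigma> f g" "window_form R f' g = sigma_inner \<sigma> f' g"
    using R C0_continuous[OF assms(3)] by blast+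
  ultimately show ?thesis by simp
qed

lemma sigma_inner_commute:
  assumes "f \<in> C0" "g \<in> C0"
  shows "sigma_inner \<sigma> g f = cnj (sigma_inner \<sigma> f g)"
proof -
  let ?P = "\<lambda>f R. R \<ge> 0 \<and> (\<forall>g. continuous_on UNIV g \<longrightarrow> window_form R f g = sigma_inner \<sigma> f g)"
  have "eventually (\<lambda>R. ?P f R \<and> ?P g R) at_top"
    by (intro eventually_conj eventually_window_form_eq assms)
  then obtain R where R: "?P f R" "?P g R"
    using eventually_happens'[OF trivial_limit_at_top_linorder] by blast
  then show ?thesis using window_form_commute[of f g R] assms C0_continuous by metis
qed

lemma sigma_inner_diff_right:
  assumes "f \<in> C0" "f' \<in> C0" "g \<in> C0"
  shows "sigma_inner \<sigma> g (\<lambda>l. f l - f' l) = sigma_inner \<sigma> g f - sigma_inner \<sigma> g f'"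
  using sigma_inner_diff_left[OF assms] sigma_inner_commute[OF assms(1,3)]
    sigma_inner_commute[OF assms(2,3)] sigma_inner_commute[OF C0_diff[OF assms(1,2)] assms(3)]
  by simp

lemma sigma_norm_power2: "f \<in> C0 \<Longrightarrow> (sigma_norm \<sigma> f)\<^sup>2 = Re (sigma_inner \<sigma> f f)"
proof -
  assume f: "f \<in> C0"
  have "\<exists>R. R \<ge> 0 \<and> (\<forall>g. continuous_on UNIV g \<longrightarrow> window_form R f g = sigma_inner \<sigma> f g)"
    by (rule eventually_happens'[OF _ eventually_window_form_eq[OF f]]) simp
  then have "0 \<le> Re (sigma_inner \<sigma> f f)" using window_form_nonneg C0_continuous[OF f] by metis
  then show ?thesis by (simp add: sigma_norm_def)
qed

lemma sigma_norm_diff_power2: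
  assumes "f \<in> C0" "g \<in> C0"
  shows "(sigma_dist f g)\<^sup>2 =
    Re (sigma_inner \<sigma> f f) - Re (sigma_inner \<sigma> f g) - Re (sigma_inner \<sigma> g f) + Re (sigma_inner \<sigma> g g)"
  using sigma_norm_power2[OF C0_diff[OF assms]] assms C0_diff[OF assms]
  by (simp add: sigma_inner_diff_left sigma_inner_diff_right)

lemma sigma_Cauchy_C0: "u \<in> sigma_Cauchy \<sigma> \<Longrightarrow> u k \<in> C0"
  by (simp add: sigma_Cauchy_def)

lemma sigma_Cauchy_bounded:
  assumes u: "u \<in> sigma_Cauchy \<sigma>"
  obtains B where "B > 0" "\<And>k. sigma_norm \<sigma> (u k) \<le> B"
proof -
  obtain N where N: "\<forall>k\<ge>N. \<forall>m\<ge>N. sigma_dist (u k) (u m) < 1"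
    using u zero_less_one unfolding sigma_Cauchy_def by blast
  define B where "B = (\<Sum>k\<le>N. sigma_norm \<sigma> (u k)) + 1"
  have nn: "0 \<le> sigma_norm \<sigma> (u k)" for k using sigma_norm_nonneg sigma_Cauchy_C0[OF u] by blast
  have le: "sigma_norm \<sigma> (u k) \<le> (\<Sum>k\<le>N. sigma_norm \<sigma> (u k))" if "k \<le> N" for k
    by (rule member_le_sum) (use nn that in auto)
  have "sigma_norm \<sigma> (u k) \<le> B" for k
  proof (cases "k \<le> N")
    case True
    then show ?thesis using le unfolding B_def by fastforce
  next
    case False
    have "sigma_norm \<sigma> (\<lambda>l. u k l - 0) \<le> sigma_dist (u k) (u N) + sigma_norm \<sigma> (\<lambda>l. u N l - 0)"
      by (rule sigma_norm_triangle3) (use u C0_zero in \<open>auto intro: sigma_Cauchy_C0\<close>)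
    then show ?thesis using N[rule_format, of k N] False le[of N] unfolding B_def by simp
  qed
  moreover have "B > 0" unfolding B_def using nn by (simp add: sum_nonneg add_nonneg_pos)
  ultimately show thesis using that by blast
qed

lemma sigma_inner_difference_bound:
  assumes "f \<in> C0" "f' \<in> C0" "g \<in> C0" "g' \<in> C0"
  shows "norm (sigma_inner \<sigma> f g - sigma_inner \<sigma> f' g') \<le>
    2 * (sigma_dist f f' * sigma_norm \<sigma> g) + 2 * (sigma_norm \<sigma> f' * sigma_dist g g')"
proof -
  have "sigma_inner \<sigma> f g - sigma_inner \<sigma> f' g' =
    sigma_inner \<sigma> (\<lambda>l. f l - f' l) g + sigma_inner \<sigma> f' (\<lambda>l. g l - g' l)"
    using assms by (simp add: sigma_inner_diff_left sigma_inner_diff_right)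
  also have "norm \<dots> \<le> norm (sigma_inner \<sigma> (\<lambda>l. f l - f' l) g) + norm (sigma_inner \<sigma> f' (\<lambda>l. g l - g' l))"
    by (rule norm_triangle_ineq)
  finally show ?thesis
    using norm_sigma_inner_bound[of "\<lambda>l. f l - f' l" g] norm_sigma_inner_bound[of f' "\<lambda>l. g l - g' l"]
      assms C0_diff by fastforce
qed

lemma sigma_inner_Cauchy:
  assumes u: "u \<in> sigma_Cauchy \<sigma>" and v: "v \<in> sigma_Cauchy \<sigma>"
  shows "convergent (\<lambda>k. sigma_inner \<sigma> (u k) (v k))"
proof -
  obtain B where B: "B > 0" "\<And>k. sigma_norm \<sigma> (u k) \<le> B" using sigma_Cauchy_bounded[OF u] by blast
  obtain C where C: "C > 0" "\<And>k. sigma_norm \<sigma> (v k) \<le> C" using sigma_Cauchy_bounded[OF v] by blast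
  note nn = sigma_norm_nonneg[OF sigma_Cauchy_C0[OF u]] sigma_norm_nonneg[OF sigma_Cauchy_C0[OF v]]
    sigma_norm_nonneg[OF C0_diff[OF sigma_Cauchy_C0[OF u] sigma_Cauchy_C0[OF u]]]
    sigma_norm_nonneg[OF C0_diff[OF sigma_Cauchy_C0[OF v] sigma_Cauchy_C0[OF v]]]
  have "Cauchy (\<lambda>k. sigma_inner \<sigma> (u k) (v k))"
  proof (rule metric_CauchyI)
    fix e :: real assume "e > 0"
    \<comment> \<open>Chosen so that \<open>2 * (d * C) + 2 * (B * d) = e\<close>; the first summand
      is estimated strictly.\<close>
    define d where "d = e / (2 * (B + C))"
    have d: "d > 0" using \<open>e > 0\<close> B C by (simp add: d_def)
    have "2 * (d * C) + 2 * (B * d) = 2 * (B + C) * d" by (simp add: algebra_simps)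
    also have "\<dots> = e" using B C by (simp add: d_def)
    finally have de: "2 * (d * C) + 2 * (B * d) = e" .
    obtain N where N: "\<forall>k\<ge>N. \<forall>m\<ge>N. sigma_dist (u k) (u m) < d"
      using u d unfolding sigma_Cauchy_def by blast
    obtain N' where N': "\<forall>k\<ge>N'. \<forall>m\<ge>N'. sigma_dist (v k) (v m) < d"
      using v d unfolding sigma_Cauchy_def by blast
    have "dist (sigma_inner \<sigma> (u m) (v m)) (sigma_inner \<sigma> (u n) (v n)) < e"
      if "m \<ge> max N N'" "n \<ge> max N N'" for m n
    proof -
      have "dist (sigma_inner \<sigma> (u m) (v m)) (sigma_inner \<sigma> (u n) (v n)) \<le>
        2 * (sigma_dist (u m) (u n) * sigma_norm \<sigma> (v m)) + 2 * (sigma_norm \<sigma> (u n) * sigma_dist (v m) (v n))"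
        unfolding dist_norm by (intro sigma_inner_difference_bound sigma_Cauchy_C0 u v)
      also have "sigma_dist (u m) (u n) * sigma_norm \<sigma> (v m) < d * C"
        by (rule order_le_less_trans[OF mult_left_mono[OF C(2)] mult_strict_right_mono])
          (use N that nn C d in auto)
      also have "sigma_norm \<sigma> (u n) * sigma_dist (v m) (v n) \<le> B * d"
        by (rule mult_mono) (use N' that nn B d in \<open>auto intro: less_imp_le\<close>)
      finally show ?thesis using de by simp
    qed
    then show "\<exists>M. \<forall>m\<ge>M. \<forall>n\<ge>M. dist (sigma_inner \<sigma> (u m) (v m)) (sigma_inner \<sigma> (u n) (v n)) < e" by blast
  qed
  then show ?thesis by (simp add: Cauchy_convergent_iff)
qed

lemma sigma_inner_equiv:
  assumes u: "(u, u') \<in> sigma_equiv \<sigma>" and v: "(v, v') \<in> sigma_equiv \<sigma>"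
  shows "(\<lambda>k. sigma_inner \<sigma> (u k) (v k) - sigma_inner \<sigma> (u' k) (v' k)) \<longlonglongrightarrow> 0"
proof -
  have c: "u \<in> sigma_Cauchy \<sigma>" "u' \<in> sigma_Cauchy \<sigma>" "v \<in> sigma_Cauchy \<sigma>" "v' \<in> sigma_Cauchy \<sigma>"
    using u v by (auto simp: sigma_equiv_def)
  obtain B where B: "B > 0" "\<And>k. sigma_norm \<sigma> (u' k) \<le> B" using sigma_Cauchy_bounded[OF c(2)] by blast
  obtain C where C: "C > 0" "\<And>k. sigma_norm \<sigma> (v k) \<le> C" using sigma_Cauchy_bounded[OF c(3)] by blast
  have "(\<lambda>k. 2 * (sigma_dist (u k) (u' k) * C) + 2 * (B * sigma_dist (v k) (v' k))) \<longlonglongrightarrow>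
     2 * (0 * C) + 2 * (B * 0)"
    using u v unfolding sigma_equiv_def by (intro tendsto_intros) auto
  then have lim: "(\<lambda>k. 2 * (sigma_dist (u k) (u' k) * C) + 2 * (B * sigma_dist (v k) (v' k))) \<longlonglongrightarrow> 0"
    by simp
  show ?thesis
  proof (rule Lim_null_comparison[OF _ lim])
  show "\<forall>\<^sub>F k in sequentially. norm (sigma_inner \<sigma> (u k) (v k) - sigma_inner \<sigma> (u' k) (v' k)) \<le>
      2 * (sigma_dist (u k) (u' k) * C) + 2 * (B * sigma_dist (v k) (v' k))"
    proof (rule always_eventually, rule allI)
      fix k
      have "norm (sigma_inner \<sigma> (u k) (v k) - sigma_inner \<sigma> (u' k) (v' k)) \<le>
        2 * (sigma_dist (u k) (u' k) * sigma_norm \<sigma> (v k)) + 2 * (sigma_norm \<sigma> (u' k) * sigma_dist (v k) (v' k))"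
        by (intro sigma_inner_difference_bound sigma_Cauchy_C0 c)
      also have "\<dots> \<le> 2 * (sigma_dist (u k) (u' k) * C) + 2 * (B * sigma_dist (v k) (v' k))"
        by (intro add_mono mult_left_mono mult_right_mono B C sigma_norm_nonneg C0_diff sigma_Cauchy_C0 c) auto
      finally show "norm (sigma_inner \<sigma> (u k) (v k) - sigma_inner \<sigma> (u' k) (v' k)) \<le>
        2 * (sigma_dist (u k) (u' k) * C) + 2 * (B * sigma_dist (v k) (v' k))" .
    qed
  qed
qed

lemma equiv_sigma_equiv: "equiv (sigma_Cauchy \<sigma>) (sigma_equiv \<sigma>)"
proof (rule equivI)
  show "sigma_equiv \<sigma> \<subseteq> sigma_Cauchy \<sigma> \<times> sigma_Cauchy \<sigma>" by (auto simp: sigma_equiv_def)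
  have "sigma_norm \<sigma> (\<lambda>l. 0) = 0"
  proof -
    have "eventually (\<lambda>R. window_norm R (\<lambda>l. 0) = sigma_norm \<sigma> (\<lambda>l. 0) \<and> R \<ge> 0) at_top"
      by (intro eventually_conj eventually_window_norm_eq C0_zero eventually_ge_at_top)
    from eventually_happens'[OF trivial_limit_at_top_linorder this] show ?thesis using window_norm_zero by metis
  qed
  then show "refl_on (sigma_Cauchy \<sigma>) (sigma_equiv \<sigma>)"
    by (auto simp: refl_on_def sigma_equiv_def)
  show "sym (sigma_equiv \<sigma>)"
  proof (rule symI)
    fix u v assume uv: "(u, v) \<in> sigma_equiv \<sigma>"
    then have "(\<lambda>l. sigma_norm \<sigma> (\<lambda>la. u l la - v l la)) = (\<lambda>l. sigma_norm \<sigma> (\<lambda>la. v l la - u l la))"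
      by (intro ext sigma_norm_minus_commute) (auto simp: sigma_equiv_def intro: sigma_Cauchy_C0)
    with uv show "(v, u) \<in> sigma_equiv \<sigma>" by (simp add: sigma_equiv_def)
  qed
  show "trans (sigma_equiv \<sigma>)"
  proof (rule transI)
    fix u v w assume uv: "(u, v) \<in> sigma_equiv \<sigma>" and vw: "(v, w) \<in> sigma_equiv \<sigma>"
    then have c: "u \<in> sigma_Cauchy \<sigma>" "v \<in> sigma_Cauchy \<sigma>" "w \<in> sigma_Cauchy \<sigma>"
      by (auto simp: sigma_equiv_def)
    have "(\<lambda>k. sigma_dist (u k) (v k) + sigma_dist (v k) (w k)) \<longlonglongrightarrow> 0 + 0"
      using uv vw unfolding sigma_equiv_def by (intro tendsto_intros) auto
    then have lim: "(\<lambda>k. sigma_dist (u k) (v k) + sigma_dist (v k) (w k)) \<longlonglongrightarrow> 0" by simp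
    have "(\<lambda>k. sigma_dist (u k) (w k)) \<longlonglongrightarrow> 0"
    proof (rule tendsto_sandwich[OF _ _ tendsto_const lim])
      show "\<forall>\<^sub>F k in sequentially. 0 \<le> sigma_dist (u k) (w k)"
        by (intro always_eventually allI sigma_norm_nonneg C0_diff sigma_Cauchy_C0 c)
      show "\<forall>\<^sub>F k in sequentially. sigma_dist (u k) (w k) \<le>
          sigma_dist (u k) (v k) + sigma_dist (v k) (w k)"
        by (intro always_eventually allI sigma_norm_triangle3 sigma_Cauchy_C0 c)
    qed
    with c show "(u, w) \<in> sigma_equiv \<sigma>" by (simp add: sigma_equiv_def)
  qed
qed

text \<open>The definite description over pairs of representatives is legitimate: inner products of
  Cauchy sequences converge, and equivalent representatives change them by a null sequence. Any
  representatives may then be used to compute the value.\<close>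

lemma L2_sigma_inner_tendsto:
  assumes "\<xi> \<in> L2_sigma \<sigma>" "\<eta> \<in> L2_sigma \<sigma>" and u: "u \<in> \<xi>" and v: "v \<in> \<eta>"
  shows "(\<lambda>k. sigma_inner \<sigma> (u k) (v k)) \<longlonglongrightarrow> L2_sigma_inner \<sigma> \<xi> \<eta>"
proof -
  have rel: "(u', u) \<in> sigma_equiv \<sigma>" if "u' \<in> \<xi>" for u'
    using quotient_eq_iff[OF equiv_sigma_equiv, of \<xi> \<xi> u' u] assms that by (auto simp: L2_sigma_def)
  have rel': "(v', v) \<in> sigma_equiv \<sigma>" if "v' \<in> \<eta>" for v'
    using quotient_eq_iff[OF equiv_sigma_equiv, of \<eta> \<eta> v' v] assms that by (auto simp: L2_sigma_def)
  have "u \<in> sigma_Cauchy \<sigma>" "v \<in> sigma_Cauchy \<sigma>"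
    using rel[OF u] rel'[OF v] by (auto simp: sigma_equiv_def)
  then obtain c where c: "(\<lambda>k. sigma_inner \<sigma> (u k) (v k)) \<longlonglongrightarrow> c"
    using sigma_inner_Cauchy unfolding convergent_def by blast
  have "L2_sigma_inner \<sigma> \<xi> \<eta> = c"
    unfolding L2_sigma_inner_def
  proof (rule the_equality)
    show "\<exists>u\<in>\<xi>. \<exists>v\<in>\<eta>. (\<lambda>k. sigma_inner \<sigma> (u k) (v k)) \<longlonglongrightarrow> c" using u v c by blast
    fix c' assume "\<exists>u\<in>\<xi>. \<exists>v\<in>\<eta>. (\<lambda>k. sigma_inner \<sigma> (u k) (v k)) \<longlonglongrightarrow> c'"
    then obtain u' v' where u'v': "u' \<in> \<xi>" "v' \<in> \<eta>" "(\<lambda>k. sigma_inner \<sigma> (u' k) (v' k)) \<longlonglongrightarrow> c'" by blast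
    have "(\<lambda>k. sigma_inner \<sigma> (u' k) (v' k) - sigma_inner \<sigma> (u k) (v k)) \<longlonglongrightarrow> c' - c"
      by (intro tendsto_intros u'v' c)
    then show "c' = c"
      using sigma_inner_equiv[OF rel[OF u'v'(1)] rel'[OF u'v'(2)]] LIMSEQ_unique by fastforce
  qed
  with c show ?thesis by simp
qed

end

subsection \<open>Completeness and surjectivity from density\<close>

lemma norm_diff_power2_le: "(norm (a - b :: 'a::real_normed_vector))\<^sup>2 \<le> 2 * (norm a)\<^sup>2 + 2 * (norm b)\<^sup>2"
proof -
  have "(norm (a - b))\<^sup>2 \<le> (norm a + norm b)\<^sup>2"
    by (intro power_mono norm_triangle_ineq4) auto
  also have "\<dots> \<le> 2 * (norm a)\<^sup>2 + 2 * (norm b)\<^sup>2"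
    using sum_squares_bound[of "norm a" "norm b"] by (simp add: power2_sum)
  finally show ?thesis .
qed

lemma integrable_norm_diff_power2:
  fixes f g :: "'a \<Rightarrow> 'b::{banach, second_countable_topology}"
  assumes [measurable]: "f \<in> borel_measurable M" "g \<in> borel_measurable M"
    and "integrable M (\<lambda>x. (norm (f x))\<^sup>2)" "integrable M (\<lambda>x. (norm (g x))\<^sup>2)"
  shows "integrable M (\<lambda>x. (norm (f x - g x))\<^sup>2)"
proof (rule Bochner_Integration.integrable_bound)
  show "integrable M (\<lambda>x. 2 * (norm (f x))\<^sup>2 + 2 * (norm (g x))\<^sup>2)" using assms by simp
  show "AE x in M. norm ((norm (f x - g x))\<^sup>2) \<le> norm (2 * (norm (f x))\<^sup>2 + 2 * (norm (g x))\<^sup>2)"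
    using norm_diff_power2_le by (intro AE_I2) (simp add: abs_of_nonneg)
qed measurable

text \<open>The weighted terms are eventually below 1, so the differences are dominated by the
  geometric series of ratio \<open>sqrt (1/2)\<close>.\<close>

lemma summable_differences_convergent:
  fixes h :: "nat \<Rightarrow> 'b::banach"
  assumes "summable (\<lambda>j. 2 ^ j * (norm (h (Suc j) - h j))\<^sup>2)"
  shows "convergent h"
proof -
  have "eventually (\<lambda>j. 2 ^ j * (norm (h (Suc j) - h j))\<^sup>2 < 1) sequentially"
    using summable_LIMSEQ_zero[OF assms] by (rule order_tendstoD) simp
  then have ev: "eventually (\<lambda>j. norm (h (Suc j) - h j) \<le> sqrt (1/2) ^ j) sequentially"
  proof eventually_elim
    case (elim j)
    have "(norm (h (Suc j) - h j))\<^sup>2 \<le> (1/2) ^ j"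
      using elim by (simp add: field_simps power_divide)
    also have "(1/2) ^ j = (sqrt (1/2) ^ j)\<^sup>2"
      by (simp add: power_mult[symmetric] mult.commute[of j] power_mult real_sqrt_divide power_divide)
    finally show ?case by (rule power2_le_imp_le) simp
  qed
  have "summable (\<lambda>j. h (Suc j) - h j)"
    by (rule summable_comparison_test_ev[OF ev]) (simp add: summable_geometric)
  then have "convergent (\<lambda>n. (\<Sum>j<n. h (Suc j) - h j) + h 0)"
    unfolding summable_iff_convergent by (intro convergent_add) (auto simp: convergent_const)
  then show ?thesis by (simp add: sum_lessThan_telescope)
qed

text \<open>Riesz-Fischer: a rapidly converging subsequence converges almost everywhere, and Fatou's
  lemma turns the pointwise limit into a limit in mean square.\<close>

lemma L2_complete:
  fixes f :: "nat \<Rightarrow> 'a \<Rightarrow> 'b::{banach, second_countable_topology}"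
  assumes [measurable]: "\<And>k. f k \<in> borel_measurable M"
    and int: "\<And>k. integrable M (\<lambda>x. (norm (f k x))\<^sup>2)"
    and Cauchy: "\<And>e. e > 0 \<Longrightarrow> \<exists>N. \<forall>k\<ge>N. \<forall>m\<ge>N. (\<integral>x. (norm (f k x - f m x))\<^sup>2 \<partial>M) < e"
  obtains g where "g \<in> borel_measurable M" "integrable M (\<lambda>x. (norm (g x))\<^sup>2)"
    "(\<lambda>k. \<integral>x. (norm (f k x - g x))\<^sup>2 \<partial>M) \<longlonglongrightarrow> 0"
proof -
  note int2 = integrable_norm_diff_power2[OF assms(1) assms(1) int int]
  have nn2: "(\<integral>\<^sup>+x. ennreal ((norm (f k x - f m x))\<^sup>2) \<partial>M) = ennreal (\<integral>x. (norm (f k x - f m x))\<^sup>2 \<partial>M)" for k m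
    by (rule nn_integral_eq_integral[OF int2]) simp
  \<comment> \<open>The rate \<open>1/8\<close> beats the weight \<open>2 ^ j\<close> used below:
    \<open>2 ^ j * (1/8) ^ j = (1/4) ^ j\<close> is summable.\<close>
  obtain N where N: "\<And>j k m. k \<ge> N j \<Longrightarrow> m \<ge> N j \<Longrightarrow> (\<integral>x. (norm (f k x - f m x))\<^sup>2 \<partial>M) < (1/8) ^ j"
    using Cauchy[of "(1/8) ^ j" for j] by (auto simp: choice_iff) metis
  \<comment> \<open>Summing the thresholds makes \<open>r j\<close> exceed all \<open>N i\<close>
    with \<open>i \<le> j\<close> at once.\<close>
  define r where "r j = (\<Sum>i\<le>j. N i)" for j
  have r: "N i \<le> r j" if "i \<le> j" for i j
    unfolding r_def using that by (intro member_le_sum) auto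
  define h where "h j = f (r j)" for j
  have h [measurable]: "h j \<in> borel_measurable M" for j by (simp add: h_def)
  define g where "g x = lim (\<lambda>j. h j x)" for x
  have g [measurable]: "g \<in> borel_measurable M"
    unfolding g_def by (rule borel_measurable_lim_metric) measurable
  have "(\<integral>\<^sup>+x. (\<Sum>j. ennreal (2 ^ j * (norm (h (Suc j) x - h j x))\<^sup>2)) \<partial>M) =
      (\<Sum>j. \<integral>\<^sup>+x. ennreal (2 ^ j * (norm (h (Suc j) x - h j x))\<^sup>2) \<partial>M)"
    by (rule nn_integral_suminf) measurable
  also have "\<dots> \<le> (\<Sum>j. ennreal ((1/4) ^ j))"
  proof (rule suminf_le)
    fix j
    have "(\<integral>\<^sup>+x. ennreal (2 ^ j * (norm (h (Suc j) x - h j x))\<^sup>2) \<partial>M) =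
       ennreal (2 ^ j) * ennreal (\<integral>x. (norm (h (Suc j) x - h j x))\<^sup>2 \<partial>M)"
      by (simp add: ennreal_mult nn_integral_cmult h_def nn2)
    also have "\<dots> = ennreal (2 ^ j * (\<integral>x. (norm (h (Suc j) x - h j x))\<^sup>2 \<partial>M))"
      by (simp add: ennreal_mult)
    also have "\<dots> \<le> ennreal (2 ^ j * (1/8) ^ j)"
      using N[of j "r (Suc j)" "r j"] r[of j j] r[of j "Suc j"] unfolding h_def
      by (intro ennreal_leI mult_left_mono) auto
    also have "(2::real) ^ j * (1/8) ^ j = (1/4) ^ j"
      by (simp add: power_mult_distrib[symmetric])
    finally show "(\<integral>\<^sup>+x. ennreal (2 ^ j * (norm (h (Suc j) x - h j x))\<^sup>2) \<partial>M) \<le> ennreal ((1/4) ^ j)" .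
  qed auto
  also have "\<dots> = ennreal (\<Sum>j. (1/4) ^ j)"
    by (rule suminf_ennreal2) (auto simp: summable_geometric)
  also have "\<dots> < \<infinity>" by simp
  finally have "AE x in M. (\<Sum>j. ennreal (2 ^ j * (norm (h (Suc j) x - h j x))\<^sup>2)) \<noteq> \<infinity>"
    by (intro nn_integral_noteq_infinite) auto
  then have lim: "AE x in M. (\<lambda>j. h j x) \<longlonglongrightarrow> g x"
  proof eventually_elim
    case (elim x)
    have "summable (\<lambda>j. 2 ^ j * (norm (h (Suc j) x - h j x))\<^sup>2)"
      by (rule summable_suminf_not_top) (use elim in auto)
    then have "convergent (\<lambda>j. h j x)" by (rule summable_differences_convergent)
    then show ?case by (simp add: g_def convergent_LIMSEQ_iff)
  qed
  \<comment> \<open>Fatou's lemma in the index of the subsequence: the bound for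
    \<open>f k - h j\<close> survives the limit in \<open>j\<close>.\<close>
  have bound: "(\<integral>\<^sup>+x. ennreal ((norm (f k x - g x))\<^sup>2) \<partial>M) \<le> ennreal ((1/8) ^ i)" if k: "k \<ge> N i" for k i
  proof -
    have "(\<integral>\<^sup>+x. ennreal ((norm (f k x - g x))\<^sup>2) \<partial>M) = (\<integral>\<^sup>+x. liminf (\<lambda>j. ennreal ((norm (f k x - h j x))\<^sup>2)) \<partial>M)"
    proof (rule nn_integral_cong_AE, use lim in eventually_elim)
      case (elim x)
      have "(\<lambda>j. ennreal ((norm (f k x - h j x))\<^sup>2)) \<longlonglongrightarrow> ennreal ((norm (f k x - g x))\<^sup>2)"
        by (intro tendsto_intros tendsto_ennrealI elim)
      from lim_imp_Liminf[OF sequentially_bot this] show ?case by (rule sym)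
    qed
    also have "\<dots> \<le> liminf (\<lambda>j. \<integral>\<^sup>+x. ennreal ((norm (f k x - h j x))\<^sup>2) \<partial>M)"
      by (rule nn_integral_liminf) measurable
    also have "\<dots> \<le> liminf (\<lambda>j::nat. ennreal ((1/8) ^ i))"
    proof (rule Liminf_mono)
      show "\<forall>\<^sub>F j in sequentially. (\<integral>\<^sup>+x. ennreal ((norm (f k x - h j x))\<^sup>2) \<partial>M) \<le> ennreal ((1/8) ^ i)"
        using eventually_ge_at_top[of i]
      proof eventually_elim
        case (elim j)
        show ?case unfolding h_def nn2
            using N[OF k order_trans[OF order_refl r[OF elim]]] by (intro ennreal_leI) simp
      qed
    qed
    finally show ?thesis by (simp add: Liminf_const)
  qed
  have int_fg: "integrable M (\<lambda>x. (norm (f k x - g x))\<^sup>2)" if "k \<ge> N 0" for k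
  proof (rule integrableI_bounded)
    show "(\<integral>\<^sup>+x. ennreal (norm ((norm (f k x - g x))\<^sup>2)) \<partial>M) < \<infinity>"
      using order_le_less_trans[OF bound[OF that] ennreal_less_top] by simp
  qed measurable
  \<comment> \<open>Square integrability of \<open>g = f - (f - g)\<close> follows from that of both
    terms.\<close>
  have "integrable M (\<lambda>x. (norm (f (N 0) x - (f (N 0) x - g x)))\<^sup>2)"
    by (rule integrable_norm_diff_power2) (use int int_fg[of "N 0"] in auto)
  then have "integrable M (\<lambda>x. (norm (g x))\<^sup>2)" by simp
  moreover have "(\<lambda>k. \<integral>x. (norm (f k x - g x))\<^sup>2 \<partial>M) \<longlonglongrightarrow> 0"
  proof (rule LIMSEQ_I)
    fix e :: real assume "e > 0"
    then obtain i where i: "(1/8) ^ i < e" using real_arch_pow_inv[of e "1/8"] by auto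
    have "norm ((\<integral>x. (norm (f k x - g x))\<^sup>2 \<partial>M) - 0) < e" if "k \<ge> max (N 0) (N i)" for k
    proof -
      have "ennreal (\<integral>x. (norm (f k x - g x))\<^sup>2 \<partial>M) \<le> ennreal ((1/8) ^ i)"
        using bound[of i k] that by (subst nn_integral_eq_integral[symmetric, OF int_fg]) auto
      then have "(\<integral>x. (norm (f k x - g x))\<^sup>2 \<partial>M) \<le> (1/8) ^ i" by simp
      with i show ?thesis by simp
    qed
    then show "\<exists>no. \<forall>k\<ge>no. norm ((\<integral>x. (norm (f k x - g x))\<^sup>2 \<partial>M) - 0) < e" by blast
  qed
  ultimately show thesis using that g by blast
qed

lemma norm_cinner_le: "norm (cinner u v) \<le> 2 * (norm u * norm v)"
proof -
  have "norm (\<i> *s v) = norm v" for v :: "complex ^ 'a"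
    by (simp add: norm_vec_def norm_mult L2_set_def)
  moreover have "Im (cinner u v) = - (u \<bullet> (\<i> *s v))"
    by (simp add: Re_cinner[symmetric] cinner_smult_right)
  ultimately have "\<bar>Im (cinner u v)\<bar> \<le> norm u * norm v"
    using Cauchy_Schwarz_ineq2[of u "\<i> *s v"] by simp
  moreover have "\<bar>Re (cinner u v)\<bar> \<le> norm u * norm v"
    using Cauchy_Schwarz_ineq2[of u v] by (simp add: Re_cinner)
  ultimately show ?thesis using cmod_le[of "cinner u v"] by linarith
qed

lemma borel_measurable_cinner [measurable]:
  fixes f g :: "'a \<Rightarrow> complex ^ 'm::finite"
  assumes "f \<in> borel_measurable M" "g \<in> borel_measurable M"
  shows "(\<lambda>x. cinner (f x) (g x)) \<in> borel_measurable M"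
  using assms
proof (rule borel_measurable_continuous_Pair)
  show "continuous_on UNIV (\<lambda>x :: (complex ^ 'm) \<times> (complex ^ 'm). cinner (fst x) (snd x))"
    unfolding cinner_def by (intro continuous_intros)
qed

lemma L2_half_line_D:
  assumes "f \<in> L2_half_line"
  shows "f \<in> borel_measurable (lebesgue_on {0..})" "integrable (lebesgue_on {0..}) (\<lambda>x. (norm (f x))\<^sup>2)"
  using assms by (auto simp: L2_half_line_def)

lemma integrable_cinner:
  assumes f: "f \<in> L2_half_line" and g: "g \<in> L2_half_line"
  shows "integrable (lebesgue_on {0..}) (\<lambda>x. cinner (f x) (g x))"
proof (rule Bochner_Integration.integrable_bound)
  show "integrable (lebesgue_on {0..}) (\<lambda>x. (norm (f x))\<^sup>2 + (norm (g x))\<^sup>2)"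
    by (intro Bochner_Integration.integrable_add L2_half_line_D f g)
  have "norm (cinner (f x) (g x)) \<le> (norm (f x))\<^sup>2 + (norm (g x))\<^sup>2" for x
    using norm_cinner_le[of "f x" "g x"] sum_squares_bound[of "norm (f x)" "norm (g x)"] by linarith
  then show "AE x in lebesgue_on {0..}. norm (cinner (f x) (g x)) \<le> norm ((norm (f x))\<^sup>2 + (norm (g x))\<^sup>2)"
    by (intro AE_I2) (simp add: abs_of_nonneg)
  show "(\<lambda>x. cinner (f x) (g x)) \<in> borel_measurable (lebesgue_on {0..})"
    using L2_half_line_D f g by measurable
qed

definition L2_dist :: "(real \<Rightarrow> complex ^ 'm::finite) \<Rightarrow> (real \<Rightarrow> complex ^ 'm) \<Rightarrow> real" where
  "L2_dist f g = sqrt (LINT x|lebesgue_on {0..}. (norm (f x - g x))\<^sup>2)"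

lemma L2_dist_power2: "(L2_dist f g)\<^sup>2 = (LINT x|lebesgue_on {0..}. (norm (f x - g x))\<^sup>2)"
  by (simp add: L2_dist_def)

lemma L2_dist_inner:
  assumes f: "f \<in> L2_half_line" and g: "g \<in> L2_half_line"
  shows "(L2_dist f g)\<^sup>2 = Re (L2_half_line_inner f f) - Re (L2_half_line_inner f g)
     - Re (L2_half_line_inner g f) + Re (L2_half_line_inner g g)"
proof -
  have *: "(norm (f x - g x))\<^sup>2 = Re (cinner (f x) (f x)) - Re (cinner (f x) (g x)) - Re (cinner (g x) (f x))
      + Re (cinner (g x) (g x))" for x
    by (simp add: Re_cinner power2_norm_eq_inner inner_diff_left inner_diff_right)
  show ?thesis
    unfolding L2_dist_power2 * L2_half_line_inner_def
    by (simp add: integrable_cinner f g)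
qed

section \<open>Distances under the isometry and closedness of its range\<close>

context spectral_matrix
begin

text \<open>The assumption on \<open>F\<close> speaks of inner products of classes. Expanding both
  squared distances into four inner products turns it into a statement on arbitrary representatives,
  without ever forming a difference of classes.\<close>

lemma isometric_extension_tendsto:
  assumes F: "isometric_extension Y \<sigma> F" and f: "f \<in> L2_half_line" and g: "g \<in> L2_half_line"
    and u: "u \<in> F f" and v: "v \<in> F g"
  shows "(\<lambda>k. sigma_dist (u k) (v k)) \<longlonglongrightarrow> L2_dist f g"
proof -
  have FL: "F f \<in> L2_sigma \<sigma>" "F g \<in> L2_sigma \<sigma>" using F f g by (auto simp: isometric_extension_def)
  have "u \<in> sigma_Cauchy \<sigma>" "v \<in> sigma_Cauchy \<sigma>"
    using FL u v in_quotient_imp_subset[OF equiv_sigma_equiv] unfolding L2_sigma_def by blast+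
  then have C0: "u k \<in> C0" "v k \<in> C0" for k by (auto intro: sigma_Cauchy_C0)
  have inner: "L2_sigma_inner \<sigma> (F f') (F g') = L2_half_line_inner f' g'"
    if "f' \<in> L2_half_line" "g' \<in> L2_half_line" for f' g'
    using F that by (auto simp: isometric_extension_def)
  have "(\<lambda>k. Re (sigma_inner \<sigma> (u k) (u k)) - Re (sigma_inner \<sigma> (u k) (v k)) - Re (sigma_inner \<sigma> (v k) (u k))
      + Re (sigma_inner \<sigma> (v k) (v k))) \<longlonglongrightarrow> (L2_dist f g)\<^sup>2"
    unfolding L2_dist_inner[OF f g] inner[OF f f, symmetric] inner[OF f g, symmetric]
      inner[OF g f, symmetric] inner[OF g g, symmetric]
    by (intro tendsto_intros L2_sigma_inner_tendsto FL u v)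
  then have "(\<lambda>k. (sigma_dist (u k) (v k))\<^sup>2) \<longlonglongrightarrow> (L2_dist f g)\<^sup>2"
    by (simp add: sigma_norm_diff_power2 C0)
  then have "(\<lambda>k. sqrt ((sigma_dist (u k) (v k))\<^sup>2)) \<longlonglongrightarrow> sqrt ((L2_dist f g)\<^sup>2)"
    by (rule tendsto_real_sqrt)
  then show ?thesis
    using sigma_norm_nonneg[OF C0_diff[OF C0]] by (simp add: L2_dist_def)
qed

text \<open>A class is a sequence of functions \<open>u k\<close> in \<open>C0\<close>. Each is
  approximated by the image of some \<open>w k\<close>, the isometry carries the Cauchy property
  back to \<open>w\<close>, and the limit of \<open>w\<close> in the complete space is a
  preimage.\<close>

lemma surjective_if_dense:
  fixes F :: "(real \<Rightarrow> complex ^ 'm::finite) \<Rightarrow> (nat \<Rightarrow> real \<Rightarrow> complex ^ 'n) set"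
  assumes F: "isometric_extension Y \<sigma> F"
    and dense: "\<And>h e. h \<in> C0 \<Longrightarrow> e > 0 \<Longrightarrow>
      \<exists>w\<in>L2_half_line. \<exists>v\<in>F w. \<forall>\<^sub>F k in sequentially. sigma_dist h (v k) < e"
  shows "F ` L2_half_line = L2_sigma \<sigma>"
proof
  have FL: "F f \<in> L2_sigma \<sigma>" if "f \<in> L2_half_line" for f
    using F that by (auto simp: isometric_extension_def)
  then show "F ` L2_half_line \<subseteq> L2_sigma \<sigma>" by blast
  show "L2_sigma \<sigma> \<subseteq> F ` L2_half_line"
  proof
    fix \<xi> assume \<xi>: "\<xi> \<in> L2_sigma \<sigma>"
    then obtain u where u: "u \<in> \<xi>" "u \<in> sigma_Cauchy \<sigma>"
      using in_quotient_imp_non_empty[OF equiv_sigma_equiv] in_quotient_imp_subset[OF equiv_sigma_equiv]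
      unfolding L2_sigma_def by blast
    have uC: "u k \<in> C0" for k using u(2) by (rule sigma_Cauchy_C0)
    let ?P = "\<lambda>k p. fst p \<in> L2_half_line \<and> snd p \<in> F (fst p) \<and>
       (\<forall>\<^sub>F m in sequentially. sigma_dist (u k) (snd p m) < 1 / real (Suc k))"
    have "\<forall>k. \<exists>p. ?P k p"
    proof
      fix k
      have "1 / real (Suc k) > 0" by simp
      from dense[OF uC this, of k] obtain w v where "?P k (w, v)" by auto
      then show "\<exists>p. ?P k p" by (rule exI)
    qed
    from choice[OF this] obtain p where p: "\<forall>k. ?P k (p k)" by (rule exE)
    define w v where "w k = fst (p k)" and "v k = snd (p k)" for k
    have w: "w k \<in> L2_half_line" and v: "v k \<in> F (w k)"
      and uv: "\<forall>\<^sub>F m in sequentially. sigma_dist (u k) (v k m) < 1 / real (Suc k)" for k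
      using p by (auto simp: w_def v_def)
    have "v k \<in> sigma_Cauchy \<sigma>" for k
      using FL[OF w] v in_quotient_imp_subset[OF equiv_sigma_equiv] unfolding L2_sigma_def by blast
    then have vC: "v k m \<in> C0" for k m by (rule sigma_Cauchy_C0)
    \<comment> \<open>Representatives of the images of \<open>w k\<close> and \<open>w j\<close> are
      compared through \<open>u k\<close> and \<open>u j\<close>; their distance tends to the
      distance of the preimages.\<close>
    have dist: "L2_dist (w k) (w j) \<le> 1 / real (Suc k) + 1 / real (Suc j) + sigma_dist (u k) (u j)" for k j
    proof (rule tendsto_upperbound[OF isometric_extension_tendsto[OF F w w v v]])
      show "\<forall>\<^sub>F m in sequentially. sigma_dist (v k m) (v j m) \<le>
         1 / real (Suc k) + 1 / real (Suc j) + sigma_dist (u k) (u j)"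
        using uv[of k] uv[of j]
      proof eventually_elim
        case (elim m)
        have "sigma_dist (v k m) (v j m) \<le> sigma_dist (v k m) (u k) + sigma_dist (u k) (v j m)"
          by (intro sigma_norm_triangle3 uC vC)
        moreover have "sigma_dist (u k) (v j m) \<le> sigma_dist (u k) (u j) + sigma_dist (u j) (v j m)"
          by (intro sigma_norm_triangle3 uC vC)
        ultimately show ?case using elim sigma_norm_minus_commute[OF vC[of k m] uC[of k]] by linarith
      qed
    qed simp
    have small: "\<exists>N. \<forall>k\<ge>N. 1 / real (Suc k) < e \<and> (\<forall>j\<ge>N. sigma_dist (u k) (u j) < e)" if e: "e > 0" for e
    proof -
      obtain N where "\<forall>k\<ge>N. \<forall>m\<ge>N. sigma_dist (u k) (u m) < e"
        using u(2) e unfolding sigma_Cauchy_def by blast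
      moreover have "\<forall>\<^sub>F k in sequentially. 1 / real (Suc k) < e"
        using LIMSEQ_Suc[OF lim_1_over_n] e by (rule order_tendstoD(2)[rotated, rotated])
      then obtain N' where "\<forall>k\<ge>N'. 1 / real (Suc k) < e" by (auto simp: eventually_sequentially)
      ultimately show ?thesis by (intro exI[of _ "max N N'"]) auto
    qed
    obtain g where g: "g \<in> borel_measurable (lebesgue_on {0..})" "integrable (lebesgue_on {0..}) (\<lambda>x. (norm (g x))\<^sup>2)"
      "(\<lambda>k. LINT x|lebesgue_on {0..}. (norm (w k x - g x))\<^sup>2) \<longlonglongrightarrow> 0"
    proof (rule L2_complete[of w "lebesgue_on {0..}"])
      fix e :: real assume "e > 0"
      then have "sqrt e / 3 > 0" by simp
      then obtain N where N: "\<forall>k\<ge>N. 1 / real (Suc k) < sqrt e / 3 \<and> (\<forall>j\<ge>N. sigma_dist (u k) (u j) < sqrt e / 3)"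
        using small by blast
      have "(LINT x|lebesgue_on {0..}. (norm (w k x - w m x))\<^sup>2) < e" if "k \<ge> N" "m \<ge> N" for k m
      proof -
        have "L2_dist (w k) (w m) < sqrt e"
        proof -
          have "1 / real (Suc k) < sqrt e / 3" "1 / real (Suc m) < sqrt e / 3"
            "sigma_dist (u k) (u m) < sqrt e / 3" using N that by blast+
          then show ?thesis using dist[of k m] by linarith
        qed
        then show ?thesis unfolding L2_dist_def by simp
      qed
      then show "\<exists>N. \<forall>k\<ge>N. \<forall>m\<ge>N. (LINT x|lebesgue_on {0..}. (norm (w k x - w m x))\<^sup>2) < e" by blast
    qed (use w in \<open>auto dest: L2_half_line_D\<close>)
    have gL: "g \<in> L2_half_line" using g by (simp add: L2_half_line_def)
    obtain x where x: "x \<in> F g" "x \<in> sigma_Cauchy \<sigma>"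
      using FL[OF gL] in_quotient_imp_non_empty[OF equiv_sigma_equiv] in_quotient_imp_subset[OF equiv_sigma_equiv]
      unfolding L2_sigma_def by blast
    have xC: "x k \<in> C0" for k using x(2) by (rule sigma_Cauchy_C0)
    have wg: "(\<lambda>k. L2_dist (w k) g) \<longlonglongrightarrow> 0"
      unfolding L2_dist_def using tendsto_real_sqrt[OF g(3)] by simp
    \<comment> \<open>One large \<open>k\<close> is frozen. Then \<open>u m\<close> is compared with
      \<open>x m\<close> by way of \<open>u k\<close> and \<open>v k m\<close>, each of the three
      steps costing less than \<open>e / 3\<close>.\<close>
    have "(\<lambda>m. sigma_dist (x m) (u m)) \<longlonglongrightarrow> 0"
    proof (rule tendstoI)
      fix e :: real assume "e > 0"
      then have e3: "e / 3 > 0" by simp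
      obtain N where N: "\<forall>k\<ge>N. 1 / real (Suc k) < e/3 \<and> (\<forall>j\<ge>N. sigma_dist (u k) (u j) < e/3)"
        using small[OF e3] by blast
      have "\<forall>\<^sub>F k in sequentially. L2_dist (w k) g < e/3 \<and> k \<ge> N"
        using order_tendstoD(2)[OF wg e3] eventually_ge_at_top[of N] by eventually_elim auto
      then obtain k where k: "L2_dist (w k) g < e/3" "k \<ge> N"
        using eventually_happens'[OF sequentially_bot] by blast
      have "\<forall>\<^sub>F m in sequentially. sigma_dist (v k m) (x m) < e/3"
        using isometric_extension_tendsto[OF F w gL v x(1)] k(1) by (rule order_tendstoD)
      then show "\<forall>\<^sub>F m in sequentially. dist (sigma_dist (x m) (u m)) 0 < e"
        using uv[of k] eventually_ge_at_top[of N]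
      proof eventually_elim
        case (elim m)
        have "sigma_dist (u m) (x m) \<le> sigma_dist (u m) (u k) + sigma_dist (u k) (x m)"
          by (intro sigma_norm_triangle3 uC xC)
        moreover have "sigma_dist (u k) (x m) \<le> sigma_dist (u k) (v k m) + sigma_dist (v k m) (x m)"
          by (intro sigma_norm_triangle3 uC vC xC)
        moreover have "sigma_dist (u m) (u k) < e/3" "1 / real (Suc k) < e/3" using N elim k(2) by blast+
        ultimately have "sigma_dist (u m) (x m) < e"
          using elim by linarith
        then show ?case
          using sigma_norm_minus_commute[OF uC[of m] xC[of m]] sigma_norm_nonneg[OF C0_diff[OF xC[of m] uC[of m]]]
          by simp
      qed
    qed
    then have "(x, u) \<in> sigma_equiv \<sigma>" using x u by (simp add: sigma_equiv_def)
    then have "F g = \<xi>"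
      using quotient_eqI[OF equiv_sigma_equiv] FL[OF gL] \<xi> x(1) u(1) unfolding L2_sigma_def by blast
    with gL show "\<xi> \<in> F ` L2_half_line" by blast
  qed
qed

end

subsection \<open>Ordinary differential equations\<close>

text \<open>The function \<open>exp (- L * t) * |y|^2 - \<delta>^2 * t\<close> is nonincreasing.
  Squares stay differentiable at zeros of \<open>y\<close>; the \<open>+ 1\<close> in the exponent
  pays for \<open>2 |y| \<delta> \<le> |y|^2 + \<delta>^2\<close>, which separates the defect
  \<open>\<delta>\<close> from the solution.\<close>

lemma gronwall_power2:
  fixes y :: "real \<Rightarrow> 'a::real_inner"
  assumes "R \<ge> 0" "K \<ge> 0"
    and der: "\<And>x. x \<in> {0..R} \<Longrightarrow> (y has_vector_derivative d x) (at x within {0..R})"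
    and bound: "\<And>x. x \<in> {0..R} \<Longrightarrow> norm (d x) \<le> K * norm (y x) + \<delta>"
    and x: "x \<in> {0..R}"
  shows "(norm (y x))\<^sup>2 \<le> exp ((2 * K + 1) * x) * ((norm (y 0))\<^sup>2 + \<delta>\<^sup>2 * x)"
proof -
  define L where "L = 2 * K + 1"
  define \<psi>' where "\<psi>' t = exp (- L * t) * (2 * (y t \<bullet> d t)) + (exp (- L * t) * (- L)) * (y t \<bullet> y t) - \<delta>\<^sup>2" for t
  have "((\<lambda>t. exp (- L * t) * (y t \<bullet> y t) - \<delta>\<^sup>2 * t) has_vector_derivative \<psi>' t) (at t within {0..x})"
    if "t \<in> {0..x}" for t
  proof -
    have "(y has_vector_derivative d t) (at t within {0..x})"
      by (rule has_vector_derivative_within_subset[OF der]) (use that x in auto)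
    then have "((\<lambda>t. y t \<bullet> y t) has_vector_derivative 2 * (y t \<bullet> d t)) (at t within {0..x})"
      using bounded_bilinear.has_vector_derivative[OF bounded_bilinear_inner, of y "d t" t "{0..x}" y "d t"]
      by (simp add: inner_commute)
    then have 1: "((\<lambda>t. y t \<bullet> y t) has_field_derivative 2 * (y t \<bullet> d t)) (at t within {0..x})"
      by (simp add: has_real_derivative_iff_has_vector_derivative)
    show ?thesis
      unfolding has_real_derivative_iff_has_vector_derivative[symmetric] \<psi>'_def
      by (rule derivative_eq_intros 1 refl | simp)+
  qed
  then have int: "(\<psi>' has_integral ((exp (- L * x) * (y x \<bullet> y x) - \<delta>\<^sup>2 * x) - (exp (- L * 0) * (y 0 \<bullet> y 0) - \<delta>\<^sup>2 * 0))) {0..x}"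
    by (intro fundamental_theorem_of_calculus) (use x in auto)
  have neg: "\<psi>' t \<le> 0" if "t \<in> {0..x}" for t
  proof -
    have t: "t \<in> {0..R}" using that x by auto
    have "y t \<bullet> d t \<le> norm (y t) * norm (d t)" by (rule norm_cauchy_schwarz)
    also have "\<dots> \<le> norm (y t) * (K * norm (y t) + \<delta>)"
      using bound[OF t] by (intro mult_left_mono) auto
    finally have "2 * (y t \<bullet> d t) \<le> 2 * K * (norm (y t))\<^sup>2 + 2 * norm (y t) * \<delta>"
      by (simp add: algebra_simps power2_eq_square)
    then have "2 * (y t \<bullet> d t) - L * (y t \<bullet> y t) \<le> \<delta>\<^sup>2"
      using sum_squares_bound[of "norm (y t)" \<delta>] by (simp add: L_def power2_norm_eq_inner algebra_simps)
    then have "exp (- L * t) * (2 * (y t \<bullet> d t) - L * (y t \<bullet> y t)) \<le> exp (- L * t) * \<delta>\<^sup>2"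
      by (intro mult_left_mono) auto
    also have "\<dots> \<le> 1 * \<delta>\<^sup>2"
      using that assms(2) by (intro mult_right_mono) (auto simp: L_def mult_nonpos_nonneg)
    finally show ?thesis by (simp add: \<psi>'_def algebra_simps)
  qed
  have "exp (- L * x) * (y x \<bullet> y x) - \<delta>\<^sup>2 * x - (exp (- L * 0) * (y 0 \<bullet> y 0) - \<delta>\<^sup>2 * 0) \<le> 0"
    by (rule has_integral_le[OF int has_integral_0 neg])
  then have "exp (- L * x) * (norm (y x))\<^sup>2 \<le> (norm (y 0))\<^sup>2 + \<delta>\<^sup>2 * x"
    by (simp add: power2_norm_eq_inner)
  then have "exp (L * x) * (exp (- L * x) * (norm (y x))\<^sup>2) \<le> exp (L * x) * ((norm (y 0))\<^sup>2 + \<delta>\<^sup>2 * x)"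
    by (intro mult_left_mono) auto
  then show ?thesis
    by (simp add: mult.assoc[symmetric] exp_add[symmetric]) (simp add: L_def)
qed

text \<open>In the norm weighted by \<open>exp (- c x)\<close>, \<open>c = 2 K + 1\<close>, the Picard operator is a contraction on all
  of \<open>[0,R]\<close>.\<close>

lemma Lipschitz_ode_exists:
  fixes f :: "real \<Rightarrow> 'a::euclidean_space \<Rightarrow> 'a"
  assumes "R \<ge> 0" "K \<ge> 0"
    and cont: "\<And>v. continuous_on {0..R} v \<Longrightarrow> continuous_on {0..R} (\<lambda>s. f s (v s))"
    and Lip: "\<And>s u v. s \<in> {0..R} \<Longrightarrow> norm (f s u - f s v) \<le> K * norm (u - v)"
  shows "\<exists>u. u 0 = u0 \<and> (\<forall>x\<in>{0..R}. (u has_vector_derivative f x (u x)) (at x within {0..R}))"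
proof -
  define c where "c = 2 * K + 1"
  have c: "c > 0" "K / c \<le> 1/2" using \<open>K \<ge> 0\<close> by (auto simp: c_def field_simps)
  \<comment> \<open>Clamping to \<open>[0,R]\<close> extends a continuous function on the interval
    to a bounded continuous one on the line, so the complete space of such functions can host the
    fixed point.\<close>
  define cl where "cl x = max 0 (min x R)" for x :: real
  have cl: "cl x \<in> {0..R}" "x \<in> {0..R} \<Longrightarrow> cl x = x" for x using \<open>R \<ge> 0\<close> by (auto simp: cl_def)
  \<comment> \<open>The unknown is stored as \<open>exp (- c * x) *\<^sub>R u x\<close>;
    \<open>G\<close> removes the weight before applying \<open>f\<close>.\<close>
  define G where "G v s = f s (exp (c * s) *\<^sub>R apply_bcontfun v s)" for v s
  define P where "P v x = u0 + integral {0..x} (G v)" for v x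
  define T where "T v = Bcontfun (\<lambda>x. exp (- c * cl x) *\<^sub>R P v (cl x))" for v
  have G: "continuous_on {0..R} (G v)" for v
    unfolding G_def by (rule cont) (intro continuous_intros; simp)
  have Gint: "G v integrable_on {0..x}" if "x \<in> {0..R}" for v x
    by (rule integrable_continuous_real, rule continuous_on_subset[OF G]) (use that in auto)
  have P': "(P v has_vector_derivative G v x) (at x within {0..R})" if "x \<in> {0..R}" for v x
    unfolding P_def using integral_has_vector_derivative[OF G that, of v]
    by (auto intro!: derivative_eq_intros)
  have Pc: "continuous_on {0..R} (P v)" for v
    unfolding continuous_on_eq_continuous_within using P' has_vector_derivative_continuous by blast
  have T: "apply_bcontfun (T v) x = exp (- c * cl x) *\<^sub>R P v (cl x)" for v x
  proof -
    have cc: "continuous_on {0..R} (\<lambda>x. exp (- c * x) *\<^sub>R P v x)" by (intro continuous_intros Pc)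
    have "continuous_on UNIV cl" unfolding cl_def by (intro continuous_intros)
    then have 1: "continuous_on UNIV (\<lambda>x. exp (- c * cl x) *\<^sub>R P v (cl x))"
      by (rule continuous_on_compose2[OF cc]) (use cl in blast)
    have "bounded ((\<lambda>x. exp (- c * x) *\<^sub>R P v x) ` {0..R})"
      by (intro compact_imp_bounded compact_continuous_image cc) auto
    then have 2: "bounded (range (\<lambda>x. exp (- c * cl x) *\<^sub>R P v (cl x)))"
      by (rule bounded_subset) (use cl in auto)
    show ?thesis unfolding T_def using 1 2 by (subst Bcontfun_inverse) (auto simp: bcontfun_def)
  qed
  have "\<exists>!v. T v = v"
  proof (rule banach_fix_type[of "1/2"])
    show "\<forall>v w. dist (T v) (T w) \<le> 1/2 * dist v w"
    proof (intro allI dist_bound)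
      fix v w :: "real \<Rightarrow>\<^sub>C 'a" and x :: real
      define X where "X = cl x"
      have X: "X \<in> {0..R}" unfolding X_def by (rule cl(1))
      let ?D = "dist v w"
      have exp_int: "((\<lambda>s. K * ?D * exp (c * s)) has_integral (K * ?D * exp (c * X) / c - K * ?D * exp (c * 0) / c)) {0..X}"
      proof (rule fundamental_theorem_of_calculus)
        fix s :: real
        show "((\<lambda>s. K * ?D * exp (c * s) / c) has_vector_derivative K * ?D * exp (c * s)) (at s within {0..X})"
          unfolding has_real_derivative_iff_has_vector_derivative[symmetric]
          using c by (auto intro!: derivative_eq_intros)
      qed (use X in auto)
      have "norm (integral {0..X} (\<lambda>s. G v s - G w s)) \<le> integral {0..X} (\<lambda>s. K * ?D * exp (c * s))"
      proof (rule integral_norm_bound_integral)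
        show "(\<lambda>s. G v s - G w s) integrable_on {0..X}"
          by (intro integrable_diff Gint X)
        show "(\<lambda>s. K * ?D * exp (c * s)) integrable_on {0..X}"
          using exp_int by blast
        fix s assume "s \<in> {0..X}"
        then have "s \<in> {0..R}" using X by auto
        then have "norm (G v s - G w s) \<le> K * norm (exp (c * s) *\<^sub>R (apply_bcontfun v s - apply_bcontfun w s))"
          using Lip unfolding G_def by (metis scaleR_diff_right)
        also have "\<dots> \<le> K * (exp (c * s) * ?D)"
          using dist_bounded[of v s w] \<open>K \<ge> 0\<close> by (intro mult_left_mono) (auto simp: dist_norm)
        finally show "norm (G v s - G w s) \<le> K * ?D * exp (c * s)"
          by (simp add: mult_ac)
      qed
      also have "\<dots> = K * ?D * exp (c * X) / c - K * ?D / c"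
        unfolding integral_unique[OF exp_int] by simp
      also have "\<dots> \<le> K * ?D * exp (c * X) / c" using c \<open>K \<ge> 0\<close> by simp
      finally have I: "norm (integral {0..X} (\<lambda>s. G v s - G w s)) \<le> (K / c) * ?D * exp (c * X)"
        by (simp add: field_simps)
      have "dist (apply_bcontfun (T v) x) (apply_bcontfun (T w) x) = norm (exp (- c * X) *\<^sub>R (P v X - P w X))"
        by (simp only: T dist_norm X_def scaleR_diff_right)
      also have "P v X - P w X = integral {0..X} (\<lambda>s. G v s - G w s)"
        unfolding P_def using Gint[OF X] by (simp add: Henstock_Kurzweil_Integration.integral_diff)
      also have "norm (exp (- c * X) *\<^sub>R integral {0..X} (\<lambda>s. G v s - G w s)) \<le> exp (- c * X) * ((K / c) * ?D * exp (c * X))"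
        using mult_left_mono[OF I, of "exp (- c * X)"] by simp
      also have "\<dots> = (K / c) * ?D" by (simp add: exp_minus field_simps)
      also have "\<dots> \<le> 1/2 * ?D" using c by (intro mult_right_mono) auto
      finally show "dist (apply_bcontfun (T v) x) (apply_bcontfun (T w) x) \<le> 1/2 * dist v w" .
    qed
  qed auto
  then obtain v where v: "T v = v" by blast
  have Pv: "exp (c * x) *\<^sub>R apply_bcontfun v x = P v x" if "x \<in> {0..R}" for x
  proof -
    have "apply_bcontfun v x = exp (- c * x) *\<^sub>R P v x" using T[of v x] cl(2)[OF that] v by simp
    then show ?thesis by (simp add: exp_minus)
  qed
  have "(P v has_vector_derivative f x (P v x)) (at x within {0..R})" if "x \<in> {0..R}" for x
    using P'[OF that, of v] unfolding G_def Pv[OF that] .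
  moreover have "P v 0 = u0" by (simp add: P_def)
  ultimately show ?thesis by blast
qed

text \<open>Links the Lebesgue integrals on the half line, which define transforms and norms, with
  integrals over \<open>[0,R]\<close>, where the fundamental theorem of calculus is at hand.\<close>

lemma compact_support_integral:
  fixes h :: "real \<Rightarrow> 'a::euclidean_space"
  assumes h: "continuous_on {0..} h" and z: "\<And>x. x > R \<Longrightarrow> h x = 0" and "R \<ge> 0"
  shows "integrable (lebesgue_on {0..}) h"
    and "(LINT x|lebesgue_on {0..}. h x) = integral {0..R} h"
proof -
  have eq: "(if x \<in> {0..} then h x else 0) = (if x \<in> {0..R} then h x else 0)" for x
    using z by auto
  have "integrable (lebesgue_on {0..R}) h"
    by (rule continuous_imp_integrable_real, rule continuous_on_subset[OF h]) auto
  then have "integrable lebesgue (\<lambda>x. if x \<in> {0..} then h x else 0)"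
    unfolding eq by (subst Lebesgue_Measure.integrable_restrict_UNIV) auto
  then show i: "integrable (lebesgue_on {0..}) h"
    by (subst (asm) Lebesgue_Measure.integrable_restrict_UNIV) auto
  then have "(LINT x|lebesgue_on {0..}. h x) = integral {0..} h"
    by (rule lebesgue_integral_eq_integral) simp
  also have "\<dots> = integral {0..R} h"
  proof -
    have "integral UNIV (\<lambda>x. if x \<in> {0..} then h x else 0) = integral UNIV (\<lambda>x. if x \<in> {0..R} then h x else 0)"
      by (simp only: eq)
    then show ?thesis by (simp only: Henstock_Kurzweil_Integration.integral_restrict_UNIV)
  qed
  finally show "(LINT x|lebesgue_on {0..}. h x) = integral {0..R} h" .
qed

subsection \<open>The first order system\<close>

lemma scaleR_conv_smult: "r *\<^sub>R (v :: complex ^ 'm) = complex_of_real r *s v"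
  by (simp add: vec_eq_iff scaleR_conv_of_real[where 'a = complex])

lemma norm_smult: "norm (c *s (v :: complex ^ 'm::finite)) = norm c * norm v"
  by (simp add: norm_vec_def norm_mult L2_set_right_distrib)

lemma mat_mult_vector: "mat c *v (v :: complex ^ 'm::finite) = c *s v"
  by (simp add: mat_def matrix_vector_mult_def vec_eq_iff if_distrib if_distribR cong: if_cong)

lemma bounded_bilinear_cinner: "bounded_bilinear (cinner :: complex ^ 'm::finite \<Rightarrow> complex ^ 'm \<Rightarrow> complex)"
proof -
  have "bilinear (cinner :: complex ^ 'm \<Rightarrow> complex ^ 'm \<Rightarrow> complex)"
    unfolding bilinear_def
    by (auto intro!: linearI simp: cinner_add_left cinner_add_right scaleR_conv_smult
        cinner_smult_left cinner_smult_right scaleR_conv_of_real)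
  then show ?thesis by (simp add: bilinear_conv_bounded_bilinear)
qed

lemma cinner_diff_left: "cinner (u - v) w = cinner u w - cinner v w"
  by (simp add: cinner_def algebra_simps sum_subtractf)

lemma cinner_diff_right: "cinner u (v - w) = cinner u v - cinner u w"
  by (simp add: cinner_def algebra_simps sum_subtractf)

lemma cinner_axis: "cinner (axis i 1) v = v $ i"
  by (simp add: cinner_def axis_def if_distrib if_distribR cong: if_cong)

lemma cinner_eqI: "(\<And>c. cinner c u = cinner c v) \<Longrightarrow> u = v"
  by (metis cinner_axis vec_eq_iff)

text \<open>The imaginary part is a real inner product with a rotated vector, so Cauchy-Schwarz
  applies with constant 1. With this constant the energy identity bounds the solution by the
  right-hand side itself.\<close>

lemma abs_Im_cinner_le: "\<bar>Im (cinner u v)\<bar> \<le> norm u * norm v"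
proof -
  have "Im (cinner u v) = - (u \<bullet> (\<i> *s v))"
    by (simp add: Re_cinner[symmetric] cinner_smult_right)
  then show ?thesis
    using Cauchy_Schwarz_ineq2[of u "\<i> *s v"] by (simp add: norm_smult)
qed

lemmas continuous_on_cinner [continuous_intros] = bounded_bilinear.continuous_on[OF bounded_bilinear_cinner]
lemmas continuous_on_matrix_vector_mult_complex [continuous_intros] =
  bounded_bilinear.continuous_on[OF bounded_bilinear_matrix_vector_mult_complex]

lemma continuous_on_smult_const [continuous_intros]:
  fixes f :: "_ \<Rightarrow> complex ^ 'm"
  shows "continuous_on S f \<Longrightarrow> continuous_on S (\<lambda>x. c *s f x)"
  unfolding vector_scalar_mult_def by (intro continuous_intros)

lemma continuous_on_cut:
  fixes h :: "real \<Rightarrow> 'a::real_normed_vector"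
  assumes "continuous_on {0..R} h" "h R = 0" "R \<ge> 0"
  shows "continuous_on {0..} (\<lambda>x. if x \<le> R then h x else 0)"
proof -
  have "continuous_on ({0..R} \<union> {R..}) (\<lambda>x. if x \<le> R then h x else 0)"
    by (rule continuous_on_cases) (use assms in auto)
  moreover have "{0..R} \<union> {R..} = {0..}" using assms by auto
  ultimately show ?thesis by simp
qed

text \<open>Transforms of these are integrals of continuous functions over bounded intervals. The
  value at 0 is free, so bumps may concentrate there.\<close>

definition test_functions :: "(real \<Rightarrow> complex ^ 'm::finite) set" where
  "test_functions = {w. continuous_on {0..} w \<and> (\<exists>R\<ge>0. \<forall>x\<ge>R. w x = 0)}"

lemma test_functions_add:
  assumes "v \<in> test_functions" "w \<in> test_functions"
  shows "(\<lambda>x. v x + w x) \<in> test_functions"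
proof -
  obtain R R' where R: "R \<ge> 0" "\<forall>x\<ge>R. v x = 0" "R' \<ge> 0" "\<forall>x\<ge>R'. w x = 0"
    using assms by (auto simp: test_functions_def)
  then have "\<forall>x\<ge>max R R'. v x + w x = 0" by auto
  then have "\<exists>R\<ge>0. \<forall>x\<ge>R. v x + w x = 0" using R(1) by (intro exI[of _ "max R R'"]) auto
  with assms show ?thesis by (auto simp: test_functions_def intro!: continuous_intros)
qed

lemma test_functions_smult:
  assumes "w \<in> test_functions"
  shows "(\<lambda>x. c *s w x) \<in> test_functions"
proof -
  obtain R where "R \<ge> 0" "\<forall>x\<ge>R. w x = 0" using assms by (auto simp: test_functions_def)
  then have "\<exists>R\<ge>0. \<forall>x\<ge>R. c *s w x = 0" by (intro exI[of _ R]) auto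
  with assms show ?thesis by (auto simp: test_functions_def intro!: continuous_intros)
qed

lemma test_functions_L2:
  assumes "w \<in> test_functions"
  shows "w \<in> L2_half_line_compact"
proof -
  obtain R where R: "R \<ge> 0" "\<forall>x\<ge>R. w x = 0" and w: "continuous_on {0..} w"
    using assms by (auto simp: test_functions_def)
  have "integrable (lebesgue_on {0..}) w"
    by (rule compact_support_integral(1)[OF w _ R(1)]) (use R in auto)
  moreover have "integrable (lebesgue_on {0..}) (\<lambda>x. (norm (w x))\<^sup>2)"
    by (rule compact_support_integral(1)[OF _ _ R(1)]) (use R in \<open>auto intro!: continuous_intros w\<close>)
  moreover have "\<exists>R. AE x in lebesgue_on {0..}. x > R \<longrightarrow> w x = 0"
    using R by (intro exI[of _ R] AE_I2) auto
  ultimately show ?thesis by (simp add: L2_half_line_compact_def L2_half_line_def)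
qed

text \<open>\<open>P s u = 0\<close> is the condition at the right endpoint for the spectral parameter \<open>s \<i>\<close>, \<open>s = \<plusminus>1\<close>; its sign
  makes the boundary term of the energy identity favourable.\<close>

locale boundary_system =
  fixes B :: "complex ^ 'm::finite ^ 'm" and Q :: "real \<Rightarrow> complex ^ 'm ^ 'm"
    and Y :: "real \<Rightarrow> complex \<Rightarrow> complex ^ 'n::finite ^ 'm" and Y0 :: "complex ^ 'n ^ 'm"
    and P :: "real \<Rightarrow> complex ^ 'm \<Rightarrow> complex ^ 'n"
  assumes B_self_adjoint: "self_adjoint B"
    and B_inj: "\<And>v. B *v v = 0 \<Longrightarrow> v = 0"
    and Q_continuous: "continuous_on {0..} Q"
    and Q_self_adjoint: "\<And>x. x \<ge> 0 \<Longrightarrow> self_adjoint (Q x)"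
    and Y_solves: "\<And>lam. solves_system B Q lam (\<lambda>x. Y x lam)"
    and Y_0: "\<And>lam. Y 0 lam = Y0"
    and isotropic: "\<And>c d. cinner (Y0 *v c) (B *v (Y0 *v d)) = 0"
    and P_linear: "\<And>s. linear (P s)"
    and P_sign: "\<And>s v. s \<in> {1, -1} \<Longrightarrow> P s v = 0 \<Longrightarrow> 0 \<le> s * (v \<bullet> (B *v v))"
    and Y0_adjoint_surj: "\<And>i. \<exists>v. cadjoint Y0 *v v = axis i 1"
begin

definition Bi :: "complex ^ 'm ^ 'm" where
  "Bi = (SOME C. C ** B = mat 1 \<and> B ** C = mat 1)"

lemma Bi: "Bi *v (B *v v) = v" "B *v (Bi *v v) = v"
proof -
  have "inj ((*v) B)"
  proof (rule injI)
    fix u v assume "B *v u = B *v v"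
    then have "B *v (u - v) = 0" by (simp add: matrix_vector_mult_diff_distrib)
    then show "u = v" using B_inj by force
  qed
  then have "\<exists>C. C ** B = mat 1 \<and> B ** C = mat 1"
    using matrix_left_invertible_injective matrix_left_right_inverse by blast
  then have *: "Bi ** B = mat 1 \<and> B ** Bi = mat 1" unfolding Bi_def by (rule someI_ex)
  then show "Bi *v (B *v v) = v" "B *v (Bi *v v) = v"
    by (simp_all add: matrix_vector_mul_assoc)
qed

text \<open>The equation \<open>(L - z) u = g\<close> solved for the derivative:
  \<open>B (1/\<i>) u' + Q u = z u + g\<close> reads \<open>B u' = \<i> (g + z u - Q u)\<close>.
  Accordingly \<open>sol z g R u\<close> below means \<open>(L - z) u = g\<close> on
  \<open>[0,R]\<close>.\<close>

definition rhs :: "complex \<Rightarrow> complex ^ 'm \<Rightarrow> real \<Rightarrow> complex ^ 'm \<Rightarrow> complex ^ 'm" where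
  "rhs z g x u = Bi *v (\<i> *s (g + z *s u - Q x *v u))"

lemma B_rhs: "B *v rhs z g x u = \<i> *s (g + z *s u - Q x *v u)"
  by (simp add: rhs_def Bi)

lemma rhs_unique: "B *v d = \<i> *s (g + z *s u - Q x *v u) \<Longrightarrow> d = rhs z g x u"
  unfolding rhs_def by (metis Bi(1))

definition sol :: "complex \<Rightarrow> (real \<Rightarrow> complex ^ 'm) \<Rightarrow> real \<Rightarrow> (real \<Rightarrow> complex ^ 'm) \<Rightarrow> bool" where
  "sol z g R u \<longleftrightarrow> (\<forall>x\<in>{0..R}. (u has_vector_derivative rhs z (g x) x (u x)) (at x within {0..R}))"

lemma sol_continuous: "sol z g R u \<Longrightarrow> continuous_on {0..R} u"
  unfolding sol_def continuous_on_eq_continuous_within using has_vector_derivative_continuous by blast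

lemma Q_continuous': "continuous_on {0..R} Q"
  by (rule continuous_on_subset[OF Q_continuous]) auto

lemma continuous_on_rhs:
  assumes "S \<subseteq> {0..}" "continuous_on S g" "continuous_on S u"
  shows "continuous_on S (\<lambda>x. rhs z (g x) x (u x))"
  unfolding rhs_def by (intro continuous_intros assms continuous_on_subset[OF Q_continuous])

lemma Y_column:
  assumes "x \<ge> 0"
  shows "((\<lambda>x. Y x z *v c) has_vector_derivative rhs z 0 x (Y x z *v c)) (at x within {0..})"
proof -
  obtain D where D: "((\<lambda>x. Y x z) has_vector_derivative D) (at x within {0..})"
    and eq: "B ** (mat (1 / \<i>) ** D) + Q x ** Y x z = mat z ** Y x z"
    using Y_solves[of z] assms unfolding solves_system_def by blast
  have "((\<lambda>x. Y x z *v c) has_vector_derivative D *v c) (at x within {0..})"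
    by (rule bounded_linear.has_vector_derivative[OF bounded_linear_matrix_vector_left D])
  moreover have "D *v c = rhs z 0 x (Y x z *v c)"
  proof (rule rhs_unique)
    have "(B ** (mat k ** D) + Q x ** Y x z) *v c = k *s (B *v (D *v c)) + Q x *v (Y x z *v c)" for k
      by (simp add: matrix_vector_mult_add_rdistrib matrix_vector_mul_assoc[symmetric] mat_mult_vector
          vector_scalar_commute)
    from this[of "1 / \<i>"] have *: "(1 / \<i>) *s (B *v (D *v c)) + Q x *v (Y x z *v c) = z *s (Y x z *v c)"
      unfolding eq by (simp add: matrix_vector_mul_assoc[symmetric] mat_mult_vector)
    have "B *v (D *v c) = \<i> *s ((1 / \<i>) *s (B *v (D *v c)) + Q x *v (Y x z *v c) - Q x *v (Y x z *v c))"
      by (simp add: vector_smult_assoc)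
    also have "\<dots> = \<i> *s (0 + z *s (Y x z *v c) - Q x *v (Y x z *v c))"
      by (simp only: * add_0)
    finally show "B *v (D *v c) = \<i> *s (0 + z *s (Y x z *v c) - Q x *v (Y x z *v c))" .
  qed
  ultimately show ?thesis by simp
qed

lemma Y_column_sol: "sol z (\<lambda>_. 0) R (\<lambda>x. Y x z *v c)"
  unfolding sol_def by (auto intro: has_vector_derivative_within_subset[OF Y_column])

lemma continuous_on_Y: "continuous_on {0..} (\<lambda>x. Y x z)"
  using Y_solves[of z] has_vector_derivative_continuous
  unfolding continuous_on_eq_continuous_within solves_system_def by fastforce

text \<open>In the derivative of \<open>cinner y (B u)\<close> the terms with \<open>Q\<close>
  cancel by self-adjointness, leaving the inhomogeneities and the parameter difference. With
  \<open>y = u\<close> this is the energy identity; with \<open>y\<close> a combination of columns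
  of \<open>Y\<close> at a real parameter it computes transforms.\<close>

lemma Lagrange:
  assumes y: "sol z1 g1 R y" and u: "sol z2 g2 R u" and R: "R \<ge> 0"
  shows "((\<lambda>x. \<i> * (cinner (y x) (g2 x) - cinner (g1 x) (u x) + (z2 - cnj z1) * cinner (y x) (u x)))
    has_integral (cinner (y R) (B *v u R) - cinner (y 0) (B *v u 0))) {0..R}"
proof (rule fundamental_theorem_of_calculus[OF R])
  fix x assume x: "x \<in> {0..R}"
  let ?y' = "rhs z1 (g1 x) x (y x)" and ?u' = "rhs z2 (g2 x) x (u x)"
  have y': "(y has_vector_derivative ?y') (at x within {0..R})" using y x by (simp add: sol_def)
  have "(u has_vector_derivative ?u') (at x within {0..R})" using u x by (simp add: sol_def)
  then have Bu': "((\<lambda>x. B *v u x) has_vector_derivative B *v ?u') (at x within {0..R})"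
    by (rule bounded_linear.has_vector_derivative[OF
        bounded_bilinear.bounded_linear_right[OF bounded_bilinear_matrix_vector_mult_complex]])
  have "((\<lambda>x. cinner (y x) (B *v u x)) has_vector_derivative
     cinner (y x) (B *v ?u') + cinner ?y' (B *v u x)) (at x within {0..R})"
    by (rule bounded_bilinear.has_vector_derivative[OF bounded_bilinear_cinner y' Bu'])
  moreover have "cinner ?y' (B *v u x) = cinner (B *v ?y') (u x)"
    by (simp add: self_adjoint_cinner[OF B_self_adjoint])
  moreover have "cinner (Q x *v y x) (u x) = cinner (y x) (Q x *v u x)"
    using Q_self_adjoint[of x] x by (simp add: self_adjoint_cinner)
  ultimately show "((\<lambda>x. cinner (y x) (B *v u x)) has_vector_derivative
     \<i> * (cinner (y x) (g2 x) - cinner (g1 x) (u x) + (z2 - cnj z1) * cinner (y x) (u x))) (at x within {0..R})"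
    by (simp add: B_rhs cinner_smult_left cinner_smult_right cinner_add_left cinner_add_right
        cinner_diff_left cinner_diff_right algebra_simps)
qed
text \<open>For \<open>z = s \<i>\<close> the factor \<open>z - cnj z = 2 s \<i>\<close> produces
  \<open>- 2 |u|^2\<close>. The boundary term at 0 is zero because the range of \<open>Y0\<close> is
  isotropic for \<open>B\<close>, and the condition at \<open>R\<close> makes the other one
  nonnegative.\<close>

lemma energy_bound:
  assumes s: "s \<in> {1, -1}" and R: "R \<ge> 0" and u: "sol (of_real s * \<i>) g R u"
    and g: "continuous_on {0..R} g" and u0: "u 0 = Y0 *v c" and uR: "P s (u R) = 0"
  shows "integral {0..R} (\<lambda>x. (norm (u x))\<^sup>2) \<le> integral {0..R} (\<lambda>x. (norm (g x))\<^sup>2)"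
proof -
  note uc = sol_continuous[OF u]
  let ?f = "\<lambda>x. - 2 * s * Im (cinner (u x) (g x)) - 2 * (norm (u x))\<^sup>2"
  have eq: "s * Re (\<i> * (cinner (u x) (g x) - cinner (g x) (u x) +
       (of_real s * \<i> - cnj (of_real s * \<i>)) * cinner (u x) (u x))) = ?f x" for x
  proof -
    have "Im (cinner (g x) (u x)) = - Im (cinner (u x) (g x))"
      using arg_cong[OF cnj_cinner[of "u x" "g x"], of Im] by simp
    then show ?thesis using s by (auto simp: cinner_self)
  qed
  have "((\<lambda>x. s * Re (\<i> * (cinner (u x) (g x) - cinner (g x) (u x) +
       (of_real s * \<i> - cnj (of_real s * \<i>)) * cinner (u x) (u x))))
    has_integral (s * Re (cinner (u R) (B *v u R) - cinner (u 0) (B *v u 0)))) {0..R}"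
    by (intro has_integral_mult_right has_integral_Re Lagrange u R)
  then have "(?f has_integral s * (u R \<bullet> (B *v u R))) {0..R}"
    unfolding eq u0 isotropic by (simp add: Re_cinner)
  moreover have "0 \<le> s * (u R \<bullet> (B *v u R))" by (rule P_sign[OF s uR])
  ultimately have nn: "0 \<le> integral {0..R} ?f" by (simp add: integral_unique)
  \<comment> \<open>The cross term is at most \<open>|u|^2 + |g|^2\<close>, so half of
    \<open>2 |u|^2\<close> absorbs it.\<close>
  have "?f x \<le> (norm (g x))\<^sup>2 - (norm (u x))\<^sup>2" for x
  proof -
    have "- 2 * s * Im (cinner (u x) (g x)) \<le> 2 * (norm (u x) * norm (g x))"
    proof -
      have "- 2 * s * Im (cinner (u x) (g x)) \<le> 2 * \<bar>Im (cinner (u x) (g x))\<bar>"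
        using s abs_ge_self[of "Im (cinner (u x) (g x))"] abs_ge_minus_self[of "Im (cinner (u x) (g x))"]
        by (elim insertE emptyE) simp_all
      then show ?thesis using abs_Im_cinner_le[of "u x" "g x"] by linarith
    qed
    then show ?thesis using sum_squares_bound[of "norm (u x)" "norm (g x)"] by linarith
  qed
  then have "integral {0..R} ?f \<le> integral {0..R} (\<lambda>x. (norm (g x))\<^sup>2 - (norm (u x))\<^sup>2)"
    by (intro integral_le integrable_continuous_real continuous_intros uc g)
  also have "\<dots> = integral {0..R} (\<lambda>x. (norm (g x))\<^sup>2) - integral {0..R} (\<lambda>x. (norm (u x))\<^sup>2)"
    by (intro Henstock_Kurzweil_Integration.integral_diff integrable_continuous_real continuous_intros uc g)
  finally show ?thesis using nn by simp
qed

text \<open>A vector in the kernel is orthogonal to the range of the adjoint, which contains every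
  basis vector.\<close>

lemma Y0_inj: "Y0 *v c = 0 \<Longrightarrow> c = 0"
proof (rule cinner_eqI[of _ 0, THEN sym, THEN sym])
  fix d assume "Y0 *v c = 0"
  have "c $ i = 0" for i
  proof -
    obtain v where v: "cadjoint Y0 *v v = axis i 1" using Y0_adjoint_surj by blast
    have "c $ i = cinner (cadjoint Y0 *v v) c" by (simp add: v cinner_axis)
    also have "\<dots> = 0" unfolding cinner_cadjoint \<open>Y0 *v c = 0\<close> by (simp add: cinner_def)
    finally show ?thesis .
  qed
  then have "c = 0" by (simp add: vec_eq_iff)
  then show "cinner d c = cinner d 0" by simp
qed

text \<open>The energy bound without inhomogeneity forces the solution to vanish on
  \<open>[0,R]\<close>: the nonreal number \<open>s \<i>\<close> is no eigenvalue of the problem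
  with these two boundary conditions.\<close>

lemma boundary_injective:
  assumes s: "s \<in> {1, -1}" and R: "R > 0" and z: "P s (Y R (of_real s * \<i>) *v c) = 0"
  shows "c = 0"
proof -
  let ?u = "\<lambda>x. Y x (of_real s * \<i>) *v c"
  have u: "sol (of_real s * \<i>) (\<lambda>_. 0) R ?u" by (rule Y_column_sol)
  have "integral {0..R} (\<lambda>x. (norm (?u x))\<^sup>2) \<le> integral {0..R} (\<lambda>x. (norm (0 :: complex ^ 'm))\<^sup>2)"
    by (rule energy_bound[OF s _ u _ _ z]) (use R in \<open>auto simp: Y_0\<close>)
  moreover have "0 \<le> integral {0..R} (\<lambda>x. (norm (?u x))\<^sup>2)"
    by (rule integral_nonneg) (auto intro!: integrable_continuous_real continuous_intros sol_continuous[OF u])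
  ultimately have "integral {0..R} (\<lambda>x. (norm (?u x))\<^sup>2) = 0" by simp
  then have "\<forall>x\<in>{0..R}. (norm (?u x))\<^sup>2 = 0"
    by (subst (asm) integral_eq_0_iff) (use R in \<open>auto intro!: continuous_intros sol_continuous[OF u]\<close>)
  then have "Y0 *v c = 0" using R Y_0 by force
  then show ?thesis by (rule Y0_inj)
qed

lemma rhs_add: "rhs z (g + h) x (u + v) = rhs z g x u + rhs z h x v"
  by (rule sym, rule rhs_unique) (simp add: matrix_vector_right_distrib B_rhs vec_eq_iff algebra_simps)

lemma rhs_diff: "rhs z g x u - rhs z g x v = rhs z 0 x (u - v)"
  using rhs_add[of z g 0 x v "u - v"] by simp

text \<open>The difference of two solutions with parameters \<open>z\<close> and \<open>z'\<close>
  solves the equation for \<open>z\<close> up to a defect proportional to \<open>z - z'\<close>,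
  which is then fed into the Gronwall estimate.\<close>

lemma rhs_diff_parameter: "rhs z 0 x u - rhs z' 0 x v = rhs z 0 x (u - v) + (z - z') *s (Bi *v (\<i> *s v))"
proof -
  have "\<i> *s (0 + z *s v - Q x *v v) = \<i> *s (0 + z' *s v - Q x *v v) + (z - z') *s (\<i> *s v)"
    by (simp add: vec_eq_iff algebra_simps)
  then have "rhs z 0 x v = rhs z' 0 x v + (z - z') *s (Bi *v (\<i> *s v))"
    unfolding rhs_def by (simp only: matrix_vector_right_distrib vector_scalar_commute)
  moreover have "rhs z 0 x u = rhs z 0 x (u - v) + rhs z 0 x v"
    using rhs_diff[of z 0 x u v] diff_eq_eq by blast
  ultimately show ?thesis by simp
qed

section \<open>Solvability of the boundary value problem and bounds locally uniform in the
  parameter\<close>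

lemma matrix_norm_bound:
  obtains k where "k > 0" "\<And>(A :: complex ^ 'm ^ 'm) v. norm (A *v v) \<le> norm A * norm v * k"
  using bounded_bilinear.pos_bounded[OF bounded_bilinear_matrix_vector_mult_complex[where 'n='m and 'm='m]] by blast

lemma rhs_bound: "\<exists>K\<ge>0. \<forall>x\<in>{0..R}. \<forall>z. norm z \<le> M \<longrightarrow> (\<forall>v. norm (rhs z 0 x v) \<le> K * norm v)"
proof -
  obtain k where k: "k > 0" "\<And>(A :: complex ^ 'm ^ 'm) v. norm (A *v v) \<le> norm A * norm v * k"
    using matrix_norm_bound by blast
  have "bounded (Q ` {0..R})"
    by (intro compact_imp_bounded compact_continuous_image Q_continuous') auto
  then obtain q where "\<forall>x\<in>{0..R}. norm (Q x) \<le> q" by (auto simp: bounded_iff)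
  then have q: "norm (Q x) \<le> q" if "x \<in> {0..R}" for x using that by blast
  define K where "K = norm Bi * (\<bar>M\<bar> + \<bar>q\<bar> * k) * k"
  have "norm (rhs z 0 x v) \<le> K * norm v" if x: "x \<in> {0..R}" and z: "norm z \<le> M" for x z v
  proof -
    have "norm (z *s v - Q x *v v) \<le> norm z * norm v + norm (Q x) * norm v * k"
      using norm_triangle_ineq4[of "z *s v" "Q x *v v"] k(2)[of "Q x" v] by (simp add: norm_smult)
    also have "\<dots> \<le> \<bar>M\<bar> * norm v + \<bar>q\<bar> * norm v * k"
      using z q[OF x] k(1) by (intro add_mono mult_right_mono) auto
    finally have "norm (\<i> *s (0 + z *s v - Q x *v v)) \<le> (\<bar>M\<bar> + \<bar>q\<bar> * k) * norm v"
      unfolding norm_smult by (simp add: algebra_simps)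
    then have "norm Bi * norm (\<i> *s (0 + z *s v - Q x *v v)) * k \<le> norm Bi * ((\<bar>M\<bar> + \<bar>q\<bar> * k) * norm v) * k"
      using k(1) by (intro mult_right_mono mult_left_mono) auto
    then show ?thesis
      using k(2)[of Bi "\<i> *s (0 + z *s v - Q x *v v)"] unfolding rhs_def K_def by (simp add: mult_ac)
  qed
  moreover have "K \<ge> 0" using k(1) by (simp add: K_def)
  ultimately show ?thesis by blast
qed

lemma inhomogeneous_sol_exists:
  assumes "R \<ge> 0" and g: "continuous_on {0..R} g"
  shows "\<exists>u. u 0 = 0 \<and> sol z g R u"
proof -
  obtain K where K: "K \<ge> 0" "\<And>x v. x \<in> {0..R} \<Longrightarrow> norm (rhs z 0 x v) \<le> K * norm v"
    using rhs_bound[of R "norm z"] by blast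
  show ?thesis
    unfolding sol_def
    by (rule Lipschitz_ode_exists[OF assms(1) K(1)])
       (auto simp: rhs_diff intro!: continuous_on_rhs g K(2))
qed

text \<open>Shooting: a particular solution starting at 0 is corrected by a homogeneous one. The map
  from \<open>c\<close> to the boundary condition at \<open>R\<close> is a linear endomorphism of a
  finite-dimensional space, injective by the energy bound and hence onto.\<close>

lemma boundary_problem_solvable:
  assumes s: "s \<in> {1, -1}" and R: "R > 0" and g: "continuous_on {0..R} g"
  shows "\<exists>u c. sol (of_real s * \<i>) g R u \<and> u 0 = Y0 *v c \<and> P s (u R) = 0"
proof -
  let ?z = "of_real s * \<i>"
  obtain p where p: "p 0 = 0" "sol ?z g R p" using inhomogeneous_sol_exists[OF _ g] R by fastforce
  let ?T = "\<lambda>c. P s (Y R ?z *v c)"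
  have lin: "linear ?T"
  proof -
    have "linear (\<lambda>c. Y R ?z *v c)"
      by (auto intro!: linearI simp: matrix_vector_right_distrib scaleR_conv_smult vector_scalar_commute)
    from linear_compose[OF this P_linear[of s]] show ?thesis by (simp add: o_def)
  qed
  have "inj ?T"
    using boundary_injective[OF s R] by (simp add: linear_injective_0[OF lin])
  then have "surj ?T" using linear_injective_imp_surjective[OF lin] by blast
  then obtain c where c: "?T c = - P s (p R)" by (metis surjD)
  let ?u = "\<lambda>x. Y x ?z *v c + p x"
  have "sol ?z g R ?u"
    unfolding sol_def
  proof
    fix x assume x: "x \<in> {0..R}"
    have "((\<lambda>x. Y x ?z *v c + p x) has_vector_derivative rhs ?z 0 x (Y x ?z *v c) + rhs ?z (g x) x (p x)) (at x within {0..R})"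
      using Y_column_sol[of ?z R c] p(2) x unfolding sol_def by (intro has_vector_derivative_add) auto
    then show "((\<lambda>x. Y x ?z *v c + p x) has_vector_derivative rhs ?z (g x) x (Y x ?z *v c + p x)) (at x within {0..R})"
      using rhs_add[of ?z 0 "g x" x "Y x ?z *v c" "p x"] by simp
  qed
  moreover have "?u 0 = Y0 *v c" by (simp add: p Y_0)
  moreover have "P s (?u R) = 0" using c linear_add[OF P_linear] by simp
  ultimately show ?thesis by blast
qed

text \<open>Two Gronwall estimates: the first makes transforms continuous in the spectral variable,
  the second keeps \<open>Y\<close> near its initial value for small \<open>x\<close>, locally
  uniformly in \<open>l\<close>. The rate \<open>sqrt x\<close> stems from the term
  \<open>\<delta>^2 * x\<close> in the squared estimate.\<close>

lemma Y_bounds: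
  assumes "R \<ge> 0"
  shows "\<exists>C\<ge>0. \<forall>x\<in>{0..R}. \<forall>l m :: real. \<bar>l\<bar> \<le> M \<longrightarrow> \<bar>m\<bar> \<le> M \<longrightarrow>
    norm (Y x (of_real l) *v c - Y x (of_real m) *v c) \<le> C * \<bar>l - m\<bar> \<and>
    norm (Y x (of_real l) *v c - Y0 *v c) \<le> C * sqrt x"
proof -
  obtain K where K: "K \<ge> 0" "\<And>x z v. x \<in> {0..R} \<Longrightarrow> norm z \<le> M \<Longrightarrow> norm (rhs z 0 x v) \<le> K * norm v"
    using rhs_bound[of R M] by blast
  obtain k where k: "k > 0" "\<And>(A :: complex ^ 'm ^ 'm) v. norm (A *v v) \<le> norm A * norm v * k"
    using matrix_norm_bound by blast
  define E where "E = exp ((2 * K + 1) * R)"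
  have E: "exp ((2 * K + 1) * x) \<le> E" if "x \<in> {0..R}" for x
    using that K by (simp add: E_def mult_left_mono)
  have "E \<ge> 0" by (simp add: E_def)
  define N where "N = sqrt E * norm (Y0 *v c)"
  define b where "b = norm Bi * N * k"
  have b: "b \<ge> 0" "N \<ge> 0" using k \<open>E \<ge> 0\<close> by (auto simp: b_def N_def)
  let ?y = "\<lambda>l x. Y x (of_real l) *v c"
  have der: "(?y l has_vector_derivative rhs l 0 x (?y l x)) (at x within {0..R})" if "x \<in> {0..R}" for l x
    using Y_column_sol[of "complex_of_real l" R c] that by (auto simp: sol_def)
  have 1: "norm (?y l x) \<le> N" if x: "x \<in> {0..R}" and l: "\<bar>l\<bar> \<le> M" for l x
  proof -
    have "(norm (?y l x))\<^sup>2 \<le> exp ((2 * K + 1) * x) * ((norm (?y l 0))\<^sup>2 + 0\<^sup>2 * x)"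
      by (rule gronwall_power2[OF assms K(1) der _ x]) (use K(2) l in auto)
    also have "\<dots> \<le> E * (norm (Y0 *v c))\<^sup>2" using E[OF x] by (simp add: Y_0 mult_right_mono)
    also have "\<dots> = N\<^sup>2" using \<open>E \<ge> 0\<close> by (simp add: N_def power_mult_distrib)
    finally show ?thesis by (rule power2_le_imp_le) (rule b)
  qed
  have 2: "norm (?y l x - ?y m x) \<le> (sqrt (E * R) * b) * \<bar>l - m\<bar>"
    if x: "x \<in> {0..R}" and l: "\<bar>l\<bar> \<le> M" and m: "\<bar>m\<bar> \<le> M" for l m x
  proof -
    have bd: "norm (rhs l 0 t (?y l t) - rhs m 0 t (?y m t)) \<le> K * norm (?y l t - ?y m t) + b * \<bar>l - m\<bar>"
      if t: "t \<in> {0..R}" for t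
    proof -
      have "norm (rhs l 0 t (?y l t - ?y m t)) \<le> K * norm (?y l t - ?y m t)"
        by (rule K(2)) (use t l in auto)
      moreover have "norm (Bi *v (\<i> *s ?y m t)) \<le> b"
      proof -
        have "norm (Bi *v (\<i> *s ?y m t)) \<le> norm Bi * norm (?y m t) * k"
          using k(2)[of Bi "\<i> *s ?y m t"] by (simp add: norm_smult)
        also have "\<dots> \<le> b" unfolding b_def using 1[OF t m] k by (intro mult_right_mono mult_left_mono) auto
        finally show ?thesis .
      qed
      then have "norm ((complex_of_real l - complex_of_real m) *s (Bi *v (\<i> *s ?y m t))) \<le> \<bar>l - m\<bar> * b"
        by (simp add: norm_smult mult_left_mono norm_of_real flip: of_real_diff)
      ultimately show ?thesis
        unfolding rhs_diff_parameter using norm_triangle_le by (smt (verit) mult.commute)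
    qed
    have "(norm (?y l x - ?y m x))\<^sup>2 \<le> exp ((2 * K + 1) * x) * ((norm (?y l 0 - ?y m 0))\<^sup>2 + (b * \<bar>l - m\<bar>)\<^sup>2 * x)"
      by (rule gronwall_power2[where y = "\<lambda>x. ?y l x - ?y m x", OF assms K(1) has_vector_derivative_diff[OF der der] bd x])
    also have "\<dots> \<le> E * ((b * \<bar>l - m\<bar>)\<^sup>2 * R)"
      using E[OF x] x \<open>E \<ge> 0\<close> by (auto simp: Y_0 intro!: mult_mono)
    also have "\<dots> = ((sqrt (E * R) * b) * \<bar>l - m\<bar>)\<^sup>2"
      using \<open>E \<ge> 0\<close> assms by (simp add: power_mult_distrib)
    finally show ?thesis
      by (rule power2_le_imp_le) (use b \<open>E \<ge> 0\<close> assms in auto)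
  qed
  have 3: "norm (?y l x - Y0 *v c) \<le> (sqrt E * (K * norm (Y0 *v c))) * sqrt x"
    if x: "x \<in> {0..R}" and l: "\<bar>l\<bar> \<le> M" for l x
  proof -
    \<comment> \<open>The constant function \<open>Y0 *v c\<close> has derivative 0 and fails to
      solve the equation by at most \<open>K * norm (Y0 *v c)\<close>.\<close>
    have bd: "norm (rhs l 0 t (?y l t) - 0) \<le> K * norm (?y l t - Y0 *v c) + K * norm (Y0 *v c)"
      if t: "t \<in> {0..R}" for t
    proof -
      have "rhs l 0 t (?y l t) = rhs l 0 t (?y l t - Y0 *v c) + rhs l 0 t (Y0 *v c)"
        using rhs_add[of l 0 0 t "?y l t - Y0 *v c" "Y0 *v c"] by simp
      then show ?thesis
        using norm_triangle_ineq[of "rhs l 0 t (?y l t - Y0 *v c)" "rhs l 0 t (Y0 *v c)"]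
          K(2)[OF t, of l "?y l t - Y0 *v c"] K(2)[OF t, of l "Y0 *v c"] l by simp
    qed
    have "(norm (?y l x - Y0 *v c))\<^sup>2 \<le> exp ((2 * K + 1) * x) * ((norm (?y l 0 - Y0 *v c))\<^sup>2 + (K * norm (Y0 *v c))\<^sup>2 * x)"
      by (rule gronwall_power2[where y = "\<lambda>x. ?y l x - Y0 *v c", OF assms K(1)
            has_vector_derivative_diff[OF der has_vector_derivative_const] bd x])
    also have "\<dots> \<le> E * ((K * norm (Y0 *v c))\<^sup>2 * x)"
      using E[OF x] x by (simp add: Y_0 mult_right_mono)
    also have "\<dots> = ((sqrt E * (K * norm (Y0 *v c))) * sqrt x)\<^sup>2"
      using \<open>E \<ge> 0\<close> x by (simp add: power_mult_distrib)
    finally show ?thesis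
      by (rule power2_le_imp_le) (use K \<open>E \<ge> 0\<close> x in auto)
  qed
  define C where "C = sqrt (E * R) * b + sqrt E * (K * norm (Y0 *v c))"
  have C: "sqrt (E * R) * b \<le> C" "sqrt E * (K * norm (Y0 *v c)) \<le> C"
    using b K \<open>E \<ge> 0\<close> assms by (auto simp: C_def)
  show ?thesis
  proof (intro exI[of _ C] conjI ballI allI impI)
    show "C \<ge> 0" using C(2) K \<open>E \<ge> 0\<close> order_trans[OF _ C(2)] by simp
    fix x and l m :: real assume x: "x \<in> {0..R}" and l: "\<bar>l\<bar> \<le> M" and m: "\<bar>m\<bar> \<le> M"
    show "norm (?y l x - ?y m x) \<le> C * \<bar>l - m\<bar>"
      using 2[OF x l m] mult_right_mono[OF C(1), of "\<bar>l - m\<bar>"] by linarith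
    show "norm (?y l x - Y0 *v c) \<le> C * sqrt x"
      using 3[OF x l] mult_right_mono[OF C(2), of "sqrt x"] x by fastforce
  qed
qed

end

subsection \<open>The spectral transform\<close>

lemma cinner_zero_left: "cinner 0 v = 0"
  by (simp add: cinner_def)

lemma continuous_on_cadjoint [continuous_intros]:
  fixes A :: "_ \<Rightarrow> complex ^ 'n ^ 'm"
  shows "continuous_on S A \<Longrightarrow> continuous_on S (\<lambda>x. cadjoint (A x))"
  unfolding cadjoint_def by (intro continuous_intros)

context boundary_system
begin

abbreviation ST :: "(real \<Rightarrow> complex ^ 'm) \<Rightarrow> real \<Rightarrow> complex ^ 'n" where
  "ST \<equiv> spectral_transform Y"

lemma integrable_spectral_transform:
  assumes "w \<in> test_functions"
  shows "integrable (lebesgue_on {0..}) (\<lambda>x. cadjoint (Y x z) *v w x)"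
proof -
  obtain R where R: "R \<ge> 0" "\<forall>x\<ge>R. w x = 0" and w: "continuous_on {0..} w"
    using assms by (auto simp: test_functions_def)
  show ?thesis
    by (rule compact_support_integral(1)[OF _ _ R(1)])
       (use R in \<open>auto intro!: continuous_intros w continuous_on_Y\<close>)
qed

text \<open>Pairing with \<open>c\<close> moves the adjoint to the other side and yields a scalar
  integral of the kind to which Lagrange's identity applies.\<close>

lemma cinner_spectral_transform:
  assumes w: "w \<in> test_functions" and R: "R \<ge> 0" "\<And>x. x > R \<Longrightarrow> w x = 0"
  shows "cinner c (ST w l) = integral {0..R} (\<lambda>x. cinner (Y x (of_real l) *v c) (w x))"
proof -
  have wc: "continuous_on {0..} w" using w by (auto simp: test_functions_def)
  have "cinner c (ST w l) = (LINT x|lebesgue_on {0..}. cinner c (cadjoint (Y x (of_real l)) *v w x))"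
    unfolding spectral_transform_def
    by (rule integral_bounded_linear[OF bounded_bilinear.bounded_linear_right[OF bounded_bilinear_cinner], symmetric])
       (rule integrable_spectral_transform[OF w])
  also have "(\<lambda>x. cinner c (cadjoint (Y x (of_real l)) *v w x)) = (\<lambda>x. cinner (Y x (of_real l) *v c) (w x))"
    by (rule ext, subst cnj_cinner[symmetric]) (simp add: cinner_cadjoint cnj_cinner)
  also have "(LINT x|lebesgue_on {0..}. cinner (Y x (of_real l) *v c) (w x)) =
      integral {0..R} (\<lambda>x. cinner (Y x (of_real l) *v c) (w x))"
    by (rule compact_support_integral(2)[OF _ _ R(1)])
       (use R(2) in \<open>auto intro!: continuous_intros wc continuous_on_Y simp: cinner_def\<close>)
  finally show ?thesis .
qed

lemma spectral_transform_add:
  assumes "v \<in> test_functions" "w \<in> test_functions"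
  shows "ST (\<lambda>x. v x + w x) l = ST v l + ST w l"
  unfolding spectral_transform_def
  by (simp add: matrix_vector_right_distrib integrable_spectral_transform assms)

lemma spectral_transform_smult:
  assumes "w \<in> test_functions"
  shows "ST (\<lambda>x. c *s w x) l = c *s ST w l"
proof -
  have bl: "bounded_linear (\<lambda>v :: complex ^ 'n. c *s v)"
    by (rule linear_conv_bounded_linear[THEN iffD1])
       (auto intro!: linearI simp: vector_add_ldistrib scaleR_conv_smult vector_smult_assoc mult.commute)
  show ?thesis
    unfolding spectral_transform_def vector_scalar_commute
    by (rule integral_bounded_linear[OF bl integrable_spectral_transform[OF assms]])
qed

text \<open>Continuity makes a transform an admissible argument of the window forms. It comes, one
  component at a time, from the local Lipschitz bound on \<open>Y\<close> in the spectral
  variable.\<close>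

lemma continuous_on_spectral_transform:
  assumes w: "w \<in> test_functions"
  shows "continuous_on UNIV (ST w)"
proof -
  obtain R where R: "R \<ge> 0" "\<forall>x\<ge>R. w x = 0" and wc: "continuous_on {0..} w"
    using assms by (auto simp: test_functions_def)
  have wc': "continuous_on {0..R} w" by (rule continuous_on_subset[OF wc]) auto
  have Yc: "continuous_on {0..R} (\<lambda>x. Y x z)" for z by (rule continuous_on_subset[OF continuous_on_Y]) auto
  let ?F = "\<lambda>c l. cinner c (ST w l)"
  have F: "?F c l = integral {0..R} (\<lambda>x. cinner (Y x (of_real l) *v c) (w x))" for c l
    by (rule cinner_spectral_transform[OF w R(1)]) (use R(2) in auto)
  have "isCont (?F c) l" for c l
  proof -
    obtain C where C: "C \<ge> 0" "\<And>x l' m. x \<in> {0..R} \<Longrightarrow> \<bar>l'\<bar> \<le> \<bar>l\<bar> + 1 \<Longrightarrow> \<bar>m\<bar> \<le> \<bar>l\<bar> + 1 \<Longrightarrow>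
      norm (Y x (of_real l') *v c - Y x (of_real m) *v c) \<le> C * \<bar>l' - m\<bar>"
      using Y_bounds[OF R(1), of "\<bar>l\<bar> + 1" c] by blast
    define D where "D = integral {0..R} (\<lambda>x. 2 * C * norm (w x))"
    have ev: "\<forall>\<^sub>F m in at l. norm (?F c m - ?F c l) \<le> D * \<bar>m - l\<bar>"
    proof -
      have "\<forall>\<^sub>F m in at l. dist m l < 1" by (auto simp: eventually_at intro: exI[of _ 1])
      then show ?thesis
      proof eventually_elim
        case (elim m)
        then have ml: "\<bar>m\<bar> \<le> \<bar>l\<bar> + 1" by (auto simp: dist_real_def)
        have "?F c m - ?F c l = integral {0..R} (\<lambda>x. cinner (Y x (of_real m) *v c) (w x) - cinner (Y x (of_real l) *v c) (w x))"
          unfolding F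
          by (intro Henstock_Kurzweil_Integration.integral_diff[symmetric] integrable_continuous_real continuous_intros wc' Yc)
        also have "norm \<dots> \<le> integral {0..R} (\<lambda>x. 2 * C * norm (w x) * \<bar>m - l\<bar>)"
        proof (rule integral_norm_bound_integral)
          fix x assume x: "x \<in> {0..R}"
          have "norm (cinner (Y x (of_real m) *v c) (w x) - cinner (Y x (of_real l) *v c) (w x))
              \<le> 2 * (norm (Y x (of_real m) *v c - Y x (of_real l) *v c) * norm (w x))"
            unfolding cinner_diff_left[symmetric] by (rule norm_cinner_le)
          also have "\<dots> \<le> 2 * ((C * \<bar>m - l\<bar>) * norm (w x))"
            using C(2)[OF x ml, of l] by (intro mult_left_mono mult_right_mono) auto
          finally show "norm (cinner (Y x (of_real m) *v c) (w x) - cinner (Y x (of_real l) *v c) (w x))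
             \<le> 2 * C * norm (w x) * \<bar>m - l\<bar>" by (simp add: mult_ac)
        qed (intro integrable_continuous_real continuous_intros wc' Yc)+
        finally show ?case by (simp add: D_def)
      qed
    qed
    have "((\<lambda>m. D * \<bar>m - l\<bar>) \<longlongrightarrow> D * \<bar>l - l\<bar>) (at l)" by (intro tendsto_intros)
    then have "((\<lambda>m. ?F c m - ?F c l) \<longlongrightarrow> 0) (at l)"
      by (intro Lim_null_comparison[OF ev]) simp
    then show ?thesis by (simp add: isCont_def LIM_zero_iff)
  qed
  then have "continuous_on UNIV (?F c)" for c by (simp add: continuous_at_imp_continuous_on)
  then have "continuous_on UNIV (\<lambda>l. ST w l $ i)" for i
    using cinner_axis[of i] by (metis (no_types, lifting) continuous_on_cong)
  then show ?thesis
    using continuous_on_vec_lambda[of UNIV "\<lambda>i l. ST w l $ i"] by simp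
qed

text \<open>A bump of mass 1 on \<open>[0,a]\<close> times a vector \<open>v\<close> acts like a
  delta function at 0: its transform is close to the adjoint of \<open>Y0\<close> applied to
  \<open>v\<close>. Closeness is uniform only for bounded \<open>l\<close>, because the bump sees
  \<open>Y\<close> at positive \<open>x\<close>.\<close>

lemma approximate_basis_vector:
  assumes "e > 0"
  shows "\<exists>f\<in>test_functions. \<forall>l. \<bar>l\<bar> \<le> M \<longrightarrow> norm (ST f l - axis i 1) \<le> e"
proof -
  obtain v where v: "cadjoint Y0 *v v = axis i 1" using Y0_adjoint_surj by blast
  have "\<exists>C\<ge>0. \<forall>x\<in>{0..1}. \<forall>l. \<bar>l\<bar> \<le> M \<longrightarrow> norm (Y x (of_real l) *v axis j 1 - Y0 *v axis j 1) \<le> C * sqrt x" for j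
    using Y_bounds[of 1 M "axis j 1"] by (metis zero_le_one)
  then obtain C where C: "\<And>j. C j \<ge> 0" "\<And>j x l. x \<in> {0..1} \<Longrightarrow> \<bar>l\<bar> \<le> M \<Longrightarrow>
     norm (Y x (of_real l) *v axis j 1 - Y0 *v axis j 1) \<le> C j * sqrt x" by metis
  define D where "D = (\<Sum>j\<in>UNIV. 2 * C j * norm v)"
  have D: "D \<ge> 0" using C(1) by (auto simp: D_def intro!: sum_nonneg)
  \<comment> \<open>Makes \<open>D * sqrt a \<le> e\<close>; \<open>a \<le> 1\<close> keeps the bump
    in the interval on which the constants \<open>C j\<close> are valid.\<close>
  define a where "a = min 1 ((e / (D + 1))\<^sup>2)"
  have a: "0 < a" "a \<le> 1" using assms D by (auto simp: a_def)
  have "sqrt a \<le> sqrt ((e / (D + 1))\<^sup>2)" unfolding a_def by (rule real_sqrt_le_mono) simp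
  then have "sqrt a \<le> e / (D + 1)" using assms D by simp
  then have "D * sqrt a \<le> D * (e / (D + 1))" using D by (intro mult_left_mono)
  also have "\<dots> \<le> e" using assms D by (simp add: field_simps)
  finally have Da: "D * sqrt a \<le> e" .
  \<comment> \<open>A triangular density of integral 1 that vanishes at \<open>a\<close>, so that
    its extension by 0 is continuous.\<close>
  define b where "b x = 2 / a * (1 - x / a)" for x
  have b_nn: "0 \<le> b x" if "x \<in> {0..a}" for x
    unfolding b_def by (intro mult_nonneg_nonneg) (use that a in auto)
  have b_int: "(b has_integral 1) {0..a}"
  proof -
    have "(b has_integral (2 / a * (a - a\<^sup>2 / (2 * a)) - 2 / a * (0 - 0\<^sup>2 / (2 * a)))) {0..a}"
    proof (rule fundamental_theorem_of_calculus)
      fix x assume "x \<in> {0..a}"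
      show "((\<lambda>x. 2 / a * (x - x\<^sup>2 / (2 * a))) has_vector_derivative b x) (at x within {0..a})"
        unfolding has_real_derivative_iff_has_vector_derivative[symmetric] b_def
        using a by (auto intro!: derivative_eq_intros)
    qed (use a in auto)
    then show ?thesis using a by (simp add: field_simps power2_eq_square)
  qed
  have b_cont: "continuous_on S b" for S unfolding b_def using a by (intro continuous_intros) auto
  define f where "f x = (if x \<le> a then b x *\<^sub>R v else 0)" for x
  have "continuous_on {0..} f" unfolding f_def
    by (rule continuous_on_cut) (use a in \<open>auto intro!: continuous_intros b_cont simp: b_def\<close>)
  moreover have "\<forall>x\<ge>a. f x = 0" using a by (auto simp: f_def b_def)
  ultimately have f: "f \<in> test_functions" using a unfolding test_functions_def by (auto intro: less_imp_le)
  have Yc: "continuous_on {0..a} (\<lambda>x. Y x z)" for z by (rule continuous_on_subset[OF continuous_on_Y]) auto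
  have comp: "norm ((ST f l - axis i 1) $ j) \<le> 2 * C j * norm v * sqrt a" if l: "\<bar>l\<bar> \<le> M" for l j
  proof -
    let ?c = "axis j (1::complex)"
    have "(ST f l - axis i 1) $ j = cinner ?c (ST f l) - cinner (Y0 *v ?c) v"
    proof -
      have "cinner (Y0 *v ?c) v = cinner ?c (cadjoint Y0 *v v)"
        by (metis cinner_cadjoint cnj_cinner)
      then show ?thesis by (simp add: v cinner_axis)
    qed
    also have "cinner ?c (ST f l) = integral {0..a} (\<lambda>x. cinner (Y x (of_real l) *v ?c) (f x))"
      by (rule cinner_spectral_transform[OF f]) (use a in \<open>auto simp: f_def\<close>)
    also have "\<dots> = integral {0..a} (\<lambda>x. b x *\<^sub>R cinner (Y x (of_real l) *v ?c) v)"
      by (rule integral_cong) (simp add: f_def scaleR_conv_smult cinner_smult_right scaleR_conv_of_real)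
    also have "cinner (Y0 *v ?c) v = integral {0..a} (\<lambda>x. b x *\<^sub>R cinner (Y0 *v ?c) v)"
      using has_integral_scaleR_left[OF b_int, of "cinner (Y0 *v ?c) v"] by (simp add: integral_unique)
    also have "integral {0..a} (\<lambda>x. b x *\<^sub>R cinner (Y x (of_real l) *v ?c) v) - \<dots> =
      integral {0..a} (\<lambda>x. b x *\<^sub>R cinner (Y x (of_real l) *v ?c) v - b x *\<^sub>R cinner (Y0 *v ?c) v)"
      by (intro Henstock_Kurzweil_Integration.integral_diff[symmetric] integrable_continuous_real continuous_intros b_cont Yc)
    also have "norm \<dots> \<le> integral {0..a} (\<lambda>x. (2 * C j * norm v * sqrt a) * b x)"
    proof (rule integral_norm_bound_integral)
      fix x assume x: "x \<in> {0..a}"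
      have "norm (b x *\<^sub>R cinner (Y x (of_real l) *v ?c) v - b x *\<^sub>R cinner (Y0 *v ?c) v) =
         b x * norm (cinner (Y x (of_real l) *v ?c - Y0 *v ?c) v)"
        using b_nn[OF x] by (simp add: cinner_diff_left flip: scaleR_diff_right)
      also have "\<dots> \<le> b x * (2 * (norm (Y x (of_real l) *v ?c - Y0 *v ?c) * norm v))"
        by (intro mult_left_mono norm_cinner_le b_nn x)
      also have "\<dots> \<le> b x * (2 * ((C j * sqrt a) * norm v))"
      proof -
        have "norm (Y x (of_real l) *v ?c - Y0 *v ?c) \<le> C j * sqrt x"
          by (rule C(2)) (use x a l in auto)
        also have "\<dots> \<le> C j * sqrt a" using x C(1) by (intro mult_left_mono) auto
        finally show ?thesis using b_nn[OF x] by (intro mult_left_mono mult_right_mono) auto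
      qed
      finally show "norm (b x *\<^sub>R cinner (Y x (of_real l) *v ?c) v - b x *\<^sub>R cinner (Y0 *v ?c) v) \<le> (2 * C j * norm v * sqrt a) * b x"
        by (simp add: mult_ac)
    qed (intro integrable_continuous_real continuous_intros b_cont Yc)+
    also have "\<dots> = 2 * C j * norm v * sqrt a"
      using has_integral_mult_right[OF b_int, of "2 * C j * norm v * sqrt a"] by (simp only: integral_unique mult_1_right)
    finally show ?thesis .
  qed
  have "norm (ST f l - axis i 1) \<le> e" if "\<bar>l\<bar> \<le> M" for l
  proof -
    have "norm (ST f l - axis i 1) \<le> (\<Sum>j\<in>UNIV. norm ((ST f l - axis i 1) $ j))"
      unfolding norm_vec_def by (rule L2_set_le_sum) simp
    also have "\<dots> \<le> (\<Sum>j\<in>UNIV. 2 * C j * norm v * sqrt a)" by (rule sum_mono) (rule comp[OF that])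
    also have "\<dots> = D * sqrt a" by (simp add: D_def sum_distrib_right)
    finally show ?thesis using Da by simp
  qed
  with f show ?thesis by blast
qed

text \<open>The solution of the boundary value problem on \<open>[0,R]\<close>, cut off by \<open>(1 - x / R)\<^sup>2\<close>, is an approximate
  resolvent of \<open>f\<close>: by the energy bound the error is of order \<open>1 / R\<close> in the \<open>L\<^sup>2\<close> norm.\<close>

lemma approximate_resolvent:
  assumes s: "s \<in> {1, -1}" and f: "f \<in> test_functions" and "\<epsilon> > 0"
  shows "\<exists>w\<in>test_functions. \<exists>e\<in>test_functions. (LINT x|lebesgue_on {0..}. (norm (e x))\<^sup>2) \<le> \<epsilon> \<and>
    (\<forall>l. ST f l =
       (of_real l - of_real s * \<i>) *s ST w l + ST e l)"
proof -
  let ?z = "of_real s * \<i>"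
  obtain a where a: "a \<ge> 0" "\<forall>x\<ge>a. f x = 0" and fc: "continuous_on {0..} f"
    using f by (auto simp: test_functions_def)
  obtain k where k: "k > 0" "\<And>(A :: complex ^ 'm ^ 'm) v. norm (A *v v) \<le> norm A * norm v * k"
    using matrix_norm_bound by blast
  define kB where "kB = norm B * k"
  have kB: "norm (B *v v) \<le> kB * norm v" for v using k(2)[of B v] by (simp add: kB_def mult_ac)
  have kB0: "kB \<ge> 0" using k(1) by (simp add: kB_def)
  define If where "If = integral {0..a} (\<lambda>x. (norm (f x))\<^sup>2)"
  \<comment> \<open>Anticipates the final bound \<open>D / R^2\<close> for the squared norm of the
    error: \<open>a\<close> enters through the part with \<open>f\<close>, \<open>kB\<close> through
    the part with \<open>B *v u\<close>.\<close>
  define D where "D = 8 * (a\<^sup>2 + kB\<^sup>2) * If"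
  have "If \<ge> 0" unfolding If_def
    by (rule integral_nonneg) (auto intro!: integrable_continuous_real continuous_intros continuous_on_subset[OF fc])
  then have D0: "D \<ge> 0" by (simp add: D_def)
  define R where "R = max (a + 1) (D / \<epsilon> + 1)"
  have R: "R > 0" "R > a" "R \<ge> 1" and DR: "D \<le> \<epsilon> * R"
    using a \<open>\<epsilon> > 0\<close> D0 by (auto simp: R_def max_def field_simps)
  have fc': "continuous_on {0..R} f" by (rule continuous_on_subset[OF fc]) auto
  obtain u c where u: "sol ?z f R u" "u 0 = Y0 *v c" "P s (u R) = 0"
    using boundary_problem_solvable[OF s R(1) fc'] by blast
  note uc = sol_continuous[OF u(1)]
  have IfR: "integral {0..R} (\<lambda>x. (norm (f x))\<^sup>2) = If"
  proof -
    have "continuous_on {0..} (\<lambda>x. (norm (f x))\<^sup>2)" by (intro continuous_intros fc)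
    then show ?thesis
      using compact_support_integral(2)[of "\<lambda>x. (norm (f x))\<^sup>2" R] compact_support_integral(2)[of "\<lambda>x. (norm (f x))\<^sup>2" a]
        a R unfolding If_def by simp
  qed
  have en: "integral {0..R} (\<lambda>x. (norm (u x))\<^sup>2) \<le> If"
    using energy_bound[OF s _ u(1) fc' u(2,3)] R IfR by simp
  \<comment> \<open>The square makes the derivative vanish at \<open>R\<close> as well. Hence
    \<open>W\<close> and \<open>g\<close> are both 0 there, and \<open>w\<close> and
    \<open>e\<close> remain continuous when extended by 0.\<close>
  define \<rho> where "\<rho> x = (1 - x / R)\<^sup>2" for x
  define \<rho>' where "\<rho>' x = - (2 / R) * (1 - x / R)" for x
  have \<rho>_cont: "continuous_on S \<rho>" "continuous_on S \<rho>'" for S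
    unfolding \<rho>_def \<rho>'_def using R by (intro continuous_intros; simp)+
  have \<rho>_der: "(\<rho> has_real_derivative \<rho>' x) (at x within S)" for x S
    unfolding \<rho>_def \<rho>'_def using R by (auto intro!: derivative_eq_intros)
  define W where "W x = \<rho> x *\<^sub>R u x" for x
  \<comment> \<open>\<open>(L - z) (\<rho> u) = \<rho> f + (1/\<i>) \<rho>' B u\<close>, and
    \<open>1/\<i> = - \<i>\<close>.\<close>
  define g where "g x = \<rho> x *\<^sub>R f x - \<i> *s (\<rho>' x *\<^sub>R (B *v u x))" for x
  have W: "sol ?z g R W"
    unfolding sol_def
  proof
    fix x assume x: "x \<in> {0..R}"
    have "(W has_vector_derivative (\<rho> x *\<^sub>R rhs ?z (f x) x (u x) + \<rho>' x *\<^sub>R u x)) (at x within {0..R})"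
      unfolding W_def using u(1) x \<rho>_der by (intro has_vector_derivative_scaleR) (auto simp: sol_def)
    moreover have "\<rho> x *\<^sub>R rhs ?z (f x) x (u x) + \<rho>' x *\<^sub>R u x = rhs ?z (g x) x (W x)"
      by (rule rhs_unique)
         (simp add: matrix_vector_right_distrib scaleR_conv_smult vector_scalar_commute B_rhs g_def W_def,
          simp add: vec_eq_iff algebra_simps)
    ultimately show "(W has_vector_derivative rhs ?z (g x) x (W x)) (at x within {0..R})" by simp
  qed
  define w where "w x = (if x \<le> R then W x else 0)" for x
  define e where "e x = (if x \<le> R then f x - g x else 0)" for x
  have WR: "W R = 0" "g R = 0" "f R = 0" using R a by (auto simp: W_def g_def \<rho>_def \<rho>'_def)
  have gc: "continuous_on {0..R} g" unfolding g_def by (intro continuous_intros \<rho>_cont fc' uc)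
  have wt: "w \<in> test_functions" unfolding test_functions_def w_def
    using R WR by (auto intro!: continuous_on_cut sol_continuous[OF W] exI[of _ R])
  have et: "e \<in> test_functions" unfolding test_functions_def e_def
    using R WR by (auto intro!: continuous_on_cut continuous_intros gc fc' exI[of _ R])
  have ST: "ST f l = (of_real l - ?z) *s ST w l + ST e l" for l
  proof (rule cinner_eqI)
    fix d
    let ?y = "\<lambda>x. Y x (of_real l) *v d"
    have yc: "continuous_on {0..R} (\<lambda>x. Y x (of_real l))"
      by (rule continuous_on_subset[OF continuous_on_Y]) auto
    have Wc: "continuous_on {0..R} W" by (rule sol_continuous[OF W])
    \<comment> \<open>Both boundary terms vanish: \<open>W R = 0\<close>, and at 0 both functions
      have values in the isotropic range of \<open>Y0\<close>. What remains says that the transform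
      of \<open>g\<close> is \<open>l - z\<close> times that of \<open>W\<close>.\<close>
    have "((\<lambda>x. \<i> * (cinner (?y x) (g x) - cinner 0 (W x) + (?z - cnj (of_real l)) * cinner (?y x) (W x)))
      has_integral (cinner (?y R) (B *v W R) - cinner (?y 0) (B *v W 0))) {0..R}"
      by (rule Lagrange[OF Y_column_sol W]) (use R in auto)
    moreover have "cinner (?y R) (B *v W R) - cinner (?y 0) (B *v W 0) = 0"
      using isotropic[of d c] R by (simp add: WR Y_0 W_def \<rho>_def u(2) cinner_def)
    ultimately have "((\<lambda>x. (-\<i>) * (\<i> * (cinner (?y x) (g x) - cinner 0 (W x) + (?z - cnj (of_real l)) * cinner (?y x) (W x))))
      has_integral (-\<i>) * 0) {0..R}"
      by (intro has_integral_mult_right) simp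
    moreover have "(-\<i>) * (\<i> * t) = t" for t by (simp flip: mult.assoc)
    ultimately have "((\<lambda>x. cinner (?y x) (g x) + (?z - of_real l) * cinner (?y x) (W x)) has_integral 0) {0..R}"
      by (simp add: cinner_zero_left add.commute)
    then have "0 = integral {0..R} (\<lambda>x. cinner (?y x) (g x) + (?z - of_real l) * cinner (?y x) (W x))"
      by (simp add: integral_unique)
    also have "\<dots> = integral {0..R} (\<lambda>x. cinner (?y x) (g x)) + integral {0..R} (\<lambda>x. (?z - of_real l) * cinner (?y x) (W x))"
      by (intro Henstock_Kurzweil_Integration.integral_add integrable_continuous_real continuous_intros yc gc Wc)
    also have "integral {0..R} (\<lambda>x. (?z - of_real l) * cinner (?y x) (W x)) =
        (?z - of_real l) * integral {0..R} (\<lambda>x. cinner (?y x) (W x))"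
      by (rule Henstock_Kurzweil_Integration.integral_mult_right)
    finally have gW: "integral {0..R} (\<lambda>x. cinner (?y x) (g x)) = (of_real l - ?z) * integral {0..R} (\<lambda>x. cinner (?y x) (W x))"
      by (simp add: algebra_simps)
    have "cinner d (ST f l) = integral {0..R} (\<lambda>x. cinner (?y x) (f x))"
      by (rule cinner_spectral_transform[OF f]) (use R a in auto)
    also have "\<dots> = integral {0..R} (\<lambda>x. cinner (?y x) (g x) + cinner (?y x) (e x))"
      by (rule integral_cong) (simp add: e_def cinner_diff_right)
    also have "\<dots> = integral {0..R} (\<lambda>x. cinner (?y x) (g x)) + integral {0..R} (\<lambda>x. cinner (?y x) (e x))"
    proof (intro Henstock_Kurzweil_Integration.integral_add integrable_continuous_real continuous_intros yc gc)
      show "continuous_on {0..R} e" by (rule continuous_on_subset[of "{0..}"]) (use et in \<open>auto simp: test_functions_def\<close>)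
    qed
    also have "integral {0..R} (\<lambda>x. cinner (?y x) (e x)) = cinner d (ST e l)"
      by (rule cinner_spectral_transform[OF et, symmetric]) (use R in \<open>auto simp: e_def\<close>)
    also note gW
    also have "integral {0..R} (\<lambda>x. cinner (?y x) (W x)) = integral {0..R} (\<lambda>x. cinner (?y x) (w x))"
      by (rule integral_cong) (simp add: w_def)
    also have "\<dots> = cinner d (ST w l)"
      by (rule cinner_spectral_transform[OF wt, symmetric]) (use R in \<open>auto simp: w_def\<close>)
    finally show "cinner d (ST f l) =
        cinner d ((of_real l - ?z) *s ST w l + ST e l)"
      unfolding cinner_add_right cinner_smult_right .
  qed
  have "(LINT x|lebesgue_on {0..}. (norm (e x))\<^sup>2) = integral {0..R} (\<lambda>x. (norm (e x))\<^sup>2)"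
    by (rule compact_support_integral(2))
       (use et R in \<open>auto simp: test_functions_def e_def intro!: continuous_intros\<close>)
  also have "\<dots> \<le> integral {0..R} (\<lambda>x. (8 * a\<^sup>2 / R\<^sup>2) * (norm (f x))\<^sup>2 + (8 * kB\<^sup>2 / R\<^sup>2) * (norm (u x))\<^sup>2)"
  proof (rule integral_le)
    have "continuous_on {0..R} e"
      by (rule continuous_on_subset[of "{0..}"]) (use et in \<open>auto simp: test_functions_def\<close>)
    then show "(\<lambda>x. (norm (e x))\<^sup>2) integrable_on {0..R}"
      by (intro integrable_continuous_real continuous_intros)
    fix x assume x: "x \<in> {0..R}"
    have \<rho>: "\<bar>1 - \<rho> x\<bar> * norm (f x) \<le> (2 * a / R) * norm (f x)"
    proof (cases "x \<le> a")
      case True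
      have "x / R \<le> 1" "0 \<le> x / R" using x R by auto
      moreover have "1 - \<rho> x = x / R * (2 - x / R)" by (simp add: \<rho>_def power2_eq_square algebra_simps)
      moreover have "\<bar>t * (2 - t)\<bar> \<le> t * 2" if "0 \<le> t" "t \<le> 1" for t :: real
        using that mult_left_mono[of "2 - t" 2 t] by (simp add: abs_mult)
      ultimately have "\<bar>1 - \<rho> x\<bar> \<le> x / R * 2" by metis
      also have "\<dots> \<le> 2 * a / R" using True R by (simp add: divide_right_mono)
      finally show ?thesis by (rule mult_right_mono) simp
    qed (use a in auto)
    have "\<bar>\<rho>' x\<bar> \<le> 2 / R"
    proof -
      have "\<bar>1 - x / R\<bar> \<le> 1" using x R by (auto simp: abs_if field_simps)
      moreover have "\<bar>- (2 / R)\<bar> = 2 / R" using R by simp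
      ultimately show ?thesis
        unfolding \<rho>'_def abs_mult using mult_left_mono[of "\<bar>1 - x / R\<bar>" 1 "2 / R"] R by simp
    qed
    then have \<rho>': "\<bar>\<rho>' x\<bar> * norm (B *v u x) \<le> (2 / R) * (kB * norm (u x))"
      using kB[of "u x"] R by (intro mult_mono) auto
    \<comment> \<open>The first part is at most \<open>(2 * a / R) * norm (f x)\<close>, since
      \<open>f\<close> vanishes beyond \<open>a\<close>; the second is at most
      \<open>(2 / R) * kB * norm (u x)\<close>, with \<open>u\<close> controlled in mean square by
      the energy bound.\<close>
    have "e x = (1 - \<rho> x) *\<^sub>R f x - (- (\<i> *s (\<rho>' x *\<^sub>R (B *v u x))))"
      using x by (simp add: e_def g_def scaleR_left_diff_distrib)
    then have "(norm (e x))\<^sup>2 \<le> 2 * (norm ((1 - \<rho> x) *\<^sub>R f x))\<^sup>2 + 2 * (norm (- (\<i> *s (\<rho>' x *\<^sub>R (B *v u x)))))\<^sup>2"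
      using norm_diff_power2_le by metis
    also have "norm ((1 - \<rho> x) *\<^sub>R f x) = \<bar>1 - \<rho> x\<bar> * norm (f x)" by simp
    also have "norm (- (\<i> *s (\<rho>' x *\<^sub>R (B *v u x)))) = \<bar>\<rho>' x\<bar> * norm (B *v u x)" by (simp add: norm_smult)
    also have "2 * (\<bar>1 - \<rho> x\<bar> * norm (f x))\<^sup>2 + 2 * (\<bar>\<rho>' x\<bar> * norm (B *v u x))\<^sup>2 \<le>
       2 * ((2 * a / R) * norm (f x))\<^sup>2 + 2 * ((2 / R) * (kB * norm (u x)))\<^sup>2"
      using \<rho> \<rho>' by (intro add_mono mult_left_mono power_mono) auto
    finally show "(norm (e x))\<^sup>2 \<le> (8 * a\<^sup>2 / R\<^sup>2) * (norm (f x))\<^sup>2 + (8 * kB\<^sup>2 / R\<^sup>2) * (norm (u x))\<^sup>2"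
      by (simp add: power_mult_distrib power_divide)
  qed (use R in \<open>intro integrable_continuous_real continuous_intros fc' uc; simp\<close>)
  also have "\<dots> = (8 * a\<^sup>2 / R\<^sup>2) * If + (8 * kB\<^sup>2 / R\<^sup>2) * integral {0..R} (\<lambda>x. (norm (u x))\<^sup>2)"
    by (subst Henstock_Kurzweil_Integration.integral_add)
       (auto intro!: integrable_continuous_real continuous_intros fc' uc simp: IfR R(1)[THEN less_imp_neq, symmetric])
  also have "\<dots> \<le> (8 * a\<^sup>2 / R\<^sup>2) * If + (8 * kB\<^sup>2 / R\<^sup>2) * If"
    using en by (intro add_left_mono mult_left_mono) auto
  also have "\<dots> = D / R\<^sup>2" by (simp add: D_def add_divide_distrib algebra_simps)
  also have "\<dots> \<le> \<epsilon>"
  proof -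
    have "\<epsilon> * R \<le> \<epsilon> * R\<^sup>2" using R \<open>\<epsilon> > 0\<close> by (intro mult_left_mono) (auto simp: power2_eq_square)
    with DR show ?thesis using R by (simp add: divide_le_eq)
  qed
  finally show ?thesis using wt et ST by blast
qed

end

subsection \<open>Approximation by transforms\<close>

text \<open>The point \<open>(1/(1+l^2), l/(1+l^2))\<close> runs through the circle
  \<open>s1^2 + s2^2 = s1\<close> without the origin, and \<open>l = s2/s1\<close>; the origin
  stands for infinity. A continuous function of compact support extends by 0 to the whole compact
  circle, where polynomials are uniformly dense.\<close>

lemma resolvent_coordinates_approximation:
  fixes \<phi> :: "real \<Rightarrow> real"
  assumes \<phi>: "continuous_on UNIV \<phi>" and M: "M > 0" "\<And>l. \<bar>l\<bar> \<ge> M \<Longrightarrow> \<phi> l = 0" and "e > 0"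
  shows "\<exists>p :: real \<times> real \<Rightarrow> real. real_polynomial_function p \<and>
    (\<forall>l. \<bar>\<phi> l - p (1 / (1 + l\<^sup>2), l / (1 + l\<^sup>2))\<bar> < e)"
proof -
  define S :: "(real \<times> real) set" where "S = {s. (fst s)\<^sup>2 + (snd s)\<^sup>2 = fst s}"
  \<comment> \<open>The first coordinate at \<open>\<bar>l\<bar> = M\<close>. Smaller first
    coordinates belong to larger \<open>\<bar>l\<bar>\<close>, where \<open>\<phi>\<close> is
    0.\<close>
  define \<delta> where "\<delta> = 1 / (1 + M\<^sup>2)"
  have \<delta>: "\<delta> > 0" by (simp add: \<delta>_def add_pos_nonneg)
  define \<Phi> where "\<Phi> s = (if fst s \<ge> \<delta> then \<phi> (snd s / fst s) else 0)" for s :: "real \<times> real"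
  have "closed S" unfolding S_def by (intro closed_Collect_eq continuous_intros)
  have "compact S"
  proof -
    have "norm s \<le> 1" if "s \<in> S" for s
    proof -
      have *: "(fst s)\<^sup>2 + (snd s)\<^sup>2 = fst s" using that by (simp add: S_def)
      then have "fst s * fst s \<le> fst s * 1" by (simp add: power2_eq_square) (metis le_add_same_cancel1 zero_le_square)
      then have "fst s \<le> 1" by (metis * add_nonneg_nonneg mult_left_le_imp_le mult_le_cancel_left1 nle_le not_less zero_le_power2 zero_less_one_class.zero_le_one)
      then show ?thesis by (simp add: norm_prod_def *)
    qed
    then have "bounded S" unfolding bounded_iff by blast
    with \<open>closed S\<close> show ?thesis by (simp add: compact_eq_bounded_closed)
  qed
  moreover have "continuous_on S \<Phi>"
  proof -
    let ?S1 = "S \<inter> {s. fst s \<ge> \<delta>}" and ?S2 = "S \<inter> {s. fst s \<le> \<delta>}"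
    have "continuous_on (?S1 \<union> ?S2) (\<lambda>s. if fst s \<ge> \<delta> then \<phi> (snd s / fst s) else 0)"
    proof (rule continuous_on_cases)
      show "closed ?S1" "closed ?S2"
        by (intro closed_Int \<open>closed S\<close> closed_Collect_le continuous_intros)+
      show "continuous_on ?S1 (\<lambda>s. \<phi> (snd s / fst s))"
        by (rule continuous_on_compose2[OF \<phi>]) (use \<delta> in \<open>auto intro!: continuous_intros\<close>)
      \<comment> \<open>The two pieces meet where the first coordinate is \<open>\<delta>\<close>;
        there the ratio of the coordinates is \<open>\<plusminus>M\<close>, a zero of
        \<open>\<phi>\<close>.\<close>
      show "\<forall>x. x \<in> ?S1 \<and> \<not> \<delta> \<le> fst x \<or> x \<in> ?S2 \<and> \<delta> \<le> fst x \<longrightarrow> \<phi> (snd x / fst x) = 0"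
      proof (intro allI impI)
        fix x assume "x \<in> ?S1 \<and> \<not> \<delta> \<le> fst x \<or> x \<in> ?S2 \<and> \<delta> \<le> fst x"
        then have x: "fst x = \<delta>" "\<delta>\<^sup>2 + (snd x)\<^sup>2 = \<delta>" by (auto simp: S_def)
        then have "(snd x / \<delta>)\<^sup>2 = 1 / \<delta> - 1"
          using \<delta> by (simp add: power_divide field_simps power2_eq_square)
        also have "\<dots> = M\<^sup>2" by (simp add: \<delta>_def)
        finally have "\<bar>snd x / \<delta>\<bar> = M" using M(1) by (metis abs_of_pos power2_abs power2_eq_iff_nonneg abs_ge_zero)
        then show "\<phi> (snd x / fst x) = 0" using M(2) x by simp
      qed
    qed auto
    moreover have "?S1 \<union> ?S2 = S" by auto
    ultimately show ?thesis unfolding \<Phi>_def by simp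
  qed
  ultimately obtain p where p: "real_polynomial_function p" "\<And>s. s \<in> S \<Longrightarrow> \<bar>\<Phi> s - p s\<bar> < e"
    using Stone_Weierstrass_real_polynomial_function \<open>e > 0\<close> by metis
  have "\<bar>\<phi> l - p (1 / (1 + l\<^sup>2), l / (1 + l\<^sup>2))\<bar> < e" for l
  proof -
    have pos: "1 + l\<^sup>2 > 0" by (simp add: add_pos_nonneg)
    have "(1 / (1 + l\<^sup>2), l / (1 + l\<^sup>2)) \<in> S"
    proof -
      have "(1 / (1 + l\<^sup>2))\<^sup>2 + (l / (1 + l\<^sup>2))\<^sup>2 = (1 + l\<^sup>2) / (1 + l\<^sup>2)\<^sup>2"
        by (simp add: power_divide add_divide_distrib)
      also have "\<dots> = 1 / (1 + l\<^sup>2)" using pos by (simp add: power2_eq_square)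
      finally show ?thesis by (simp add: S_def)
    qed
    moreover have "\<Phi> (1 / (1 + l\<^sup>2), l / (1 + l\<^sup>2)) = \<phi> l"
    proof (cases "\<delta> \<le> 1 / (1 + l\<^sup>2)")
      case True
      then show ?thesis using pos by (simp add: \<Phi>_def)
    next
      case False
      then have "1 / (1 + l\<^sup>2) < 1 / (1 + M\<^sup>2)" by (simp add: \<delta>_def)
      then have "M\<^sup>2 < l\<^sup>2" using pos by (simp add: divide_less_eq less_divide_eq add_pos_nonneg split: if_splits)
      then have "M < \<bar>l\<bar>" using M(1) by (metis abs_ge_zero power2_abs power2_less_imp_less)
      then show ?thesis using False M(2)[of l] by (simp add: \<Phi>_def)
    qed
    ultimately show ?thesis using p(2) by metis
  qed
  with p(1) show ?thesis by blast
qed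

section \<open>Functions in the closure of the range, and multipliers preserving it\<close>

locale isometric_boundary_system = boundary_system B Q Y Y0 P + spectral_matrix \<sigma>
  for B :: "complex ^ 'm::finite ^ 'm" and Q and Y :: "real \<Rightarrow> complex \<Rightarrow> complex ^ 'n::finite ^ 'm"
    and Y0 P and \<sigma> :: "real \<Rightarrow> complex ^ 'n ^ 'n" +
  fixes F :: "(real \<Rightarrow> complex ^ 'm) \<Rightarrow> (nat \<Rightarrow> real \<Rightarrow> complex ^ 'n) set"
  assumes isometric: "isometric_extension Y \<sigma> F"
begin

text \<open>The class of a transform is nonempty as an element of the quotient. Its definition
  provides compactly supported \<open>u k\<close> whose difference from \<open>ST w\<close> is small
  on all large windows, and the isometry gives the limit of their norms.\<close>

lemma transform_representative:
  assumes w: "w \<in> test_functions"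
  shows "\<exists>u\<in>F w. (\<forall>k. u k \<in> C0) \<and>
    (\<forall>e>0. \<forall>\<^sub>F k in sequentially. \<forall>\<^sub>F R in at_top. window_dist R (ST w) (u k) < e) \<and>
    (\<lambda>k. sigma_norm \<sigma> (u k)) \<longlonglongrightarrow> sqrt (LINT x|lebesgue_on {0..}. (norm (w x))\<^sup>2)"
proof -
  have wc: "w \<in> L2_half_line_compact" by (rule test_functions_L2[OF w])
  then have wL: "w \<in> L2_half_line" by (simp add: L2_half_line_compact_def)
  have Fw: "F w \<in> L2_sigma \<sigma>" "F w = sigma_class \<sigma> (ST w)"
    using isometric wc wL by (auto simp: isometric_extension_def)
  then obtain u where u: "u \<in> F w"
    using in_quotient_imp_non_empty[OF equiv_sigma_equiv] unfolding L2_sigma_def by blast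
  with Fw obtain c where uC: "u \<in> sigma_Cauchy \<sigma>"
    and c: "\<And>k. has_sigma_inner \<sigma> (\<lambda>l. ST w l - u k l) (\<lambda>l. ST w l - u k l) (c k)" "c \<longlonglongrightarrow> 0"
    unfolding sigma_class_def by blast
  have uC0: "u k \<in> C0" for k using uC by (rule sigma_Cauchy_C0)
  have "\<forall>\<^sub>F k in sequentially. \<forall>\<^sub>F R in at_top. window_dist R (ST w) (u k) < e" if e: "e > 0" for e
  proof -
    have "(\<lambda>k. sqrt (Re (c k))) \<longlonglongrightarrow> sqrt (Re 0)" by (intro tendsto_intros c)
    then have "\<forall>\<^sub>F k in sequentially. sqrt (Re (c k)) < e" using e by (intro order_tendstoD(2)) simp_all
    then show ?thesis
    proof eventually_elim
      case (elim k)
      have "((\<lambda>R. window_dist R (ST w) (u k)) \<longlongrightarrow> sqrt (Re (c k))) at_top"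
        unfolding window_norm_def using c(1)[of k] unfolding has_sigma_inner_iff by (intro tendsto_intros)
      then show ?case using elim by (rule order_tendstoD(2))
    qed
  qed
  moreover have "(\<lambda>k. sigma_norm \<sigma> (u k)) \<longlonglongrightarrow> sqrt (LINT x|lebesgue_on {0..}. (norm (w x))\<^sup>2)"
  proof -
    have "(\<lambda>k. sqrt (Re (sigma_inner \<sigma> (u k) (u k)))) \<longlonglongrightarrow> sqrt (Re (L2_sigma_inner \<sigma> (F w) (F w)))"
      by (intro tendsto_intros L2_sigma_inner_tendsto Fw(1) u)
    moreover have "L2_sigma_inner \<sigma> (F w) (F w) = complex_of_real (LINT x|lebesgue_on {0..}. (norm (w x))\<^sup>2)"
      using isometric wL unfolding isometric_extension_def L2_half_line_inner_def
      by (simp add: cinner_self del: of_real_power)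
    ultimately show ?thesis by (simp add: sigma_norm_def)
  qed
  ultimately show ?thesis using u uC0 by blast
qed

text \<open>The upper half of Parseval's identity, with slack \<open>d\<close>: an error small in
  mean square has a transform small on all large windows.\<close>

lemma transform_bound:
  assumes w: "w \<in> test_functions" and d: "d > 0"
  shows "\<forall>\<^sub>F R in at_top. window_norm R (ST w) \<le> sqrt (LINT x|lebesgue_on {0..}. (norm (w x))\<^sup>2) + d"
proof -
  let ?n = "sqrt (LINT x|lebesgue_on {0..}. (norm (w x))\<^sup>2)"
  have d2: "d / 2 > 0" using d by simp
  obtain u where u: "\<forall>k. u k \<in> C0"
    "\<forall>e>0. \<forall>\<^sub>F k in sequentially. \<forall>\<^sub>F R in at_top. window_dist R (ST w) (u k) < e"
    "(\<lambda>k. sigma_norm \<sigma> (u k)) \<longlonglongrightarrow> ?n"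
    using transform_representative[OF w] by blast
  have "\<forall>\<^sub>F k in sequentially. (\<forall>\<^sub>F R in at_top. window_dist R (ST w) (u k) < d / 2) \<and> sigma_norm \<sigma> (u k) < ?n + d / 2"
    using u(2)[rule_format, OF d2] order_tendstoD(2)[OF u(3), of "?n + d/2"] d2 by (intro eventually_conj) auto
  then obtain k where k: "\<forall>\<^sub>F R in at_top. window_dist R (ST w) (u k) < d / 2" "sigma_norm \<sigma> (u k) < ?n + d / 2"
    using eventually_happens'[OF sequentially_bot] by blast
  show ?thesis
    using k(1) eventually_window_norm_eq[OF u(1)[rule_format, of k]] eventually_ge_at_top[of 0]
  proof eventually_elim
    case (elim R)
    have "window_norm R (\<lambda>l. (ST w l - u k l) + u k l) \<le> window_dist R (ST w) (u k) + window_norm R (u k)"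
      by (intro window_norm_triangle continuous_intros continuous_on_spectral_transform w C0_continuous u(1)[rule_format] elim)
    then show ?case using elim k(2) by simp
  qed
qed

text \<open>Membership in the closure of the range, phrased by windows because \<open>h\<close> need
  not have compact support. Bounds for all large \<open>R\<close> add up under the triangle
  inequality, and no limit in \<open>R\<close> has to exist.\<close>

definition approximable :: "(real \<Rightarrow> complex ^ 'n) \<Rightarrow> bool" where
  "approximable h \<longleftrightarrow> continuous_on UNIV h \<and>
     (\<forall>e>0. \<exists>w\<in>test_functions. \<forall>\<^sub>F R in at_top. window_dist R h (ST w) \<le> e)"

lemma approximable_continuous: "approximable h \<Longrightarrow> continuous_on UNIV h"
  by (simp add: approximable_def)

lemma approximableE:
  assumes "approximable h" "e > 0"
  obtains w where "w \<in> test_functions" "\<forall>\<^sub>F R in at_top. window_dist R h (ST w) \<le> e"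
  using assms unfolding approximable_def by blast

lemma approximable_transform:
  assumes "w \<in> test_functions" shows "approximable (ST w)"
proof -
  have "\<forall>\<^sub>F R in at_top. window_dist R (ST w) (ST w) \<le> e" if "e > 0" for e
    using eventually_ge_at_top[of 0] by eventually_elim (use that window_norm_zero in simp)
  then show ?thesis unfolding approximable_def using continuous_on_spectral_transform assms by blast
qed

text \<open>Needed to turn uniform convergence of multipliers into convergence of their products
  with \<open>h\<close>.\<close>

lemma approximable_bounded:
  assumes h: "approximable h"
  obtains K where "K \<ge> 0" "\<forall>\<^sub>F R in at_top. window_norm R h \<le> K"
proof -
  obtain w where w: "w \<in> test_functions" "\<forall>\<^sub>F R in at_top. window_dist R h (ST w) \<le> 1"
    by (rule approximableE[OF h zero_less_one])
  let ?n = "sqrt (LINT x|lebesgue_on {0..}. (norm (w x))\<^sup>2)"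
  have "\<forall>\<^sub>F R in at_top. window_norm R h \<le> ?n + 2"
    using w(2) transform_bound[OF w(1) zero_less_one] eventually_ge_at_top[of 0]
  proof eventually_elim
    case (elim R)
    have "window_norm R (\<lambda>l. (h l - ST w l) + ST w l) \<le> window_dist R h (ST w) + window_norm R (ST w)"
      by (intro window_norm_triangle continuous_intros continuous_on_spectral_transform w approximable_continuous h elim)
    then show ?case using elim by simp
  qed
  moreover have "?n \<ge> 0" by simp
  ultimately show thesis using that[of "?n + 2"] by simp
qed

lemma approximable_closed:
  assumes h: "continuous_on UNIV h"
    and lim: "\<And>e. e > 0 \<Longrightarrow> \<exists>h'. approximable h' \<and> (\<forall>\<^sub>F R in at_top. window_dist R h h' \<le> e)"
  shows "approximable h"
  unfolding approximable_def
proof (intro conjI h allI impI)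
  fix e :: real assume "e > 0"
  then have e2: "e / 2 > 0" by simp
  obtain h' where h': "approximable h'" "\<forall>\<^sub>F R in at_top. window_dist R h h' \<le> e / 2"
    using lim[OF e2] by blast
  obtain w where w: "w \<in> test_functions" "\<forall>\<^sub>F R in at_top. window_dist R h' (ST w) \<le> e / 2"
    by (rule approximableE[OF h'(1) e2])
  have "\<forall>\<^sub>F R in at_top. window_dist R h (ST w) \<le> e"
    using h'(2) w(2) eventually_ge_at_top[of 0]
  proof eventually_elim
    case (elim R)
    have "window_dist R h (ST w) \<le> window_dist R h h' + window_dist R h' (ST w)"
      by (intro window_norm_triangle3 continuous_on_spectral_transform w h approximable_continuous h' elim)
    then show ?case using elim by simp
  qed
  with w(1) show "\<exists>w\<in>test_functions. \<forall>\<^sub>F R in at_top. window_dist R h (ST w) \<le> e" by blast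
qed

lemma approximable_add:
  assumes g: "approximable g" and h: "approximable h"
  shows "approximable (\<lambda>l. g l + h l)"
  unfolding approximable_def
proof (intro conjI continuous_on_add approximable_continuous g h allI impI)
  fix e :: real assume "e > 0"
  then have e2: "e / 2 > 0" by simp
  obtain v where v: "v \<in> test_functions" "\<forall>\<^sub>F R in at_top. window_dist R g (ST v) \<le> e / 2"
    by (rule approximableE[OF g e2])
  obtain w where w: "w \<in> test_functions" "\<forall>\<^sub>F R in at_top. window_dist R h (ST w) \<le> e / 2"
    by (rule approximableE[OF h e2])
  have "\<forall>\<^sub>F R in at_top. window_norm R (\<lambda>l. g l + h l - ST (\<lambda>x. v x + w x) l) \<le> e"
    using v(2) w(2) eventually_ge_at_top[of 0]
  proof eventually_elim
    case (elim R)
    have "window_norm R (\<lambda>l. (g l - ST v l) + (h l - ST w l)) \<le> window_dist R g (ST v) + window_dist R h (ST w)"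
      by (intro window_norm_triangle continuous_intros continuous_on_spectral_transform v w approximable_continuous g h elim)
    then show ?case using elim by (simp add: spectral_transform_add v w algebra_simps)
  qed
  then show "\<exists>w\<in>test_functions. \<forall>\<^sub>F R in at_top. window_norm R (\<lambda>l. g l + h l - ST w l) \<le> e"
    using test_functions_add[OF v(1) w(1)] by blast
qed

lemma approximable_smult:
  assumes h: "approximable h"
  shows "approximable (\<lambda>l. c *s h l)"
  unfolding approximable_def
proof (intro conjI continuous_on_smult_const approximable_continuous h allI impI)
  fix e :: real assume "e > 0"
  then have e2: "e / (norm c + 1) > 0" by (simp add: add_nonneg_pos)
  obtain w where w: "w \<in> test_functions" "\<forall>\<^sub>F R in at_top. window_dist R h (ST w) \<le> e / (norm c + 1)"
    by (rule approximableE[OF h e2])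
  have "\<forall>\<^sub>F R in at_top. window_norm R (\<lambda>l. c *s h l - ST (\<lambda>x. c *s w x) l) \<le> e"
    using w(2) eventually_ge_at_top[of 0]
  proof eventually_elim
    case (elim R)
    have "window_norm R (\<lambda>l. c *s (h l - ST w l)) \<le> norm c * window_dist R h (ST w)"
      by (intro window_norm_scale continuous_intros continuous_on_spectral_transform w approximable_continuous h elim) simp
    also have "\<dots> \<le> norm c * (e / (norm c + 1))" by (intro mult_left_mono elim) simp
    also have "\<dots> \<le> e"
    proof -
      have "norm c + 1 > 0" by (simp add: add_nonneg_pos)
      then show ?thesis using \<open>e > 0\<close> by (simp add: divide_le_eq algebra_simps)
    qed
    finally show ?case by (simp add: spectral_transform_smult w vector_ssub_ldistrib)
  qed
  then show "\<exists>w\<in>test_functions. \<forall>\<^sub>F R in at_top. window_norm R (\<lambda>l. c *s h l - ST w l) \<le> e"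
    using test_functions_smult[OF w(1)] by blast
qed

lemma approximable_sum:
  "finite I \<Longrightarrow> (\<And>i. i \<in> I \<Longrightarrow> approximable (f i)) \<Longrightarrow> approximable (\<lambda>l. \<Sum>i\<in>I. f i l)"
proof (induction I rule: finite_induct)
  case empty
  have "approximable (ST (\<lambda>_. 0))"
    by (intro approximable_transform) (auto simp: test_functions_def intro: exI[of _ 0])
  moreover have "ST (\<lambda>_. 0) = (\<lambda>_. 0)" by (simp add: spectral_transform_def fun_eq_iff)
  ultimately show ?case by simp
qed (auto intro!: approximable_add)

text \<open>If \<open>h\<close> is close to \<open>ST f\<close> and
  \<open>ST f = (l - z) ST w + ST e\<close>, then \<open>r h - ST w = r (h - ST f) + r ST e\<close>,
  and \<open>|r| \<le> 1\<close> enlarges neither error.\<close>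

lemma approximable_resolvent:
  assumes h: "approximable h" and s: "s \<in> {1, -1}"
  shows "approximable (\<lambda>l. (1 / (of_real l - of_real s * \<i>)) *s h l)"
proof -
  define r where "r l = 1 / (of_real l - of_real s * \<i>)" for l
  \<comment> \<open>A real number has distance at least 1 from \<open>\<plusminus>\<i>\<close>; this
    gives both the nonzero denominator and the bound on \<open>r\<close>.\<close>
  have Im: "\<bar>Im (of_real l - of_real s * \<i>)\<bar> = 1" for l using s by auto
  then have nz: "of_real l - of_real s * \<i> \<noteq> 0" for l
    by (metis abs_zero zero_complex.simps(2) zero_neq_one)
  have r_cont: "continuous_on UNIV r" unfolding r_def by (intro continuous_intros) (use nz in auto)
  have r1: "norm (r l) \<le> 1" for l
    using abs_Im_le_cmod[of "of_real l - of_real s * \<i>"] Im[of l]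
    unfolding r_def norm_divide by (simp add: divide_le_eq)
  have "approximable (\<lambda>l. r l *s h l)"
    unfolding approximable_def
  proof (intro conjI continuous_on_smult r_cont approximable_continuous h allI impI)
    fix \<epsilon> :: real assume "\<epsilon> > 0"
    then have e: "\<epsilon> / 3 > 0" "(\<epsilon> / 3)\<^sup>2 > 0" by simp_all
    obtain f where f: "f \<in> test_functions" "\<forall>\<^sub>F R in at_top. window_dist R h (ST f) \<le> \<epsilon> / 3"
      by (rule approximableE[OF h e(1)])
    obtain w e where w: "w \<in> test_functions" "e \<in> test_functions"
      "(LINT x|lebesgue_on {0..}. (norm (e x))\<^sup>2) \<le> (\<epsilon> / 3)\<^sup>2"
      "\<And>l. ST f l = (of_real l - of_real s * \<i>) *s ST w l + ST e l"
      using approximate_resolvent[OF s f(1) e(2)] by blast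
    have n: "sqrt (LINT x|lebesgue_on {0..}. (norm (e x))\<^sup>2) \<le> \<epsilon> / 3"
      using real_sqrt_le_mono[OF w(3)] \<open>\<epsilon> > 0\<close> by simp
    have "\<forall>\<^sub>F R in at_top. window_norm R (\<lambda>l. r l *s h l - ST w l) \<le> \<epsilon>"
      using f(2) transform_bound[OF w(2) e(1)] eventually_ge_at_top[of 0]
    proof eventually_elim
      case (elim R)
      have c1: "continuous_on UNIV (\<lambda>l. h l - ST f l)"
        by (intro continuous_intros continuous_on_spectral_transform f approximable_continuous h)
      have c2: "continuous_on UNIV (ST e)" by (rule continuous_on_spectral_transform[OF w(2)])
      have "r l *s h l - ST w l = r l *s (h l - ST f l) + r l *s ST e l" for l
      proof -
        have "r l *s ST f l = (r l * (of_real l - of_real s * \<i>)) *s ST w l + r l *s ST e l"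
          by (simp only: w(4) vector_add_ldistrib vector_smult_assoc)
        also have "r l * (of_real l - of_real s * \<i>) = 1" using nz by (simp add: r_def)
        finally show ?thesis by (simp add: vector_ssub_ldistrib)
      qed
      then have "window_norm R (\<lambda>l. r l *s h l - ST w l) = window_norm R (\<lambda>l. r l *s (h l - ST f l) + r l *s ST e l)"
        by (simp only:)
      also have "\<dots> \<le> window_norm R (\<lambda>l. r l *s (h l - ST f l)) + window_norm R (\<lambda>l. r l *s ST e l)"
        by (intro window_norm_triangle continuous_on_smult r_cont c1 c2 elim)
      also have "\<dots> \<le> 1 * window_dist R h (ST f) + 1 * window_norm R (ST e)"
        by (intro add_mono window_norm_scale c1 c2 r_cont r1 elim)
      finally show ?case using elim n by simp
    qed
    with w(1) show "\<exists>w\<in>test_functions. \<forall>\<^sub>F R in at_top. window_norm R (\<lambda>l. r l *s h l - ST w l) \<le> \<epsilon>" by blast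
  qed
  then show ?thesis by (simp add: r_def)
qed

text \<open>The first multiplier is the product and the second the half sum of the resolvent factors
  \<open>1/(l - \<i>)\<close> and \<open>1/(l + \<i>)\<close>.\<close>

lemma approximable_coordinates:
  assumes h: "approximable h"
  shows "approximable (\<lambda>l. complex_of_real (1 / (1 + l\<^sup>2)) *s h l)"
    and "approximable (\<lambda>l. complex_of_real (l / (1 + l\<^sup>2)) *s h l)"
proof -
  have nz: "of_real l - \<i> \<noteq> 0" "of_real l + \<i> \<noteq> 0" for l
    by (auto simp: complex_eq_iff)
  have prod: "(of_real l - \<i>) * (of_real l + \<i>) = complex_of_real (1 + l\<^sup>2)" for l
    by (simp add: algebra_simps power2_eq_square)
  have "approximable (\<lambda>l. (1 / (of_real l - \<i>)) *s ((1 / (of_real l + \<i>)) *s h l))"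
    using approximable_resolvent[OF approximable_resolvent[OF h, of "-1"], of 1] by simp
  also have "(\<lambda>l. (1 / (of_real l - \<i>)) *s ((1 / (of_real l + \<i>)) *s h l)) =
      (\<lambda>l. complex_of_real (1 / (1 + l\<^sup>2)) *s h l)"
    by (simp add: vector_smult_assoc prod)
  finally show "approximable (\<lambda>l. complex_of_real (1 / (1 + l\<^sup>2)) *s h l)" .
  have "approximable (\<lambda>l. (1/2) *s ((1 / (of_real l - \<i>)) *s h l + (1 / (of_real l + \<i>)) *s h l))"
    using approximable_smult[OF approximable_add[OF approximable_resolvent[OF h, of 1] approximable_resolvent[OF h, of "-1"]], of "1/2"]
    by simp
  also have "(\<lambda>l. (1/2) *s ((1 / (of_real l - \<i>)) *s h l + (1 / (of_real l + \<i>)) *s h l)) =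
      (\<lambda>l. complex_of_real (l / (1 + l\<^sup>2)) *s h l)"
  proof
    fix l
    have "(1/2) * (1 / (of_real l - \<i>) + 1 / (of_real l + \<i>)) = complex_of_real (l / (1 + l\<^sup>2))"
      using nz[of l] prod[of l] by (simp add: add_frac_eq)
    then show "(1/2) *s ((1 / (of_real l - \<i>)) *s h l + (1 / (of_real l + \<i>)) *s h l) =
      complex_of_real (l / (1 + l\<^sup>2)) *s h l"
      by (metis vector_sadd_rdistrib vector_smult_assoc)
  qed
  finally show "approximable (\<lambda>l. complex_of_real (l / (1 + l\<^sup>2)) *s h l)" .
qed

text \<open>The induction keeps \<open>h\<close> arbitrary because a product acts by applying one
  factor to the result of the other. A linear functional on the plane is a combination of the two
  coordinates.\<close>

lemma approximable_polynomial:
  fixes p :: "real \<times> real \<Rightarrow> real"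
  assumes "real_polynomial_function p" "approximable h"
  shows "approximable (\<lambda>l. complex_of_real (p (1 / (1 + l\<^sup>2), l / (1 + l\<^sup>2))) *s h l)"
  using assms
proof (induction arbitrary: h rule: real_polynomial_function.induct)
  case (linear f)
  have "f (a, b) = a * f (1, 0) + b * f (0, 1)" for a b
  proof -
    have "f (a, b) = f (a *\<^sub>R (1, 0) + b *\<^sub>R (0, 1))" by simp
    then show ?thesis
      using bounded_linear.linear[OF linear(1)] by (simp only: linear_add linear_cmul real_scaleR_def)
  qed
  note split = this
  have *: "complex_of_real (f (1 / (1 + l\<^sup>2), l / (1 + l\<^sup>2))) *s h l =
     complex_of_real (f (1, 0)) *s (complex_of_real (1 / (1 + l\<^sup>2)) *s h l) +
     complex_of_real (f (0, 1)) *s (complex_of_real (l / (1 + l\<^sup>2)) *s h l)" for l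
  proof -
    have "f (1 / (1 + l\<^sup>2), l / (1 + l\<^sup>2)) = 1 / (1 + l\<^sup>2) * f (1, 0) + l / (1 + l\<^sup>2) * f (0, 1)"
      by (rule split)
    then show ?thesis
      by (simp only: of_real_add of_real_mult vector_sadd_rdistrib vector_smult_assoc mult.commute)
  qed
  show ?case unfolding * by (intro approximable_add approximable_smult approximable_coordinates linear)
next
  case (const c)
  then show ?case by (intro approximable_smult)
next
  case (add f g)
  show ?case unfolding of_real_add vector_sadd_rdistrib
    by (intro approximable_add add)
next
  case (mult f g)
  show ?case unfolding of_real_mult vector_smult_assoc[symmetric]
    by (intro mult)
qed

lemma approximable_real_multiplier:
  fixes \<phi> :: "real \<Rightarrow> real"
  assumes \<phi>: "continuous_on UNIV \<phi>" and M: "M > 0" "\<And>l. \<bar>l\<bar> \<ge> M \<Longrightarrow> \<phi> l = 0" and h: "approximable h"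
  shows "approximable (\<lambda>l. complex_of_real (\<phi> l) *s h l)"
proof (rule approximable_closed)
  show "continuous_on UNIV (\<lambda>l. complex_of_real (\<phi> l) *s h l)"
    by (intro continuous_on_smult continuous_intros \<phi> approximable_continuous h)
  fix e :: real assume "e > 0"
  obtain K where K: "K \<ge> 0" "\<forall>\<^sub>F R in at_top. window_norm R h \<le> K" by (rule approximable_bounded[OF h])
  have "e / (K + 1) > 0" using \<open>e > 0\<close> K by simp
  then obtain p where p: "real_polynomial_function p"
    "\<And>l. \<bar>\<phi> l - p (1 / (1 + l\<^sup>2), l / (1 + l\<^sup>2))\<bar> < e / (K + 1)"
    using resolvent_coordinates_approximation[OF \<phi> M] by blast
  let ?p = "\<lambda>l. p (1 / (1 + l\<^sup>2), l / (1 + l\<^sup>2))"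
  have pc: "continuous_on UNIV ?p"
  proof (rule continuous_on_compose2[of UNIV p])
    show "continuous_on UNIV p"
      using p(1) by (simp add: continuous_on_polymonial_function real_polynomial_function_eq)
    have "1 + l\<^sup>2 \<noteq> 0" for l :: real using zero_le_power2[of l] by linarith
    then show "continuous_on UNIV (\<lambda>l :: real. (1 / (1 + l\<^sup>2), l / (1 + l\<^sup>2)))"
      by (intro continuous_intros) auto
  qed simp
  have "\<forall>\<^sub>F R in at_top. window_norm R (\<lambda>l. complex_of_real (\<phi> l) *s h l - complex_of_real (?p l) *s h l) \<le> e"
    using K(2) eventually_ge_at_top[of 0]
  proof eventually_elim
    case (elim R)
    have "window_norm R (\<lambda>l. complex_of_real (\<phi> l - ?p l) *s h l) \<le> e / (K + 1) * window_norm R h"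
      by (intro window_norm_scale approximable_continuous h elim continuous_intros \<phi> pc)
         (use p(2) in \<open>auto simp: less_imp_le simp flip: of_real_diff\<close>)
    also have "\<dots> \<le> e / (K + 1) * K" using elim \<open>e > 0\<close> K by (intro mult_left_mono) auto
    also have "\<dots> \<le> e" using \<open>e > 0\<close> K by (simp add: divide_le_eq algebra_simps)
    finally show ?case by (simp add: vector_sub_rdistrib)
  qed
  then show "\<exists>h'. approximable h' \<and> (\<forall>\<^sub>F R in at_top. window_norm R (\<lambda>l. complex_of_real (\<phi> l) *s h l - h' l) \<le> e)"
    using approximable_polynomial[OF p(1) h] by blast
qed

lemma approximable_multiplier:
  fixes \<phi> :: "real \<Rightarrow> complex"
  assumes \<phi>: "continuous_on UNIV \<phi>" and M: "M > 0" "\<And>l. \<bar>l\<bar> \<ge> M \<Longrightarrow> \<phi> l = 0" and h: "approximable h"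
  shows "approximable (\<lambda>l. \<phi> l *s h l)"
proof -
  have *: "\<phi> l *s h l = complex_of_real (Re (\<phi> l)) *s h l + \<i> *s (complex_of_real (Im (\<phi> l)) *s h l)" for l
    by (simp only: vector_smult_assoc vector_sadd_rdistrib[symmetric] complex_eq[symmetric])
  show ?thesis unfolding *
    by (intro approximable_add approximable_smult approximable_real_multiplier[where M = M] continuous_intros \<phi> h)
       (use M in auto)
qed

text \<open>Transforms of approximate delta functions are near \<open>axis i 1\<close> only for
  bounded \<open>l\<close>; multiplying by \<open>\<phi>\<close> removes the rest. To convert the
  uniform error into a window norm, it is written with small scalar multipliers of the fixed
  functions \<open>E j\<close> in \<open>C0\<close>, whose norms are finite.\<close>

lemma approximable_basis_multiple:
  fixes \<phi> :: "real \<Rightarrow> complex"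
  assumes \<phi>: "continuous_on UNIV \<phi>" and M: "M > 0" "\<And>l. \<bar>l\<bar> \<ge> M \<Longrightarrow> \<phi> l = 0"
  shows "approximable (\<lambda>l. \<phi> l *s axis i 1)"
proof (rule approximable_closed)
  show "continuous_on UNIV (\<lambda>l. \<phi> l *s axis i 1)" by (intro continuous_on_smult \<phi> continuous_intros)
  fix e :: real assume "e > 0"
  have "bounded (\<phi> ` {-M..M})"
    by (intro compact_imp_bounded compact_continuous_image continuous_on_subset[OF \<phi>]) auto
  then obtain A where A: "\<forall>l\<in>{-M..M}. norm (\<phi> l) \<le> A" by (auto simp: bounded_iff)
  then have A0: "A \<ge> 0" using M(1) norm_ge_zero[of "\<phi> 0"] by (meson atLeastAtMost_iff less_imp_le neg_le_0_iff_le order_trans)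
  have A': "norm (\<phi> l) \<le> A" for l
  proof (cases "\<bar>l\<bar> \<ge> M")
    case False
    then have "l \<in> {-M..M}" by auto
    with A show ?thesis by blast
  qed (use M(2) A0 in simp)
  \<comment> \<open>Equal to 1 on \<open>[-M,M]\<close> and 0 beyond \<open>M + 1\<close>, so
    \<open>\<phi> * \<theta> = \<phi>\<close>; it turns the constant basis vectors into members of
    \<open>C0\<close>.\<close>
  define \<theta> where "\<theta> l = complex_of_real (max 0 (min 1 (M + 1 - \<bar>l\<bar>)))" for l
  have \<theta>c: "continuous_on UNIV \<theta>" unfolding \<theta>_def by (intro continuous_intros)
  have \<theta>1: "\<phi> l * \<theta> l = \<phi> l" for l using M(2)[of l] by (cases "\<bar>l\<bar> \<ge> M") (auto simp: \<theta>_def)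
  define E where "E j l = \<theta> l *s axis j (1::complex)" for j :: 'n and l
  have EC: "E j \<in> C0" for j
    unfolding C0_iff E_def
  proof
    show "\<exists>R\<ge>0. \<forall>x. R \<le> \<bar>x\<bar> \<longrightarrow> \<theta> x *s axis j 1 = 0"
      using M(1) by (intro exI[of _ "M + 1"]) (auto simp: \<theta>_def)
  qed (intro continuous_on_smult \<theta>c continuous_intros)
  define N where "N = (\<Sum>j\<in>UNIV. sigma_norm \<sigma> (E j))"
  have N0: "N \<ge> 0" unfolding N_def by (intro sum_nonneg sigma_norm_nonneg EC)
  \<comment> \<open>The total error will be at most \<open>A * d * N\<close>; the \<open>+ 1\<close>
    covers the case \<open>A * N = 0\<close>.\<close>
  define d where "d = e / (A * N + 1)"
  have AN: "A * N + 1 > 0" using A0 N0 by (simp add: add_nonneg_pos)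
  then have d: "d > 0" "A * d * N \<le> e" using \<open>e > 0\<close> by (auto simp: d_def divide_le_eq algebra_simps)
  obtain f where f: "f \<in> test_functions" "\<And>l. \<bar>l\<bar> \<le> M \<Longrightarrow> norm (ST f l - axis i 1) \<le> d"
    using approximate_basis_vector[OF d(1), of M i] by blast
  note fc = continuous_on_spectral_transform[OF f(1)]
  let ?m = "\<lambda>j l. \<phi> l * (axis i 1 - ST f l) $ j"
  have mc: "continuous_on UNIV (?m j)" for j by (intro continuous_intros \<phi> fc)
  have m: "norm (?m j l) \<le> A * d" for j l
  proof (cases "\<bar>l\<bar> \<le> M")
    case True
    have "norm ((axis i 1 - ST f l) $ j) \<le> norm (axis i 1 - ST f l)" by (rule Finite_Cartesian_Product.norm_nth_le)
    also have "\<dots> \<le> d" using f(2)[OF True] by (simp add: norm_minus_commute)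
    finally show ?thesis unfolding norm_mult using A' A0 by (intro mult_mono) auto
  qed (use M(2)[of l] A0 d in auto)
  have eq: "\<phi> l *s axis i 1 - \<phi> l *s ST f l = (\<Sum>j\<in>UNIV. ?m j l *s E j l)" for l
  proof -
    have "\<phi> l *s (axis i 1 - ST f l) = (\<Sum>j\<in>UNIV. ?m j l *s E j l)"
      unfolding vec_eq_iff
    proof
      fix k
      have "(\<Sum>j\<in>UNIV. ?m j l *s E j l) $ k = ?m k l * \<theta> l"
        by (simp add: E_def axis_def if_distrib cong: if_cong)
      also have "\<dots> = (\<phi> l * \<theta> l) * (axis i 1 - ST f l) $ k" by (simp only: mult_ac)
      finally show "(\<phi> l *s (axis i 1 - ST f l)) $ k = (\<Sum>j\<in>UNIV. ?m j l *s E j l) $ k"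
        unfolding \<theta>1 by (simp only: vector_smult_component)
    qed
    then show ?thesis by (simp add: vector_ssub_ldistrib)
  qed
  have "\<forall>\<^sub>F R in at_top. \<forall>j\<in>UNIV. window_norm R (E j) = sigma_norm \<sigma> (E j)"
    by (intro eventually_ball_finite ballI eventually_window_norm_eq EC) simp
  then have "\<forall>\<^sub>F R in at_top. window_norm R (\<lambda>l. \<phi> l *s axis i 1 - \<phi> l *s ST f l) \<le> e"
    using eventually_ge_at_top[of 0]
  proof eventually_elim
    case (elim R)
    have Ec: "continuous_on UNIV (E j)" for j using EC by (rule C0_continuous)
    have "window_norm R (\<lambda>l. \<phi> l *s axis i 1 - \<phi> l *s ST f l) \<le> (\<Sum>j\<in>UNIV. window_norm R (\<lambda>l. ?m j l *s E j l))"
      unfolding eq by (intro window_norm_sum continuous_on_smult mc Ec elim) simp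
    also have "\<dots> \<le> (\<Sum>j\<in>UNIV. (A * d) * window_norm R (E j))"
      by (intro sum_mono window_norm_scale Ec mc m elim)
    also have "\<dots> = A * d * N" using elim by (simp add: N_def sum_distrib_left)
    finally show ?case using d(2) by simp
  qed
  then show "\<exists>h'. approximable h' \<and> (\<forall>\<^sub>F R in at_top. window_norm R (\<lambda>l. \<phi> l *s axis i 1 - h' l) \<le> e)"
    using approximable_multiplier[OF \<phi> M approximable_transform[OF f(1)]] by blast
qed

lemma approximable_C0:
  assumes h: "h \<in> C0" shows "approximable h"
proof -
  obtain R where R: "R \<ge> 0" "\<forall>x. \<bar>x\<bar> \<ge> R \<longrightarrow> h x = 0" using h unfolding C0_iff by blast
  have "approximable (\<lambda>l. \<Sum>i\<in>UNIV. h l $ i *s axis i 1)"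
    by (intro approximable_sum approximable_basis_multiple[where M = "R + 1"] continuous_intros C0_continuous h)
       (use R in auto)
  moreover have "(\<Sum>i\<in>UNIV. h l $ i *s axis i 1) = h l" for l
    by (simp add: vec_eq_iff axis_def if_distrib cong: if_cong)
  ultimately show ?thesis by simp
qed

text \<open>Approximability concerns \<open>ST w\<close> on windows, density concerns
  representatives of \<open>F w\<close>. They meet in one large window where the norm of the
  compactly supported difference \<open>h - u k\<close> has already reached its final value.\<close>

lemma surjective: "F ` L2_half_line = L2_sigma \<sigma>"
proof (rule surjective_if_dense[OF isometric])
  fix h :: "real \<Rightarrow> complex ^ 'n" and e :: real
  assume h: "h \<in> C0" and "e > 0"
  then have e2: "e / 2 > 0" by simp
  obtain w where w: "w \<in> test_functions" "\<forall>\<^sub>F R in at_top. window_dist R h (ST w) \<le> e / 2"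
    by (rule approximableE[OF approximable_C0[OF h] e2])
  obtain u where u: "u \<in> F w" "\<forall>k. u k \<in> C0"
    "\<forall>e>0. \<forall>\<^sub>F k in sequentially. \<forall>\<^sub>F R in at_top. window_dist R (ST w) (u k) < e"
    using transform_representative[OF w(1)] by blast
  have "\<forall>\<^sub>F k in sequentially. sigma_dist h (u k) < e"
    using u(3)[rule_format, OF e2]
  proof eventually_elim
    case (elim k)
    have "\<forall>\<^sub>F R in at_top. window_dist R h (ST w) \<le> e / 2 \<and> window_dist R (ST w) (u k) < e / 2 \<and>
        window_dist R h (u k) = sigma_dist h (u k) \<and> R \<ge> 0"
      by (intro eventually_conj w(2) elim eventually_window_norm_eq C0_diff h u(2)[rule_format] eventually_ge_at_top)
    then obtain R where R: "window_dist R h (ST w) \<le> e / 2" "window_dist R (ST w) (u k) < e / 2"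
        "window_dist R h (u k) = sigma_dist h (u k)" "R \<ge> 0"
      using eventually_happens'[OF trivial_limit_at_top_linorder] by blast
    have "window_dist R h (u k) \<le> window_dist R h (ST w) + window_dist R (ST w) (u k)"
      by (intro window_norm_triangle3 continuous_on_spectral_transform w C0_continuous h u(2)[rule_format] R)
    then show ?case using R by simp
  qed
  moreover have "w \<in> L2_half_line"
    using test_functions_L2[OF w(1)] by (simp add: L2_half_line_compact_def)
  ultimately show "\<exists>w\<in>L2_half_line. \<exists>v\<in>F w. \<forall>\<^sub>F k in sequentially. sigma_dist h (v k) < e"
    using u(1) by blast
qed

end

subsection \<open>Block structure\<close>

definition upper :: "complex ^ ('n + 'n) \<Rightarrow> complex ^ 'n" where
  "upper v = (\<chi> i. v $ Inl i)"

definition lower :: "complex ^ ('n + 'n) \<Rightarrow> complex ^ 'n" where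
  "lower v = (\<chi> i. v $ Inr i)"

lemma sum_UNIV_Plus:
  fixes f :: "'a::finite + 'b::finite \<Rightarrow> 'c::comm_monoid_add"
  shows "(\<Sum>i\<in>UNIV. f i) = (\<Sum>i\<in>UNIV. f (Inl i)) + (\<Sum>i\<in>UNIV. f (Inr i))"
  using sum.Plus[of "UNIV :: 'a set" "UNIV :: 'b set" f] by (simp add: o_def)

lemma vec_eq_halves: "u = v \<longleftrightarrow> upper u = upper v \<and> lower u = lower v"
proof
  assume "upper u = upper v \<and> lower u = lower v"
  then have "u $ i = v $ i" for i by (cases i) (auto simp: upper_def lower_def vec_eq_iff)
  then show "u = v" by (simp add: vec_eq_iff)
qed simp

lemma cinner_halves:
  fixes u v :: "complex ^ ('n::finite + 'n)"
  shows "cinner u v = cinner (upper u) (upper v) + cinner (lower u) (lower v)"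
  by (simp add: cinner_def upper_def lower_def sum_UNIV_Plus)

lemma block_diag_mult:
  fixes A D :: "complex ^ 'n::finite ^ 'n"
  shows "upper (block_diag A D *v v) = A *v upper v" "lower (block_diag A D *v v) = D *v lower v"
  by (simp_all add: vec_eq_iff upper_def lower_def block_diag_def matrix_vector_mult_def sum_UNIV_Plus)

lemma block_col_mult:
  fixes A C :: "complex ^ 'n::finite ^ 'n"
  shows "upper (block_col A C *v c) = A *v c" "lower (block_col A C *v c) = C *v c"
  by (simp_all add: vec_eq_iff upper_def lower_def block_col_def matrix_vector_mult_def)

lemma self_adjoint_block_diag:
  assumes "self_adjoint A" "self_adjoint D"
  shows "self_adjoint (block_diag A D)"
  unfolding self_adjoint_def vec_eq_iff
proof (intro allI)
  fix i j :: "'a + 'a"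
  show "cadjoint (block_diag A D) $ i $ j = block_diag A D $ i $ j"
    using assms by (cases i; cases j) (auto simp: self_adjoint_def cadjoint_def block_diag_def vec_eq_iff)
qed

lemma matrix_vector_mult_uminus: "(- A) *v (v :: complex ^ 'n::finite) = - (A *v v)"
  by (simp add: matrix_vector_mult_def vec_eq_iff sum_negf)

lemma pos_def_mult_eq_0: "pos_def A \<Longrightarrow> A *v v = 0 \<Longrightarrow> v = 0"
  unfolding pos_def_def by (metis Re_cinner inner_zero_right less_irrefl)

lemma pos_def_nonneg: "pos_def A \<Longrightarrow> 0 \<le> v \<bullet> (A *v v)"
  unfolding pos_def_def Re_cinner by (cases "v = 0") (auto intro: less_imp_le)

theorem theorem3p7:
  fixes B1 B2 H :: "complex ^ 'n::finite ^ 'n"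
    and Q :: "real \<Rightarrow> complex ^ ('n + 'n) ^ ('n + 'n)"
    and Y :: "real \<Rightarrow> complex \<Rightarrow> complex ^ 'n ^ ('n + 'n)"
    and \<sigma> :: "real \<Rightarrow> complex ^ 'n ^ 'n"
    and F :: "(real \<Rightarrow> complex ^ ('n + 'n)) \<Rightarrow> (nat \<Rightarrow> real \<Rightarrow> complex ^ 'n) set"
  assumes "pos_def B1" and "pos_def B2"
    and "B1 = cadjoint H ** B2 ** H"
    and "continuous_on {0..} Q" and "\<And>x. x \<ge> 0 \<Longrightarrow> self_adjoint (Q x)"
    and "\<And>lam. solves_system (block_diag B1 (- B2)) Q lam (\<lambda>x. Y x lam)"
    and "\<And>lam. Y 0 lam = block_col (mat 1) H"
    and "is_spectral_function Y \<sigma>"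
    and "isometric_extension Y \<sigma> F"
  shows "F ` L2_half_line = L2_sigma \<sigma>"
proof -
  let ?B = "block_diag B1 (- B2)" and ?Y0 = "block_col (mat 1) H"
  \<comment> \<open>For \<open>s = 1\<close> the lower half vanishes at \<open>R\<close>, leaving
    the nonnegative part with \<open>B1\<close>; for \<open>s = -1\<close> the upper half vanishes,
    leaving the part with \<open>- B2\<close>, whose sign \<open>s\<close> corrects.\<close>
  define P :: "real \<Rightarrow> complex ^ ('n + 'n) \<Rightarrow> complex ^ 'n" where
    "P s = (if s = 1 then lower else upper)" for s
  have form: "cinner u (?B *v v) = cinner (upper u) (B1 *v upper v) - cinner (lower u) (B2 *v lower v)" for u v
    using cinner_diff_right[of "lower u" 0 "B2 *v lower v"]
    by (simp add: cinner_halves block_diag_mult matrix_vector_mult_uminus cinner_def)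
  have real_form: "v \<bullet> (?B *v v) = upper v \<bullet> (B1 *v upper v) - lower v \<bullet> (B2 *v lower v)" for v
    unfolding Re_cinner[symmetric] form by simp
  interpret boundary_system ?B Q Y ?Y0 P
  proof (rule boundary_system.intro)
    show "self_adjoint ?B"
      using assms(1,2) by (intro self_adjoint_block_diag) (auto simp: pos_def_def self_adjoint_def cadjoint_def vec_eq_iff)
    show "v = 0" if "?B *v v = 0" for v
    proof -
      have "B1 *v upper v = 0" "- (B2 *v lower v) = 0"
        using that block_diag_mult[of B1 "- B2" v]
        by (auto simp: matrix_vector_mult_uminus upper_def lower_def vec_eq_iff)
      then have "upper v = 0" "lower v = 0" using pos_def_mult_eq_0 assms(1,2) by auto
      then show ?thesis by (simp add: vec_eq_halves[of v 0]) (simp add: upper_def lower_def vec_eq_iff)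
    qed
    \<comment> \<open>On the range of \<open>?Y0\<close> the form equals
      \<open>cinner c ((B1 - cadjoint H ** B2 ** H) *v d)\<close>; the relation between
      \<open>B1\<close>, \<open>B2\<close> and \<open>H\<close> says that this is 0.\<close>
    show "cinner (?Y0 *v c) (?B *v (?Y0 *v d)) = 0" for c d
    proof -
      have "cinner (H *v c) (B2 *v (H *v d)) = cinner c ((cadjoint H ** B2 ** H) *v d)"
        by (metis cinner_cadjoint cnj_cinner matrix_vector_mul_assoc)
      then show ?thesis by (simp add: form block_col_mult flip: assms(3))
    qed
    show "linear (P s)" for s
      by (auto intro!: linearI simp: P_def upper_def lower_def vec_eq_iff)
    show "0 \<le> s * (v \<bullet> (?B *v v))" if "s \<in> {1, -1}" "P s v = 0" for s v
      using that pos_def_nonneg[OF assms(1), of "upper v"] pos_def_nonneg[OF assms(2), of "lower v"]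
      unfolding real_form P_def by (auto split: if_splits)
    \<comment> \<open>The adjoint of \<open>?Y0\<close> sends a vector with lower half 0 to its
      upper half, because the upper block of \<open>?Y0\<close> is the identity.\<close>
    show "\<exists>v. cadjoint ?Y0 *v v = axis i 1" for i
    proof (intro exI cinner_eqI)
      fix c
      have "cinner c (cadjoint ?Y0 *v (block_col (mat 1) 0 *v axis i 1)) = cinner (?Y0 *v c) (block_col (mat 1) 0 *v axis i 1)"
        by (metis cinner_cadjoint cnj_cinner)
      then show "cinner c (cadjoint ?Y0 *v (block_col (mat 1) 0 *v axis i 1)) = cinner c (axis i 1)"
        by (simp add: cinner_halves block_col_mult) (simp add: cinner_def)
    qed
  qed (use assms in auto)
  interpret spectral_matrix \<sigma>
    using assms(8) by (intro spectral_matrix.intro) (auto simp: is_spectral_function_def)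
  interpret isometric_boundary_system ?B Q Y ?Y0 P \<sigma> F
    by unfold_locales (rule assms(9))
  show ?thesis by (rule surjective)
qed

end
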